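(* Let $E=\mathbb Z^2$ with basis $e_0,e_1$ and $W=\mathbb Z$. Among the $256$ sign tensors $\mu:E^{\otimes3}\to W$ (all structure constants $\mu_{abc}=\mu(e_a,e_b,e_c)\in\{\pm1\}$, $a,b,c\in\{0,1\}$), the triples $(\operatorname{rank}_{\mathbb Q}\Theta_\mu,\ \operatorname{rank}_{\mathbb Z}Q_\mu,\ \operatorname{tors}Q_\mu)$ occur with exactly the following multiplicities: - $\operatorname{rank}\Theta_\mu=2$, $Q_\mu\cong\mathbb Z/2\mathbb Z$, $\mathfrak D(T_\mu,\mathbb Z)\cong\mathbb Z^2\oplus\mathbb Z/2\mathbb Z$: $224$ tensors; - $\operatorname{rank}\Theta_\mu=1$, $Q_\mu\cong\mathbb Z/2\mathbb Z$, $\mathfrak D(T_\mu,\mathbb Z)\cong\mathbb Z^3\oplus\mathbb Z/2\mathbb Z$: $28$ tensors; - $\operatorname{rank}\Theta_\mu=1$, $Q_\mu\cong\mathbb Z$, $\mathfrak D(T_\mu,\mathbb Z)\cong\mathbb Z^4$: $4$ tensors. The four torsion-free exceptional tensors are, up to a global sign, $\mu_{abc}=1$ and $\mu_{abc}=(-1)^{a+b+c}$ $(a,b,c\in\{0,1\})$. Every remaining sign tensor has a nonzero $2$-primary middle-relation defect, i.e. $\operatorname{tors}(Q_\mu)$ has nonzero $2$-primary part.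
   Context: For $\mu:E^{\otimes3}\to W$ define $\Theta_\mu:E\otimes E\to\operatorname{Hom}_{\mathbb Z}(E,W)$ by $\Theta_\mu(a\otimes b)(c)=\mu(a,b,c)$; $B_\mu:E^{\otimes4}\to(W\otimes E)\oplus(E\otimes W)$ by $B_\mu(a\otimes b\otimes c\otimes d)=\mu(a,b,c)\otimes d-a\otimes\mu(b,c,d)$; and $Q_\mu=\operatorname{coker}B_\mu$. $\operatorname{tors}$ denotes the torsion subgroup. $T_\mu=E\oplus W$ with $\Gamma=\mathbb Z$ and ternary operation $(x+u)\,n\,(y+v)\,m\,(z+w)=nm\,\mu(x,y,z)$ ($x,y,z\in E$; $u,v,w\in W$). The universal operator rng $\mathcal O(T,\Gamma)$ is the quotient of $T\otimes_{\mathbb Z}\Gamma\otimes_{\mathbb Z}T\otimes_{\mathbb Z}\Gamma$, with multiplication $(a\otimes\alpha\otimes b\otimes\beta)(c\otimes\gamma\otimes d\otimes\delta)=(a\alpha b\beta c)\otimes\gamma\otimes d\otimes\delta$, by the two-sided ideal generated by all $(a\alpha b\beta c)\otimes\gamma\otimes d\otimes\delta-a\otimes\alpha\otimes(b\beta c\gamma d)\otimes\delta$. The operator defect $\mathfrak D(T_\mu,\mathbb Z)$ is the kernel of the regular representation $\mathcal O(T_\mu,\mathbb Z)\to\operatorname{End}_{\mathbb Z}(T_\mu)$, $[a,\alpha,b,\beta]\mapsto(x\mapsto a\alpha b\beta x)$, where $[a,\alpha,b,\beta]$ is the class of $a\otimes\alpha\otimes b\otimes\beta$. *)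

theory Defs
  imports
    "HOL-Algebra.Algebra"
    "HOL-Library.Extended_Nat"
    "HOL-Library.Function_Algebras"
    "HOL-Library.Product_Plus"
begin

definition additive_group :: "'a::ab_group_add monoid"
  where "additive_group = \<lparr>carrier = UNIV, monoid.mult = (+), one = 0\<rparr>"

lemma carrier_additive_group [simp]: "carrier additive_group = UNIV"
  and mult_additive_group [simp]: "x \<otimes>\<^bsub>additive_group\<^esub> y = x + y"
  and one_additive_group [simp]: "\<one>\<^bsub>additive_group\<^esub> = 0"
  by (simp_all add: additive_group_def)

lemma comm_group_additive_group [simp]: "comm_group additive_group"
  by (rule comm_groupI) (auto simp: algebra_simps intro: exI[of _ "- x" for x] right_minus)

lemma group_additive_group [simp]: "group additive_group"
  by (simp add: comm_group.axioms(2))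

lemma inv_additive_group [simp]: "inv\<^bsub>additive_group\<^esub> x = - x"
  by (rule group.inv_equality) auto

section \<open>Tensor products over the integers\<close>

definition tensor_relators :: "('a::ab_group_add \<times> 'b::ab_group_add \<Rightarrow>\<^sub>0 int) set" where
  "tensor_relators =
     {frag_of (a + a', b) - frag_of (a, b) - frag_of (a', b) |a a' b. True} \<union>
     {frag_of (a, b + b') - frag_of (a, b) - frag_of (a, b') |a b b'. True}"

definition tensor_kernel :: "('a::ab_group_add \<times> 'b::ab_group_add \<Rightarrow>\<^sub>0 int) set" where
  "tensor_kernel = generate additive_group tensor_relators"

lemma subgroup_tensor_kernel: "subgroup tensor_kernel additive_group"
  unfolding tensor_kernel_def by (rule group.generate_is_subgroup) auto

lemma tensor_kernel_0: "0 \<in> tensor_kernel"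
  using subgroup.one_closed[OF subgroup_tensor_kernel] by simp

lemma tensor_kernel_add: "x \<in> tensor_kernel \<Longrightarrow> y \<in> tensor_kernel \<Longrightarrow> x + y \<in> tensor_kernel"
  using subgroup.m_closed[OF subgroup_tensor_kernel] by fastforce

lemma tensor_kernel_minus: "x \<in> tensor_kernel \<Longrightarrow> - x \<in> tensor_kernel"
  using subgroup.m_inv_closed[OF subgroup_tensor_kernel] by fastforce

definition tensor_rel ::
    "('a::ab_group_add \<times> 'b::ab_group_add \<Rightarrow>\<^sub>0 int) \<Rightarrow> ('a \<times> 'b \<Rightarrow>\<^sub>0 int) \<Rightarrow> bool" where
  "tensor_rel x y \<longleftrightarrow> x - y \<in> tensor_kernel"

lemma equivp_tensor_rel:
  "equivp (tensor_rel :: ('a::ab_group_add \<times> 'b::ab_group_add \<Rightarrow>\<^sub>0 int) \<Rightarrow> _)"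
proof (rule equivpI)
  show "reflp (tensor_rel :: ('a \<times> 'b \<Rightarrow>\<^sub>0 int) \<Rightarrow> _)"
    by (simp add: reflp_def tensor_rel_def tensor_kernel_0)
  show "symp (tensor_rel :: ('a \<times> 'b \<Rightarrow>\<^sub>0 int) \<Rightarrow> _)"
  proof (rule sympI)
    fix x y :: "'a \<times> 'b \<Rightarrow>\<^sub>0 int"
    assume "tensor_rel x y"
    then show "tensor_rel y x"
      unfolding tensor_rel_def using tensor_kernel_minus[of "x - y"] by simp
  qed
  show "transp (tensor_rel :: ('a \<times> 'b \<Rightarrow>\<^sub>0 int) \<Rightarrow> _)"
  proof (rule transpI)
    fix x y z :: "'a \<times> 'b \<Rightarrow>\<^sub>0 int"
    assume "tensor_rel x y" "tensor_rel y z"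
    then show "tensor_rel x z"
      unfolding tensor_rel_def using tensor_kernel_add[of "x - y" "y - z"] by simp
  qed
qed

quotient_type (overloaded) ('a, 'b) tensor (infixl "\<otimes>\<^sub>\<int>" 70) =
  "('a::ab_group_add \<times> 'b::ab_group_add) \<Rightarrow>\<^sub>0 int" / tensor_rel
  by (rule equivp_tensor_rel)

instantiation tensor :: (ab_group_add, ab_group_add) ab_group_add
begin

lift_definition zero_tensor :: "'a \<otimes>\<^sub>\<int> 'b" is 0 .

lift_definition plus_tensor :: "'a \<otimes>\<^sub>\<int> 'b \<Rightarrow> 'a \<otimes>\<^sub>\<int> 'b \<Rightarrow> 'a \<otimes>\<^sub>\<int> 'b" is "(+)"
proof -
  fix x x' y y' :: "'a \<times> 'b \<Rightarrow>\<^sub>0 int"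
  assume "tensor_rel x x'" "tensor_rel y y'"
  then show "tensor_rel (x + y) (x' + y')"
    unfolding tensor_rel_def using tensor_kernel_add[of "x - x'" "y - y'"]
    by (simp add: add_diff_add)
qed

lift_definition uminus_tensor :: "'a \<otimes>\<^sub>\<int> 'b \<Rightarrow> 'a \<otimes>\<^sub>\<int> 'b" is uminus
proof -
  fix x y :: "'a \<times> 'b \<Rightarrow>\<^sub>0 int"
  assume "tensor_rel x y"
  then show "tensor_rel (- x) (- y)"
    unfolding tensor_rel_def using tensor_kernel_minus[of "x - y"] by simp
qed

definition minus_tensor :: "'a \<otimes>\<^sub>\<int> 'b \<Rightarrow> 'a \<otimes>\<^sub>\<int> 'b \<Rightarrow> 'a \<otimes>\<^sub>\<int> 'b" where
  "minus_tensor x y = x + - y"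

instance
proof
  fix a b c :: "'a \<otimes>\<^sub>\<int> 'b"
  show "a + b + c = a + (b + c)"
    by transfer (simp add: tensor_rel_def tensor_kernel_0 add.assoc)
  show "a + b = b + a"
    by transfer (simp add: tensor_rel_def tensor_kernel_0 add.commute)
  show "0 + a = a"
    by transfer (simp add: tensor_rel_def tensor_kernel_0)
  show "- a + a = 0"
    by transfer (simp add: tensor_rel_def tensor_kernel_0)
  show "a - b = a + - b"
    by (simp add: minus_tensor_def)
qed

end

lift_definition tensor_elem :: "'a::ab_group_add \<Rightarrow> 'b::ab_group_add \<Rightarrow> 'a \<otimes>\<^sub>\<int> 'b"
    (infixl "\<otimes>\<^sub>\<int>" 70)
  is "\<lambda>a b. frag_of (a, b)" .

lemma tensor_add_left: "(a + a') \<otimes>\<^sub>\<int> b = a \<otimes>\<^sub>\<int> b + a' \<otimes>\<^sub>\<int> b"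
proof transfer
  fix a a' :: 'a and b :: 'b
  have "frag_of (a + a', b) - frag_of (a, b) - frag_of (a', b) \<in> tensor_relators"
    unfolding tensor_relators_def by blast
  then show "tensor_rel (frag_of (a + a', b)) (frag_of (a, b) + frag_of (a', b))"
    unfolding tensor_rel_def tensor_kernel_def
    using generate.incl by (fastforce simp: diff_diff_add)
qed

lemma tensor_add_right: "a \<otimes>\<^sub>\<int> (b + b') = a \<otimes>\<^sub>\<int> b + a \<otimes>\<^sub>\<int> b'"
proof transfer
  fix a :: 'a and b b' :: 'b
  have "frag_of (a, b + b') - frag_of (a, b) - frag_of (a, b') \<in> tensor_relators"
    unfolding tensor_relators_def by blast
  then show "tensor_rel (frag_of (a, b + b')) (frag_of (a, b) + frag_of (a, b'))"
    unfolding tensor_rel_def tensor_kernel_def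
    using generate.incl by (fastforce simp: diff_diff_add)
qed

lemma tensor_induct [case_names zero elem diff]:
  fixes t :: "'a::ab_group_add \<otimes>\<^sub>\<int> 'b::ab_group_add"
  assumes "P 0" "\<And>a b. P (a \<otimes>\<^sub>\<int> b)" "\<And>s t. P s \<Longrightarrow> P t \<Longrightarrow> P (s - t)"
  shows "P t"
proof -
  have eq: "s - t = s + - t" for s t :: "'a \<otimes>\<^sub>\<int> 'b"
    by simp
  have "P (abs_tensor x)" for x :: "'a \<times> 'b \<Rightarrow>\<^sub>0 int"
    using subset_UNIV
  proof (induction x rule: frag_induction)
    case zero
    show ?case using assms(1) by (simp add: zero_tensor_def)
  next
    case (one x)
    show ?case using assms(2)[of "fst x" "snd x"] by (simp add: tensor_elem.abs_eq)
  next
    case (diff a b)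
    have "abs_tensor (a - b) = abs_tensor a - abs_tensor b"
      unfolding eq by (simp add: plus_tensor.abs_eq uminus_tensor.abs_eq)
    then show ?case using diff assms(3) by simp
  qed
  from this[of "rep_tensor t"] show ?thesis
    by (simp add: Quotient3_abs_rep[OF Quotient3_tensor])
qed

lemma additive_eq_on_tensorsI:
  fixes g h :: "'a::ab_group_add \<otimes>\<^sub>\<int> 'b::ab_group_add \<Rightarrow> 'c::ab_group_add"
  assumes "additive g" "additive h" "\<And>a b. g (a \<otimes>\<^sub>\<int> b) = h (a \<otimes>\<^sub>\<int> b)"
  shows "g = h"
proof
  fix t
  show "g t = h t"
    by (induction t rule: tensor_induct)
      (simp_all add: assms additive.zero additive.diff)
qed

lemma tensor_universal:
  fixes f :: "'a::ab_group_add \<Rightarrow> 'b::ab_group_add \<Rightarrow> 'c::ab_group_add"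
  assumes left: "\<And>b. additive (\<lambda>a. f a b)" and right: "\<And>a. additive (f a)"
  shows "\<exists>h. additive h \<and> (\<forall>a b. h (a \<otimes>\<^sub>\<int> b) = f a b)"
proof -
  obtain h where h: "h \<in> hom (free_Abelian_group UNIV) (additive_group :: 'c monoid)"
    and h_frag: "\<And>x. h (frag_of x) = case_prod f x"
    using comm_group.free_Abelian_group_universal
      [OF comm_group_additive_group, of "case_prod f" UNIV]
    by auto
  have h_add: "additive h"
    using h by (auto simp: hom_def additive_def)
  interpret h: additive h by (rule h_add)
  have "subgroup {x. h x = 0} additive_group"
    by (rule group.subgroupI) (auto simp: h.add h.minus intro: exI[of _ 0] h.zero)
  moreover have "tensor_relators \<subseteq> {x. h x = 0}"
    using additive.add[OF left] additive.add[OF right]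
    by (auto simp: tensor_relators_def h.diff h_frag)
  ultimately have "tensor_kernel \<subseteq> {x. h x = 0}"
    unfolding tensor_kernel_def by (intro group.generate_subgroup_incl) auto
  then have resp: "h x = h y" if "tensor_rel x y" for x y
    using that by (auto simp: tensor_rel_def h.diff)
  define g where "g t = h (rep_tensor t)" for t
  have g_abs: "g (abs_tensor x) = h x" for x
    unfolding g_def
    by (rule resp) (simp add: Quotient3_rep_abs[OF Quotient3_tensor]
        equivp_reflp[OF equivp_tensor_rel])
  have "additive g"
  proof
    fix s t
    have "g (abs_tensor (rep_tensor s) + abs_tensor (rep_tensor t)) = g s + g t"
      by (simp add: plus_tensor.abs_eq g_abs h.add) (simp add: g_def)
    then show "g (s + t) = g s + g t"
      by (simp add: Quotient3_abs_rep[OF Quotient3_tensor])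
  qed
  moreover have "g (a \<otimes>\<^sub>\<int> b) = f a b" for a b
    by (simp add: tensor_elem.abs_eq g_abs h_frag)
  ultimately show ?thesis by blast
qed

definition quadriadditive ::
    "('a::ab_group_add \<Rightarrow> 'b::ab_group_add \<Rightarrow> 'c::ab_group_add \<Rightarrow> 'd::ab_group_add
      \<Rightarrow> 'x::ab_group_add) \<Rightarrow> bool" where
  "quadriadditive f \<longleftrightarrow>
     (\<forall>b c d. additive (\<lambda>a. f a b c d)) \<and> (\<forall>a c d. additive (\<lambda>b. f a b c d)) \<and>
     (\<forall>a b d. additive (\<lambda>c. f a b c d)) \<and> (\<forall>a b c. additive (\<lambda>d. f a b c d))"

text \<open>The homomorphism prescribed on pure tensors; meaningful when the prescription is additive
  in each argument, see \<open>tensor4_extend\<close> below.\<close>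

definition tensor4_extend ::
    "('a::ab_group_add \<Rightarrow> 'b::ab_group_add \<Rightarrow> 'c::ab_group_add \<Rightarrow> 'd::ab_group_add
      \<Rightarrow> 'x::ab_group_add) \<Rightarrow> 'a \<otimes>\<^sub>\<int> 'b \<otimes>\<^sub>\<int> 'c \<otimes>\<^sub>\<int> 'd \<Rightarrow> 'x" where
  "tensor4_extend f =
     (THE h. additive h \<and> (\<forall>a b c d. h (a \<otimes>\<^sub>\<int> b \<otimes>\<^sub>\<int> c \<otimes>\<^sub>\<int> d) = f a b c d))"

lemma additive_tensor_left: "additive h \<Longrightarrow> additive (\<lambda>s. h (s \<otimes>\<^sub>\<int> d))"
  by (simp add: additive_def tensor_add_left)

lemma additive_plus: "additive g \<Longrightarrow> additive h \<Longrightarrow> additive (\<lambda>x. g x + h x)"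
  for g h :: "'a::ab_group_add \<Rightarrow> 'b::ab_group_add"
  by (simp add: additive_def algebra_simps)

lemma additive_eq_on_tensors4I:
  fixes g h :: "'a::ab_group_add \<otimes>\<^sub>\<int> 'b::ab_group_add \<otimes>\<^sub>\<int> 'c::ab_group_add \<otimes>\<^sub>\<int> 'd::ab_group_add
    \<Rightarrow> 'x::ab_group_add"
  assumes g: "additive g" and h: "additive h"
    and eq: "\<And>a b c d. g (a \<otimes>\<^sub>\<int> b \<otimes>\<^sub>\<int> c \<otimes>\<^sub>\<int> d) = h (a \<otimes>\<^sub>\<int> b \<otimes>\<^sub>\<int> c \<otimes>\<^sub>\<int> d)"
  shows "g = h"
proof (rule additive_eq_on_tensorsI[OF g h])
  fix r :: "'a \<otimes>\<^sub>\<int> 'b \<otimes>\<^sub>\<int> 'c" and d :: 'd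
  have gd: "additive (\<lambda>r. g (r \<otimes>\<^sub>\<int> d))" and hd: "additive (\<lambda>r. h (r \<otimes>\<^sub>\<int> d))"
    using g h by (auto intro: additive_tensor_left)
  have "(\<lambda>r. g (r \<otimes>\<^sub>\<int> d)) = (\<lambda>r. h (r \<otimes>\<^sub>\<int> d))"
  proof (rule additive_eq_on_tensorsI[OF gd hd])
    fix s :: "'a \<otimes>\<^sub>\<int> 'b" and c :: 'c
    have "(\<lambda>s. g (s \<otimes>\<^sub>\<int> c \<otimes>\<^sub>\<int> d)) = (\<lambda>s. h (s \<otimes>\<^sub>\<int> c \<otimes>\<^sub>\<int> d))"
      by (rule additive_eq_on_tensorsI
          [OF additive_tensor_left[OF gd] additive_tensor_left[OF hd]]) (rule eq)
    then show "g (s \<otimes>\<^sub>\<int> c \<otimes>\<^sub>\<int> d) = h (s \<otimes>\<^sub>\<int> c \<otimes>\<^sub>\<int> d)"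
      by (rule fun_cong)
  qed
  then show "g (r \<otimes>\<^sub>\<int> d) = h (r \<otimes>\<^sub>\<int> d)"
    by (rule fun_cong)
qed

lemma tensor4_universal:
  fixes f :: "'a::ab_group_add \<Rightarrow> 'b::ab_group_add \<Rightarrow> 'c::ab_group_add \<Rightarrow> 'd::ab_group_add
    \<Rightarrow> 'x::ab_group_add"
  assumes "quadriadditive f"
  shows "\<exists>h. additive h \<and> (\<forall>a b c d. h (a \<otimes>\<^sub>\<int> b \<otimes>\<^sub>\<int> c \<otimes>\<^sub>\<int> d) = f a b c d)"
proof -
  have f_add:
    "f (a + a') b c d = f a b c d + f a' b c d" "f a (b + b') c d = f a b c d + f a b' c d"
    "f a b (c + c') d = f a b c d + f a b c' d" "f a b c (d + d') = f a b c d + f a b c d'"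
    for a a' b b' c c' d d'
    using assms by (simp_all add: quadriadditive_def additive_def)
  have "\<forall>c d. \<exists>h. additive h \<and> (\<forall>a b. h (a \<otimes>\<^sub>\<int> b) = f a b c d)"
    by (intro allI tensor_universal) (simp_all add: additive_def f_add)
  then obtain F where F: "\<And>c d. additive (F c d)"
    and F_pure: "\<And>a b c d. F c d (a \<otimes>\<^sub>\<int> b) = f a b c d"
    by metis
  have F_c: "F (c + c') d s = F c d s + F c' d s" for c c' d s
    using additive_eq_on_tensorsI[OF F additive_plus[OF F F], of "c + c'" d c d c' d]
    by (simp add: F_pure f_add fun_eq_iff)
  have F_d: "F c (d + d') s = F c d s + F c d' s" for c d d' s
    using additive_eq_on_tensorsI[OF F additive_plus[OF F F], of c "d + d'" c d c d']
    by (simp add: F_pure f_add fun_eq_iff)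
  have "\<forall>d. \<exists>h. additive h \<and> (\<forall>s c. h (s \<otimes>\<^sub>\<int> c) = F c d s)"
    using F by (intro allI tensor_universal) (simp_all add: additive_def F_c)
  then obtain G where G: "\<And>d. additive (G d)"
    and G_pure: "\<And>s c d. G d (s \<otimes>\<^sub>\<int> c) = F c d s"
    by metis
  have G_d: "G (d + d') r = G d r + G d' r" for d d' r
    using additive_eq_on_tensorsI[OF G additive_plus[OF G G], of "d + d'" d d']
    by (simp add: G_pure F_d fun_eq_iff)
  have "\<exists>h. additive h \<and> (\<forall>r d. h (r \<otimes>\<^sub>\<int> d) = G d r)"
    using G by (intro tensor_universal) (simp_all add: additive_def G_d)
  then show ?thesis
    by (metis G_pure F_pure)
qed

lemma tensor4_extend:
  assumes "quadriadditive f"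
  shows "additive (tensor4_extend f)"
    and "tensor4_extend f (a \<otimes>\<^sub>\<int> b \<otimes>\<^sub>\<int> c \<otimes>\<^sub>\<int> d) = f a b c d"
proof -
  have "\<exists>!h. additive h \<and> (\<forall>a b c d. h (a \<otimes>\<^sub>\<int> b \<otimes>\<^sub>\<int> c \<otimes>\<^sub>\<int> d) = f a b c d)"
  proof (rule ex_ex1I[OF tensor4_universal[OF assms]])
    fix g h
    assume "additive g \<and> (\<forall>a b c d. g (a \<otimes>\<^sub>\<int> b \<otimes>\<^sub>\<int> c \<otimes>\<^sub>\<int> d) = f a b c d)"
      and "additive h \<and> (\<forall>a b c d. h (a \<otimes>\<^sub>\<int> b \<otimes>\<^sub>\<int> c \<otimes>\<^sub>\<int> d) = f a b c d)"
    then show "g = h"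
      by (intro additive_eq_on_tensors4I) auto
  qed
  from theI'[OF this] show "additive (tensor4_extend f)"
    and "tensor4_extend f (a \<otimes>\<^sub>\<int> b \<otimes>\<^sub>\<int> c \<otimes>\<^sub>\<int> d) = f a b c d"
    unfolding tensor4_extend_def by auto
qed

section \<open>Rank and torsion of abelian groups\<close>

definition int_independent :: "('a, 'm) monoid_scheme \<Rightarrow> 'a set \<Rightarrow> bool" where
  "int_independent G S \<longleftrightarrow> finite S \<and> S \<subseteq> carrier G \<and>
     (\<forall>n :: 'a \<Rightarrow> int. (\<Otimes>\<^bsub>G\<^esub>x\<in>S. x [^]\<^bsub>G\<^esub> n x) = \<one>\<^bsub>G\<^esub> \<longrightarrow> (\<forall>x\<in>S. n x = 0))"

definition int_rank :: "('a, 'm) monoid_scheme \<Rightarrow> enat" where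
  "int_rank G = (SUP S \<in> {S. int_independent G S}. enat (card S))"

definition tors :: "('a, 'm) monoid_scheme \<Rightarrow> ('a, 'm) monoid_scheme" where
  "tors G = G\<lparr>carrier := {x \<in> carrier G. \<exists>n::nat. n > 0 \<and> x [^]\<^bsub>G\<^esub> n = \<one>\<^bsub>G\<^esub>}\<rparr>"

definition primary_part :: "nat \<Rightarrow> ('a, 'm) monoid_scheme \<Rightarrow> 'a set" where
  "primary_part p G = {x \<in> carrier G. \<exists>k::nat. x [^]\<^bsub>G\<^esub> (p ^ k) = \<one>\<^bsub>G\<^esub>}"

section \<open>Invariants of a trilinear map\<close>

definition Theta ::
    "('e::ab_group_add \<otimes>\<^sub>\<int> 'e \<otimes>\<^sub>\<int> 'e \<Rightarrow> 'w::ab_group_add) \<Rightarrow> 'e \<otimes>\<^sub>\<int> 'e \<Rightarrow> 'e \<Rightarrow> 'w" where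
  "Theta \<mu> t c = \<mu> (t \<otimes>\<^sub>\<int> c)"

text \<open>Embedding \<open>Hom(E, \<int>)\<close> into \<open>Hom(E, \<rat>)\<close>, this is the dimension over \<open>\<rat>\<close> of the span of the
  image, i.e.\ of the image of the rational extension of the homomorphism.\<close>

definition rational_rank :: "('a \<Rightarrow> 'e \<Rightarrow> int) \<Rightarrow> nat" where
  "rational_rank h =
     vector_space.dim (\<lambda>(q::rat) (f :: 'e \<Rightarrow> rat) x. q * f x) (range (\<lambda>t x. of_int (h t x)))"

definition middle_map ::
    "('e::ab_group_add \<otimes>\<^sub>\<int> 'e \<otimes>\<^sub>\<int> 'e \<Rightarrow> 'w::ab_group_add)
      \<Rightarrow> 'e \<otimes>\<^sub>\<int> 'e \<otimes>\<^sub>\<int> 'e \<otimes>\<^sub>\<int> 'e \<Rightarrow> ('w \<otimes>\<^sub>\<int> 'e) \<times> ('e \<otimes>\<^sub>\<int> 'w)" where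
  "middle_map \<mu> = tensor4_extend
     (\<lambda>a b c d. (\<mu> (a \<otimes>\<^sub>\<int> b \<otimes>\<^sub>\<int> c) \<otimes>\<^sub>\<int> d, 0) - (0, a \<otimes>\<^sub>\<int> \<mu> (b \<otimes>\<^sub>\<int> c \<otimes>\<^sub>\<int> d)))"

definition middle_coker ::
    "('e::ab_group_add \<otimes>\<^sub>\<int> 'e \<otimes>\<^sub>\<int> 'e \<Rightarrow> 'w::ab_group_add)
      \<Rightarrow> (('w \<otimes>\<^sub>\<int> 'e) \<times> ('e \<otimes>\<^sub>\<int> 'w)) set monoid" where
  "middle_coker \<mu> = additive_group Mod range (middle_map \<mu>)"

lemma middle_map:
  assumes "additive \<mu>"
  shows "additive (middle_map \<mu>)"
    and "middle_map \<mu> (a \<otimes>\<^sub>\<int> b \<otimes>\<^sub>\<int> c \<otimes>\<^sub>\<int> d) =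
      (\<mu> (a \<otimes>\<^sub>\<int> b \<otimes>\<^sub>\<int> c) \<otimes>\<^sub>\<int> d, 0) - (0, a \<otimes>\<^sub>\<int> \<mu> (b \<otimes>\<^sub>\<int> c \<otimes>\<^sub>\<int> d))"
proof -
  have "quadriadditive
      (\<lambda>a b c d. (\<mu> (a \<otimes>\<^sub>\<int> b \<otimes>\<^sub>\<int> c) \<otimes>\<^sub>\<int> d, 0) - (0, a \<otimes>\<^sub>\<int> \<mu> (b \<otimes>\<^sub>\<int> c \<otimes>\<^sub>\<int> d)))"
    using additive.add[OF assms]
    by (simp add: quadriadditive_def additive_def tensor_add_left tensor_add_right)
  then show "additive (middle_map \<mu>)"
    and "middle_map \<mu> (a \<otimes>\<^sub>\<int> b \<otimes>\<^sub>\<int> c \<otimes>\<^sub>\<int> d) =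
      (\<mu> (a \<otimes>\<^sub>\<int> b \<otimes>\<^sub>\<int> c) \<otimes>\<^sub>\<int> d, 0) - (0, a \<otimes>\<^sub>\<int> \<mu> (b \<otimes>\<^sub>\<int> c \<otimes>\<^sub>\<int> d))"
    unfolding middle_map_def by (simp_all add: tensor4_extend)
qed

section \<open>The universal operator rng and the operator defect\<close>

text \<open>Throughout, \<open>p a \<alpha> b \<beta> c\<close> is the ternary operation of \<open>(T, \<Gamma>)\<close>.\<close>

definition operator_action ::
    "('t::ab_group_add \<Rightarrow> 'g::ab_group_add \<Rightarrow> 't \<Rightarrow> 'g \<Rightarrow> 't \<Rightarrow> 't)
      \<Rightarrow> 't \<otimes>\<^sub>\<int> 'g \<otimes>\<^sub>\<int> 't \<otimes>\<^sub>\<int> 'g \<Rightarrow> 't \<Rightarrow> 't" where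
  "operator_action p = tensor4_extend (\<lambda>a \<alpha> b \<beta> x. p a \<alpha> b \<beta> x)"

definition operator_mult ::
    "('t::ab_group_add \<Rightarrow> 'g::ab_group_add \<Rightarrow> 't \<Rightarrow> 'g \<Rightarrow> 't \<Rightarrow> 't)
      \<Rightarrow> 't \<otimes>\<^sub>\<int> 'g \<otimes>\<^sub>\<int> 't \<otimes>\<^sub>\<int> 'g \<Rightarrow> 't \<otimes>\<^sub>\<int> 'g \<otimes>\<^sub>\<int> 't \<otimes>\<^sub>\<int> 'g \<Rightarrow> 't \<otimes>\<^sub>\<int> 'g \<otimes>\<^sub>\<int> 't \<otimes>\<^sub>\<int> 'g" where
  "operator_mult p = tensor4_extend
     (\<lambda>a \<alpha> b \<beta>. tensor4_extend (\<lambda>c \<gamma> d \<delta>. p a \<alpha> b \<beta> c \<otimes>\<^sub>\<int> \<gamma> \<otimes>\<^sub>\<int> d \<otimes>\<^sub>\<int> \<delta>))"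

definition quinqueadditive ::
    "('t::ab_group_add \<Rightarrow> 'g::ab_group_add \<Rightarrow> 't \<Rightarrow> 'g \<Rightarrow> 't \<Rightarrow> 't) \<Rightarrow> bool" where
  "quinqueadditive p \<longleftrightarrow>
     (\<forall>c. quadriadditive (\<lambda>a \<alpha> b \<beta>. p a \<alpha> b \<beta> c)) \<and> (\<forall>a \<alpha> b \<beta>. additive (p a \<alpha> b \<beta>))"

lemma operator_action:
  assumes "quinqueadditive p"
  shows "additive (operator_action p)"
    and "operator_action p (a \<otimes>\<^sub>\<int> \<alpha> \<otimes>\<^sub>\<int> b \<otimes>\<^sub>\<int> \<beta>) x = p a \<alpha> b \<beta> x"
proof -
  have "quadriadditive (\<lambda>a \<alpha> b \<beta> x. p a \<alpha> b \<beta> x)"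
    using assms by (simp add: quinqueadditive_def quadriadditive_def additive_def fun_eq_iff)
  then show "additive (operator_action p)"
    and "operator_action p (a \<otimes>\<^sub>\<int> \<alpha> \<otimes>\<^sub>\<int> b \<otimes>\<^sub>\<int> \<beta>) x = p a \<alpha> b \<beta> x"
    unfolding operator_action_def by (simp_all add: tensor4_extend)
qed

lemma operator_mult:
  assumes "quinqueadditive p"
  shows "additive (operator_mult p)"
    and "additive (operator_mult p U)"
    and "operator_mult p (a \<otimes>\<^sub>\<int> \<alpha> \<otimes>\<^sub>\<int> b \<otimes>\<^sub>\<int> \<beta>) (c \<otimes>\<^sub>\<int> \<gamma> \<otimes>\<^sub>\<int> d \<otimes>\<^sub>\<int> \<delta>) =
      p a \<alpha> b \<beta> c \<otimes>\<^sub>\<int> \<gamma> \<otimes>\<^sub>\<int> d \<otimes>\<^sub>\<int> \<delta>"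
proof -
  let ?f = "\<lambda>a \<alpha> b \<beta> c \<gamma> d \<delta>. p a \<alpha> b \<beta> c \<otimes>\<^sub>\<int> \<gamma> \<otimes>\<^sub>\<int> d \<otimes>\<^sub>\<int> \<delta>"
  let ?g = "\<lambda>a \<alpha> b \<beta>. tensor4_extend (?f a \<alpha> b \<beta>)"
  have p: "p (a + a') \<alpha> b \<beta> c = p a \<alpha> b \<beta> c + p a' \<alpha> b \<beta> c"
    "p a (\<alpha> + \<alpha>') b \<beta> c = p a \<alpha> b \<beta> c + p a \<alpha>' b \<beta> c"
    "p a \<alpha> (b + b') \<beta> c = p a \<alpha> b \<beta> c + p a \<alpha> b' \<beta> c"
    "p a \<alpha> b (\<beta> + \<beta>') c = p a \<alpha> b \<beta> c + p a \<alpha> b \<beta>' c"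
    "p a \<alpha> b \<beta> (c + c') = p a \<alpha> b \<beta> c + p a \<alpha> b \<beta> c'"
    for a a' \<alpha> \<alpha>' b b' \<beta> \<beta>' c c'
    using assms by (simp_all add: quinqueadditive_def quadriadditive_def additive_def)
  have f: "quadriadditive (?f a \<alpha> b \<beta>)" for a \<alpha> b \<beta>
    by (simp add: quadriadditive_def additive_def p tensor_add_left tensor_add_right)
  note sums = additive_eq_on_tensors4I[OF tensor4_extend(1)[OF f]
      additive_plus[OF tensor4_extend(1)[OF f] tensor4_extend(1)[OF f]]]
  have step: "?g (a + a') \<alpha> b \<beta> Y = ?g a \<alpha> b \<beta> Y + ?g a' \<alpha> b \<beta> Y"
    "?g a (\<alpha> + \<alpha>') b \<beta> Y = ?g a \<alpha> b \<beta> Y + ?g a \<alpha>' b \<beta> Y"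
    "?g a \<alpha> (b + b') \<beta> Y = ?g a \<alpha> b \<beta> Y + ?g a \<alpha> b' \<beta> Y"
    "?g a \<alpha> b (\<beta> + \<beta>') Y = ?g a \<alpha> b \<beta> Y + ?g a \<alpha> b \<beta>' Y"
    for a a' \<alpha> \<alpha>' b b' \<beta> \<beta>' Y
    by (rule sums[THEN fun_cong], simp only: tensor4_extend(2)[OF f], simp only: p tensor_add_left)+
  have g: "quadriadditive ?g"
    unfolding quadriadditive_def additive_def
    by (intro conjI allI ext; simp only: plus_fun_apply; rule step)
  show add: "additive (operator_mult p)"
    unfolding operator_mult_def by (rule tensor4_extend(1)[OF g])
  have pure: "operator_mult p (a \<otimes>\<^sub>\<int> \<alpha> \<otimes>\<^sub>\<int> b \<otimes>\<^sub>\<int> \<beta>) = ?g a \<alpha> b \<beta>" for a \<alpha> b \<beta>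
    unfolding operator_mult_def by (rule tensor4_extend(2)[OF g])
  then show "operator_mult p (a \<otimes>\<^sub>\<int> \<alpha> \<otimes>\<^sub>\<int> b \<otimes>\<^sub>\<int> \<beta>) (c \<otimes>\<^sub>\<int> \<gamma> \<otimes>\<^sub>\<int> d \<otimes>\<^sub>\<int> \<delta>) =
      p a \<alpha> b \<beta> c \<otimes>\<^sub>\<int> \<gamma> \<otimes>\<^sub>\<int> d \<otimes>\<^sub>\<int> \<delta>"
    by (simp add: tensor4_extend(2)[OF f])
  have "operator_mult p U (Y + Z) = operator_mult p U Y + operator_mult p U Z" for Y Z
  proof -
    have 1: "additive (\<lambda>U. operator_mult p U Y)" for Y
      using add by (simp add: additive_def)
    show ?thesis
      by (rule additive_eq_on_tensors4I[OF 1 additive_plus[OF 1 1], THEN fun_cong])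
        (simp add: pure additive.add[OF tensor4_extend(1)[OF f]])
  qed
  then show "additive (operator_mult p U)"
    by (simp add: additive_def)
qed

definition rng_ideal :: "('x::ab_group_add \<Rightarrow> 'x \<Rightarrow> 'x) \<Rightarrow> 'x set \<Rightarrow> bool" where
  "rng_ideal m I \<longleftrightarrow>
     subgroup I additive_group \<and> (\<forall>x. \<forall>y\<in>I. m x y \<in> I \<and> m y x \<in> I)"

definition operator_relators ::
    "('t::ab_group_add \<Rightarrow> 'g::ab_group_add \<Rightarrow> 't \<Rightarrow> 'g \<Rightarrow> 't \<Rightarrow> 't)
      \<Rightarrow> ('t \<otimes>\<^sub>\<int> 'g \<otimes>\<^sub>\<int> 't \<otimes>\<^sub>\<int> 'g) set" where
  "operator_relators p =
     {p a \<alpha> b \<beta> c \<otimes>\<^sub>\<int> \<gamma> \<otimes>\<^sub>\<int> d \<otimes>\<^sub>\<int> \<delta> - a \<otimes>\<^sub>\<int> \<alpha> \<otimes>\<^sub>\<int> p b \<beta> c \<gamma> d \<otimes>\<^sub>\<int> \<delta> |a \<alpha> b \<beta> c \<gamma> d \<delta>. True}"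

definition operator_ideal ::
    "('t::ab_group_add \<Rightarrow> 'g::ab_group_add \<Rightarrow> 't \<Rightarrow> 'g \<Rightarrow> 't \<Rightarrow> 't)
      \<Rightarrow> ('t \<otimes>\<^sub>\<int> 'g \<otimes>\<^sub>\<int> 't \<otimes>\<^sub>\<int> 'g) set" where
  "operator_ideal p = \<Inter>{I. rng_ideal (operator_mult p) I \<and> operator_relators p \<subseteq> I}"

text \<open>Only the additive group of the universal operator rng is recorded: its multiplication, induced
  by \<^const>\<open>operator_mult\<close>, is not needed to describe the defect once the ideal is known.\<close>

definition operator_rng ::
    "('t::ab_group_add \<Rightarrow> 'g::ab_group_add \<Rightarrow> 't \<Rightarrow> 'g \<Rightarrow> 't \<Rightarrow> 't)
      \<Rightarrow> ('t \<otimes>\<^sub>\<int> 'g \<otimes>\<^sub>\<int> 't \<otimes>\<^sub>\<int> 'g) set monoid" where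
  "operator_rng p = additive_group Mod operator_ideal p"

definition additive_End :: "('t::ab_group_add \<Rightarrow> 't) monoid" where
  "additive_End = additive_group\<lparr>carrier := {f. additive f}\<rparr>"

text \<open>The map induced on cosets; \<^const>\<open>operator_action\<close> is constant on them whenever \<open>p\<close> is
  associative.\<close>

definition regular_rep ::
    "('t::ab_group_add \<Rightarrow> 'g::ab_group_add \<Rightarrow> 't \<Rightarrow> 'g \<Rightarrow> 't \<Rightarrow> 't)
      \<Rightarrow> ('t \<otimes>\<^sub>\<int> 'g \<otimes>\<^sub>\<int> 't \<otimes>\<^sub>\<int> 'g) set \<Rightarrow> 't \<Rightarrow> 't" where
  "regular_rep p C = the_elem (operator_action p ` C)"

definition operator_defect ::
    "('t::ab_group_add \<Rightarrow> 'g::ab_group_add \<Rightarrow> 't \<Rightarrow> 'g \<Rightarrow> 't \<Rightarrow> 't)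
      \<Rightarrow> ('t \<otimes>\<^sub>\<int> 'g \<otimes>\<^sub>\<int> 't \<otimes>\<^sub>\<int> 'g) set monoid" where
  "operator_defect p =
     (operator_rng p)\<lparr>carrier := kernel (operator_rng p) additive_End (regular_rep p)\<rparr>"

definition T_op ::
    "('e::ab_group_add \<otimes>\<^sub>\<int> 'e \<otimes>\<^sub>\<int> 'e \<Rightarrow> int)
      \<Rightarrow> 'e \<times> int \<Rightarrow> int \<Rightarrow> 'e \<times> int \<Rightarrow> int \<Rightarrow> 'e \<times> int \<Rightarrow> 'e \<times> int" where
  "T_op \<mu> = (\<lambda>(x, u) n (y, v) m (z, w). (0, n * m * \<mu> (x \<otimes>\<^sub>\<int> y \<otimes>\<^sub>\<int> z)))"

lemma T_op_quinqueadditive: "additive \<mu> \<Longrightarrow> quinqueadditive (T_op \<mu>)"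
  by (auto simp: quinqueadditive_def quadriadditive_def additive_def T_op_def case_prod_beta
      tensor_add_left tensor_add_right algebra_simps)

section \<open>Sign tensors\<close>

definition e :: "nat \<Rightarrow> int \<times> int" where
  "e i = (if i = 0 then (1, 0) else (0, 1))"

definition sign_tensors :: "((int \<times> int) \<otimes>\<^sub>\<int> (int \<times> int) \<otimes>\<^sub>\<int> (int \<times> int) \<Rightarrow> int) set" where
  "sign_tensors =
     {\<mu>. additive \<mu> \<and> (\<forall>a\<in>{0,1}. \<forall>b\<in>{0,1}. \<forall>c\<in>{0,1}. \<mu> (e a \<otimes>\<^sub>\<int> e b \<otimes>\<^sub>\<int> e c) \<in> {1, -1})}"

definition sign_tensors_with ::
    "nat \<Rightarrow> enat \<Rightarrow> int monoid \<Rightarrow> ((int \<times> int) \<otimes>\<^sub>\<int> (int \<times> int) \<otimes>\<^sub>\<int> (int \<times> int) \<Rightarrow> int) set" where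
  "sign_tensors_with r k A =
     {\<mu> \<in> sign_tensors. rational_rank (Theta \<mu>) = r \<and> int_rank (middle_coker \<mu>) = k \<and>
        tors (middle_coker \<mu>) \<cong> A}"

end

theory Submission
  imports Defs
begin

text \<open>Write \<open>T \<otimes> T = (E \<otimes> E) \<oplus> (W \<otimes> E \<oplus> E \<otimes> W) \<oplus> (W \<otimes> W)\<close>. The relators of the
  operator rng already span an ideal: it contains \<open>W \<otimes> W\<close>, as \<open>\<mu>\<close> takes the value \<open>1\<close> up to sign,
  meets the middle summand in the image of \<open>B\<^sub>\<mu>\<close>, and is zero on \<open>E \<otimes> E\<close>. Since operators act
  through \<open>\<Theta>\<^sub>\<mu>\<close> on their \<open>E \<otimes> E\<close> part, the defect is \<open>ker \<Theta>\<^sub>\<mu> \<oplus> Q\<^sub>\<mu>\<close>.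

  The group \<open>Q\<^sub>\<mu>\<close> is generated by \<open>f\<^sub>d = w \<otimes> e\<^sub>d\<close> and \<open>g\<^sub>a = e\<^sub>a \<otimes> w\<close> with relations
  \<open>f\<^sub>d = \<mu>\<^sub>a\<^sub>b\<^sub>c \<mu>\<^sub>b\<^sub>c\<^sub>d g\<^sub>a\<close>, which form a connected signed graph. It is infinite cyclic if the
  graph is balanced, which forces \<open>\<mu>\<^sub>a\<^sub>b\<^sub>c = s \<rho>\<^bsup>a+b+c\<^esup>\<close> with signs \<open>s\<close> and \<open>\<rho>\<close>, and of order \<open>2\<close>
  otherwise. The rank of \<open>\<Theta>\<^sub>\<mu>\<close> is \<open>1\<close> if and only if \<open>\<mu>\<^sub>a\<^sub>b\<^sub>1 = \<rho> \<mu>\<^sub>a\<^sub>b\<^sub>0\<close> for a sign \<open>\<rho>\<close>, which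
  happens for \<open>2 \<cdot> 2\<^sup>4\<close> tensors.\<close>

section \<open>Additive maps and quotients\<close>

lemma additive_zero_map: "additive (\<lambda>x. 0)"
  by (simp add: additive_def)

lemma additive_comp: "additive f \<Longrightarrow> additive g \<Longrightarrow> additive (\<lambda>x. f (g x))"
  by (simp add: additive_def)

text \<open>Two-sided induction, as \<open>1\<close> generates \<int>. It is the tool for moving
  integer scalars through tensors: both sides are read as functions of the scalar.\<close>

lemma additive_int_eqI:
  fixes f g :: "int \<Rightarrow> 'a::ab_group_add"
  assumes f: "additive f" and g: "additive g" and 1: "f 1 = g 1"
  shows "f n = g n"
proof (induction n rule: int_induct[where k = 0])
  case base
  show ?case by (simp add: f g additive.zero)
next
  case (step1 i)
  then show ?case by (simp add: additive.add[OF f] additive.add[OF g] 1)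
next
  case (step2 i)
  then show ?case by (simp add: additive.diff[OF f] additive.diff[OF g] 1)
qed

lemma additive_tensor_elem_left: "additive (\<lambda>a. a \<otimes>\<^sub>\<int> b)"
  and additive_tensor_elem_right: "additive (\<lambda>b. a \<otimes>\<^sub>\<int> b)"
  by (simp_all add: additive_def tensor_add_left tensor_add_right)

lemma tensor_zero_left [simp]: "0 \<otimes>\<^sub>\<int> b = 0"
  and tensor_zero_right [simp]: "a \<otimes>\<^sub>\<int> 0 = 0"
  using additive.zero[OF additive_tensor_elem_left] additive.zero[OF additive_tensor_elem_right]
  by fast+

lemma additive_group_subgroup_iff:
  "subgroup S additive_group \<longleftrightarrow> 0 \<in> S \<and> (\<forall>x\<in>S. \<forall>y\<in>S. x - y \<in> S)"
proof
  assume S: "subgroup S additive_group"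
  have "x + - y \<in> S" if "x \<in> S" "y \<in> S" for x y
    using subgroup.m_closed[OF S that(1) subgroup.m_inv_closed[OF S that(2)]] by simp
  then show "0 \<in> S \<and> (\<forall>x\<in>S. \<forall>y\<in>S. x - y \<in> S)"
    using subgroup.one_closed[OF S] by simp
next
  assume *: "0 \<in> S \<and> (\<forall>x\<in>S. \<forall>y\<in>S. x - y \<in> S)"
  then have neg: "- x \<in> S" if "x \<in> S" for x
    using that by (metis diff_0)
  moreover have "x + y \<in> S" if "x \<in> S" "y \<in> S" for x y
    using * neg that by (metis diff_minus_eq_add)
  ultimately show "subgroup S additive_group"
    using * by (intro group.subgroupI) auto
qed

lemma r_coset_additive_group: "S #>\<^bsub>additive_group\<^esub> x = (\<lambda>s. s + x) ` S"
  by (auto simp: r_coset_def)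

lemma r_coset_additive_group_eq_iff:
  assumes "subgroup S additive_group"
  shows "S #>\<^bsub>additive_group\<^esub> x = S #>\<^bsub>additive_group\<^esub> y \<longleftrightarrow> x - y \<in> S"
proof
  assume "S #>\<^bsub>additive_group\<^esub> x = S #>\<^bsub>additive_group\<^esub> y"
  moreover have "x \<in> S #>\<^bsub>additive_group\<^esub> x"
    using assms by (force simp: r_coset_additive_group additive_group_subgroup_iff)
  ultimately show "x - y \<in> S"
    by (auto simp: r_coset_additive_group)
next
  assume xy: "x - y \<in> S"
  have "S #>\<^bsub>additive_group\<^esub> x \<subseteq> S #>\<^bsub>additive_group\<^esub> y" if "x - y \<in> S" for x y
  proof -
    have "s + (x - y) \<in> S" if "s \<in> S" for s
      using subgroup.m_closed[OF assms that \<open>x - y \<in> S\<close>] by simp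
    moreover have "s + x = s + (x - y) + y" for s
      by simp
    ultimately show ?thesis
      unfolding r_coset_additive_group by (metis (no_types, lifting) image_eqI image_subsetI)
  qed
  moreover have "y - x \<in> S"
    using subgroup.m_inv_closed[OF assms xy] by simp
  ultimately show "S #>\<^bsub>additive_group\<^esub> x = S #>\<^bsub>additive_group\<^esub> y"
    using xy by (simp add: subset_antisym)
qed

lemma normal_additive_group: "subgroup S additive_group \<Longrightarrow> S \<lhd> additive_group"
  by (simp add: comm_group.normal_iff_subgroup)

lemma subgroup_range_additive: "additive f \<Longrightarrow> subgroup (range f) additive_group"
  by (auto simp: additive_group_subgroup_iff additive.diff[symmetric]
      intro: range_eqI[where x = 0] simp: additive.zero)

lemma additive_mem_subgroup:
  fixes h :: "'a::ab_group_add \<otimes>\<^sub>\<int> 'b::ab_group_add \<Rightarrow> 'c::ab_group_add"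
  assumes "additive h" "subgroup S additive_group" "\<And>a b. h (a \<otimes>\<^sub>\<int> b) \<in> S"
  shows "h t \<in> S"
  by (induction t rule: tensor_induct)
    (use assms in \<open>auto simp: additive.zero additive.diff additive_group_subgroup_iff\<close>)

text \<open>Pure tensors generate the tensor product; the factors are peeled off one at a time,
  starting with the last.\<close>

lemma additive_mem_subgroup4:
  fixes h :: "'a::ab_group_add \<otimes>\<^sub>\<int> 'b::ab_group_add \<otimes>\<^sub>\<int> 'c::ab_group_add \<otimes>\<^sub>\<int> 'd::ab_group_add
    \<Rightarrow> 'x::ab_group_add"
  assumes h: "additive h" and S: "subgroup S additive_group"
    and pure: "\<And>a b c d. h (a \<otimes>\<^sub>\<int> b \<otimes>\<^sub>\<int> c \<otimes>\<^sub>\<int> d) \<in> S"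
  shows "h t \<in> S"
proof (rule additive_mem_subgroup[OF h S])
  fix r :: "'a \<otimes>\<^sub>\<int> 'b \<otimes>\<^sub>\<int> 'c" and d :: 'd
  note hd = additive_tensor_left[OF h, of d]
  show "h (r \<otimes>\<^sub>\<int> d) \<in> S"
  proof (rule additive_mem_subgroup[OF hd S])
    fix s :: "'a \<otimes>\<^sub>\<int> 'b" and c :: 'c
    show "h (s \<otimes>\<^sub>\<int> c \<otimes>\<^sub>\<int> d) \<in> S"
      by (rule additive_mem_subgroup[OF additive_tensor_left[OF hd] S]) (rule pure)
  qed
qed

text \<open>The first isomorphism theorem for the image of \<open>K\<close> in the quotient by
  \<open>J\<close>. This form fits the kernel of a map defined on a quotient, such as the operator
  defect, and with \<open>K = UNIV\<close> it computes a whole cokernel.\<close>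

lemma subgroup_Mod_iso:
  fixes f :: "'x::ab_group_add \<Rightarrow> 'h"
  assumes K: "subgroup K additive_group" and H: "group H"
    and f: "f \<in> hom (additive_group\<lparr>carrier := K\<rparr>) H" and surj: "f ` K = carrier H"
    and ker: "{x \<in> K. f x = \<one>\<^bsub>H\<^esub>} = J"
  shows "(additive_group Mod J)\<lparr>carrier := (\<lambda>x. J #>\<^bsub>additive_group\<^esub> x) ` K\<rparr> \<cong> H"
proof -
  interpret group_hom "additive_group\<lparr>carrier := K\<rparr>" H f
    using H f subgroup.subgroup_is_group[OF K]
    by (simp add: group_hom_def group_hom_axioms_def)
  \<comment> \<open>Cosets of \<open>J\<close> by elements of \<open>K\<close>, and their products,
    are the same sets whether formed in \<open>K\<close> or in the ambient group, so the two
    quotients are equal and not merely isomorphic.\<close>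
  have "(additive_group Mod J)\<lparr>carrier := (\<lambda>x. J #>\<^bsub>additive_group\<^esub> x) ` K\<rparr> =
      additive_group\<lparr>carrier := K\<rparr> Mod kernel (additive_group\<lparr>carrier := K\<rparr>) H f"
    using ker by (auto simp: FactGroup_def RCOSETS_def r_coset_def set_mult_def kernel_def fun_eq_iff)
  then show ?thesis
    using FactGroup_iso surj by simp
qed

section \<open>Homomorphisms out of a tensor product\<close>

definition tensor_extend ::
    "('a::ab_group_add \<Rightarrow> 'b::ab_group_add \<Rightarrow> 'c::ab_group_add) \<Rightarrow> 'a \<otimes>\<^sub>\<int> 'b \<Rightarrow> 'c" where
  "tensor_extend f = (THE h. additive h \<and> (\<forall>a b. h (a \<otimes>\<^sub>\<int> b) = f a b))"

lemma tensor_extend: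
  assumes "\<And>b. additive (\<lambda>a. f a b)" "\<And>a. additive (f a)"
  shows "additive (tensor_extend f)" and "tensor_extend f (a \<otimes>\<^sub>\<int> b) = f a b"
proof -
  have "\<exists>!h. additive h \<and> (\<forall>a b. h (a \<otimes>\<^sub>\<int> b) = f a b)"
    using tensor_universal[of f] assms by (intro ex_ex1I additive_eq_on_tensorsI) auto
  from theI'[OF this] show "additive (tensor_extend f)" and "tensor_extend f (a \<otimes>\<^sub>\<int> b) = f a b"
    unfolding tensor_extend_def by auto
qed

definition zscale :: "int \<Rightarrow> int \<times> int \<Rightarrow> int \<times> int" where
  "zscale n x = (n * fst x, n * snd x)"

lemma zscale_simps [simp]:
  "zscale (m + n) x = zscale m x + zscale n x" "zscale n (x + y) = zscale n x + zscale n y"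
  "zscale 0 x = 0" "zscale n 0 = 0" "zscale 1 x = x" "zscale m (zscale n x) = zscale (m * n) x"
  by (simp_all add: zscale_def prod_eq_iff algebra_simps)

lemma additive_zscale:
  assumes "additive f"
  shows "f (zscale n x) = n * (f x :: int)"
  by (rule additive_int_eqI[where f = "\<lambda>n. f (zscale n x)"])
    (simp_all add: additive_def additive.add[OF assms] algebra_simps)

lemma zscale_tensor_int: "zscale n x \<otimes>\<^sub>\<int> (w::int) = x \<otimes>\<^sub>\<int> (n * w)"
  by (rule additive_int_eqI[where f = "\<lambda>n. zscale n x \<otimes>\<^sub>\<int> w"])
    (simp_all add: additive_def tensor_add_left tensor_add_right algebra_simps)

section \<open>The operator defect\<close>

type_synonym E2 = "int \<times> int"
type_synonym operators = "(E2 \<times> int) \<otimes>\<^sub>\<int> int \<otimes>\<^sub>\<int> (E2 \<times> int) \<otimes>\<^sub>\<int> int"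

text \<open>The components of an operator in the summands \<open>E \<otimes> E\<close>,
  \<open>W \<otimes> E \<oplus> E \<otimes> W\<close> and \<open>W \<otimes> W\<close> of \<open>T \<otimes> T\<close>, with the two factors
  \<open>\<Gamma> = \<int>\<close> contracted.\<close>

definition EE_part :: "operators \<Rightarrow> E2 \<otimes>\<^sub>\<int> E2" where
  "EE_part = tensor4_extend (\<lambda>a \<alpha> b \<beta>. zscale (\<alpha> * \<beta>) (fst a) \<otimes>\<^sub>\<int> fst b)"

definition mixed_part :: "operators \<Rightarrow> (int \<otimes>\<^sub>\<int> E2) \<times> (E2 \<otimes>\<^sub>\<int> int)" where
  "mixed_part = tensor4_extend
     (\<lambda>a \<alpha> b \<beta>. ((\<alpha> * \<beta> * snd a) \<otimes>\<^sub>\<int> fst b, fst a \<otimes>\<^sub>\<int> (\<alpha> * \<beta> * snd b)))"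

definition WW_part :: "operators \<Rightarrow> int" where
  "WW_part = tensor4_extend (\<lambda>a \<alpha> b \<beta>. \<alpha> * \<beta> * snd a * snd b)"

definition EE_inj :: "E2 \<otimes>\<^sub>\<int> E2 \<Rightarrow> operators" where
  "EE_inj = tensor_extend (\<lambda>x y. (x, 0) \<otimes>\<^sub>\<int> 1 \<otimes>\<^sub>\<int> (y, 0) \<otimes>\<^sub>\<int> 1)"

definition WE_inj :: "int \<otimes>\<^sub>\<int> E2 \<Rightarrow> operators" where
  "WE_inj = tensor_extend (\<lambda>u y. (0, u) \<otimes>\<^sub>\<int> 1 \<otimes>\<^sub>\<int> (y, 0) \<otimes>\<^sub>\<int> 1)"

definition EW_inj :: "E2 \<otimes>\<^sub>\<int> int \<Rightarrow> operators" where
  "EW_inj = tensor_extend (\<lambda>x v. (x, 0) \<otimes>\<^sub>\<int> 1 \<otimes>\<^sub>\<int> (0, v) \<otimes>\<^sub>\<int> 1)"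

definition mixed_inj :: "(int \<otimes>\<^sub>\<int> E2) \<times> (E2 \<otimes>\<^sub>\<int> int) \<Rightarrow> operators" where
  "mixed_inj z = WE_inj (fst z) + EW_inj (snd z)"

text \<open>As \<open>W \<otimes> W\<close> is infinite cyclic, an integer replaces a tensor here;
  the second factor is fixed to the generator of \<open>W\<close>.\<close>

definition WW_inj :: "int \<Rightarrow> operators" where
  "WW_inj n = (0, n) \<otimes>\<^sub>\<int> 1 \<otimes>\<^sub>\<int> (0, 1) \<otimes>\<^sub>\<int> 1"

lemma EE_part: "additive EE_part"
    "EE_part (a \<otimes>\<^sub>\<int> \<alpha> \<otimes>\<^sub>\<int> b \<otimes>\<^sub>\<int> \<beta>) = zscale (\<alpha> * \<beta>) (fst a) \<otimes>\<^sub>\<int> fst b"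
  unfolding EE_part_def
  by (rule tensor4_extend, simp add: quadriadditive_def additive_def tensor_add_left
      tensor_add_right algebra_simps)+

lemma mixed_part: "additive mixed_part"
    "mixed_part (a \<otimes>\<^sub>\<int> \<alpha> \<otimes>\<^sub>\<int> b \<otimes>\<^sub>\<int> \<beta>) =
      ((\<alpha> * \<beta> * snd a) \<otimes>\<^sub>\<int> fst b, fst a \<otimes>\<^sub>\<int> (\<alpha> * \<beta> * snd b))"
  unfolding mixed_part_def
  by (rule tensor4_extend, simp add: quadriadditive_def additive_def tensor_add_left
      tensor_add_right algebra_simps)+

lemma WW_part: "additive WW_part"
    "WW_part (a \<otimes>\<^sub>\<int> \<alpha> \<otimes>\<^sub>\<int> b \<otimes>\<^sub>\<int> \<beta>) = \<alpha> * \<beta> * snd a * snd b"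
  unfolding WW_part_def
  by (rule tensor4_extend, simp add: quadriadditive_def additive_def algebra_simps)+

lemma Pair_zero_add:
  "(x + y, 0 :: 'a::monoid_add) = (x, 0) + (y, 0)" "(0 :: 'a::monoid_add, x + y) = (0, x) + (0, y)"
  by (simp_all add: prod_eq_iff)

lemma EE_inj: "additive EE_inj" "EE_inj (x \<otimes>\<^sub>\<int> y) = (x, 0) \<otimes>\<^sub>\<int> 1 \<otimes>\<^sub>\<int> (y, 0) \<otimes>\<^sub>\<int> 1"
  unfolding EE_inj_def
  by (rule tensor_extend; simp only: additive_def tensor_add_left tensor_add_right Pair_zero_add
      simp_thms)+

lemma WE_inj: "additive WE_inj" "WE_inj (u \<otimes>\<^sub>\<int> y) = (0, u) \<otimes>\<^sub>\<int> 1 \<otimes>\<^sub>\<int> (y, 0) \<otimes>\<^sub>\<int> 1"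
  unfolding WE_inj_def
  by (rule tensor_extend; simp only: additive_def tensor_add_left tensor_add_right Pair_zero_add
      simp_thms)+

lemma EW_inj: "additive EW_inj" "EW_inj (x \<otimes>\<^sub>\<int> v) = (x, 0) \<otimes>\<^sub>\<int> 1 \<otimes>\<^sub>\<int> (0, v) \<otimes>\<^sub>\<int> 1"
  unfolding EW_inj_def
  by (rule tensor_extend; simp only: additive_def tensor_add_left tensor_add_right Pair_zero_add
      simp_thms)+

lemma mixed_inj: "additive mixed_inj"
  by (simp add: additive_def mixed_inj_def additive.add[OF WE_inj(1)] additive.add[OF EW_inj(1)])

lemma WW_inj: "additive WW_inj"
  by (simp add: additive_def WW_inj_def tensor_add_left Pair_zero_add del: add_Pair)

lemma EE_part_EE_inj: "EE_part (EE_inj t) = t"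
  by (rule additive_eq_on_tensorsI[where h = "\<lambda>t. t", THEN fun_cong,
        OF additive_comp[OF EE_part(1) EE_inj(1)]])
    (simp_all add: EE_part EE_inj additive_def)

lemma mixed_part_EE_inj: "mixed_part (EE_inj t) = 0"
  by (rule additive_eq_on_tensorsI[where h = "\<lambda>t. 0", THEN fun_cong,
        OF additive_comp[OF mixed_part(1) EE_inj(1)]])
    (simp_all add: mixed_part EE_inj additive_def zero_prod_def)

lemma EE_part_mixed_inj: "EE_part (mixed_inj z) = 0"
proof -
  have "EE_part (WE_inj t) = 0" for t
    by (rule additive_eq_on_tensorsI[where h = "\<lambda>t. 0", THEN fun_cong,
          OF additive_comp[OF EE_part(1) WE_inj(1)]])
      (simp_all add: EE_part WE_inj additive_def)
  moreover have "EE_part (EW_inj t) = 0" for t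
    by (rule additive_eq_on_tensorsI[where h = "\<lambda>t. 0", THEN fun_cong,
          OF additive_comp[OF EE_part(1) EW_inj(1)]])
      (simp_all add: EE_part EW_inj additive_def)
  ultimately show ?thesis
    by (simp add: mixed_inj_def additive.add[OF EE_part(1)])
qed

lemma mixed_part_mixed_inj: "mixed_part (mixed_inj z) = z"
proof -
  have "mixed_part (WE_inj t) = (t, 0)" for t
    by (rule additive_eq_on_tensorsI[where h = "\<lambda>t. (t, 0)", THEN fun_cong,
          OF additive_comp[OF mixed_part(1) WE_inj(1)]])
      (simp_all add: mixed_part WE_inj additive_def)
  moreover have "mixed_part (EW_inj t) = (0, t)" for t
    by (rule additive_eq_on_tensorsI[where h = "\<lambda>t. (0, t)", THEN fun_cong,
          OF additive_comp[OF mixed_part(1) EW_inj(1)]])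
      (simp_all add: mixed_part EW_inj additive_def)
  ultimately show ?thesis
    by (simp add: mixed_inj_def additive.add[OF mixed_part(1)])
qed

text \<open>Integers pass freely between tensor factors, so both scalars can be collected in the
  first one. This is the normal form in which the injections are written.\<close>

lemma contract_scalars:
  fixes x :: E2 and u :: int and b :: "E2 \<times> int"
  shows "(x, u) \<otimes>\<^sub>\<int> (\<alpha>::int) \<otimes>\<^sub>\<int> b \<otimes>\<^sub>\<int> (\<beta>::int) = (zscale (\<alpha> * \<beta>) x, \<alpha> * \<beta> * u) \<otimes>\<^sub>\<int> 1 \<otimes>\<^sub>\<int> b \<otimes>\<^sub>\<int> 1"
proof -
  have "(x, u) \<otimes>\<^sub>\<int> \<alpha> \<otimes>\<^sub>\<int> b \<otimes>\<^sub>\<int> \<beta> = (zscale \<alpha> x, \<alpha> * u) \<otimes>\<^sub>\<int> 1 \<otimes>\<^sub>\<int> b \<otimes>\<^sub>\<int> \<beta>"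
    by (rule additive_int_eqI[where n = \<alpha>])
      (simp_all add: additive_def distrib_right tensor_add_left tensor_add_right
        flip: add_Pair)
  also have "\<dots> = (zscale \<beta> (zscale \<alpha> x), \<beta> * (\<alpha> * u)) \<otimes>\<^sub>\<int> 1 \<otimes>\<^sub>\<int> b \<otimes>\<^sub>\<int> 1"
    by (rule additive_int_eqI[where n = \<beta>])
      (simp_all add: additive_def distrib_right tensor_add_left tensor_add_right
        flip: add_Pair del: zscale_simps(6))
  finally show ?thesis by (simp add: ac_simps)
qed

text \<open>Passes a scalar from the first to the third factor. The third factor lies in
  \<open>W\<close>, as in the two terms of the decomposition below where the scalar sits in the
  wrong place.\<close>

lemma move_scalar:
  fixes x :: E2 and u w :: int
  shows "(zscale n x, n * u) \<otimes>\<^sub>\<int> (1::int) \<otimes>\<^sub>\<int> ((0::E2), w) \<otimes>\<^sub>\<int> (1::int) =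
    (x, u) \<otimes>\<^sub>\<int> 1 \<otimes>\<^sub>\<int> (0, n * w) \<otimes>\<^sub>\<int> 1"
proof (rule additive_int_eqI[where n = n])
  show "additive (\<lambda>n. (x, u) \<otimes>\<^sub>\<int> (1::int) \<otimes>\<^sub>\<int> (0::E2, n * w) \<otimes>\<^sub>\<int> (1::int))"
    by (simp only: additive_def distrib_right Pair_zero_add tensor_add_left tensor_add_right simp_thms)
qed (simp_all add: additive_def distrib_right tensor_add_left tensor_add_right flip: add_Pair)

text \<open>Both sides are additive, so it suffices to expand a pure tensor, after contracting its
  scalars, by bilinearity into four terms, one for each choice of \<open>E\<close> or
  \<open>W\<close> in the two factors.\<close>

lemma operators_decomp: "x = EE_inj (EE_part x) + mixed_inj (mixed_part x) + WW_inj (WW_part x)"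
proof (rule additive_eq_on_tensors4I[where g = "\<lambda>x. x", THEN fun_cong])
  show "additive (\<lambda>x. EE_inj (EE_part x) + mixed_inj (mixed_part x) + WW_inj (WW_part x))"
    by (intro additive_plus additive_comp[OF EE_inj(1)] additive_comp[OF mixed_inj]
        additive_comp[OF WW_inj] EE_part mixed_part WW_part)
next
  fix a b :: "E2 \<times> int" and \<alpha> \<beta> :: int
  obtain x u y v where ab: "a = (x, u)" "b = (y, v)" by (metis surj_pair)
  define n where "n = \<alpha> * \<beta>"
  have "a \<otimes>\<^sub>\<int> \<alpha> \<otimes>\<^sub>\<int> b \<otimes>\<^sub>\<int> \<beta> = (zscale n x, n * u) \<otimes>\<^sub>\<int> 1 \<otimes>\<^sub>\<int> (y, v) \<otimes>\<^sub>\<int> 1"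
    unfolding ab n_def by (rule contract_scalars)
  also have "(zscale n x, n * u) = (zscale n x, 0) + (0, n * u)"
    by simp
  also have "(y, v) = (y, 0) + (0, v)"
    by simp
  finally have "a \<otimes>\<^sub>\<int> \<alpha> \<otimes>\<^sub>\<int> b \<otimes>\<^sub>\<int> \<beta> = (zscale n x, 0) \<otimes>\<^sub>\<int> 1 \<otimes>\<^sub>\<int> (y, 0) \<otimes>\<^sub>\<int> 1 +
      ((0, n * u) \<otimes>\<^sub>\<int> 1 \<otimes>\<^sub>\<int> (y, 0) \<otimes>\<^sub>\<int> 1 + (zscale n x, 0) \<otimes>\<^sub>\<int> 1 \<otimes>\<^sub>\<int> (0, v) \<otimes>\<^sub>\<int> 1) +
      (0, n * u) \<otimes>\<^sub>\<int> 1 \<otimes>\<^sub>\<int> (0, v) \<otimes>\<^sub>\<int> 1"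
    by (simp only: tensor_add_left tensor_add_right ac_simps)
  \<comment> \<open>The \<open>E \<otimes> W\<close> term has its scalar on \<open>E\<close>, while
    \<open>mixed_part\<close> puts it on \<open>W\<close>.\<close>
  moreover have "(zscale n x, 0::int) \<otimes>\<^sub>\<int> (1::int) \<otimes>\<^sub>\<int> (0::E2, v) \<otimes>\<^sub>\<int> (1::int) =
      (x, 0) \<otimes>\<^sub>\<int> 1 \<otimes>\<^sub>\<int> (0, n * v) \<otimes>\<^sub>\<int> 1"
    using move_scalar[of n x 0 v] by simp
  \<comment> \<open>Here \<open>v\<close> moves the other way, to leave the generator of
    \<open>W\<close> in the third factor as in \<open>WW_inj\<close>.\<close>
  moreover have "(0, n * u) \<otimes>\<^sub>\<int> (1::int) \<otimes>\<^sub>\<int> (0::E2, v) \<otimes>\<^sub>\<int> (1::int) =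
      (0::E2, n * u * v) \<otimes>\<^sub>\<int> 1 \<otimes>\<^sub>\<int> (0, 1) \<otimes>\<^sub>\<int> 1"
    using move_scalar[of v 0 "n * u" 1] by (simp add: mult.commute)
  moreover have "EE_inj (EE_part (a \<otimes>\<^sub>\<int> \<alpha> \<otimes>\<^sub>\<int> b \<otimes>\<^sub>\<int> \<beta>)) + mixed_inj (mixed_part (a \<otimes>\<^sub>\<int> \<alpha> \<otimes>\<^sub>\<int> b \<otimes>\<^sub>\<int> \<beta>)) +
      WW_inj (WW_part (a \<otimes>\<^sub>\<int> \<alpha> \<otimes>\<^sub>\<int> b \<otimes>\<^sub>\<int> \<beta>)) = (zscale n x, 0) \<otimes>\<^sub>\<int> 1 \<otimes>\<^sub>\<int> (y, 0) \<otimes>\<^sub>\<int> 1 +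
      ((0, n * u) \<otimes>\<^sub>\<int> 1 \<otimes>\<^sub>\<int> (y, 0) \<otimes>\<^sub>\<int> 1 + (x, 0) \<otimes>\<^sub>\<int> 1 \<otimes>\<^sub>\<int> (0, n * v) \<otimes>\<^sub>\<int> 1) +
      (0, n * u * v) \<otimes>\<^sub>\<int> 1 \<otimes>\<^sub>\<int> (0, 1) \<otimes>\<^sub>\<int> 1"
    by (simp add: EE_part EE_inj mixed_part mixed_inj_def WE_inj EW_inj WW_part WW_inj_def
        ab flip: n_def)
  ultimately show "a \<otimes>\<^sub>\<int> \<alpha> \<otimes>\<^sub>\<int> b \<otimes>\<^sub>\<int> \<beta> = EE_inj (EE_part (a \<otimes>\<^sub>\<int> \<alpha> \<otimes>\<^sub>\<int> b \<otimes>\<^sub>\<int> \<beta>)) +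
      mixed_inj (mixed_part (a \<otimes>\<^sub>\<int> \<alpha> \<otimes>\<^sub>\<int> b \<otimes>\<^sub>\<int> \<beta>)) + WW_inj (WW_part (a \<otimes>\<^sub>\<int> \<alpha> \<otimes>\<^sub>\<int> b \<otimes>\<^sub>\<int> \<beta>))"
    by simp
qed (simp add: additive_def)

section \<open>The ideal generated by the operator relators\<close>

context
  fixes \<mu> :: "E2 \<otimes>\<^sub>\<int> E2 \<otimes>\<^sub>\<int> E2 \<Rightarrow> int"
  assumes \<mu>: "additive \<mu>"
begin

lemma T_op_eq: "T_op \<mu> a \<alpha> b \<beta> c = (0, \<alpha> * \<beta> * \<mu> (fst a \<otimes>\<^sub>\<int> fst b \<otimes>\<^sub>\<int> fst c))"
  by (simp add: T_op_def case_prod_beta)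

lemma mu_zscale: "\<mu> (zscale n a \<otimes>\<^sub>\<int> b \<otimes>\<^sub>\<int> c) = n * \<mu> (a \<otimes>\<^sub>\<int> b \<otimes>\<^sub>\<int> c)"
  by (rule additive_zscale[where f = "\<lambda>a. \<mu> (a \<otimes>\<^sub>\<int> b \<otimes>\<^sub>\<int> c)"])
    (simp add: additive_def tensor_add_left additive.add[OF \<mu>])

lemma additive_Theta: "additive (Theta \<mu>)"
  by (simp add: additive_def Theta_def tensor_add_left additive.add[OF \<mu>] fun_eq_iff)

text \<open>The product of \<open>T\<close> reads only \<open>E\<close> components and has values in
  \<open>W\<close>. Hence the mixed and \<open>W \<otimes> W\<close> parts of an operator act as
  zero, and every operator kills \<open>W\<close>.\<close>

lemma operator_action_T_op:
  "operator_action (T_op \<mu>) x = (\<lambda>z. (0, Theta \<mu> (EE_part x) (fst z)))"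
  by (rule additive_eq_on_tensors4I[THEN fun_cong,
        OF operator_action(1)[OF T_op_quinqueadditive[OF \<mu>]]])
    (simp_all add: fun_eq_iff operator_action(2)[OF T_op_quinqueadditive[OF \<mu>]] T_op_eq EE_part
      Theta_def mu_zscale additive_def tensor_add_left additive.add[OF EE_part(1)]
      additive.add[OF \<mu>])

text \<open>Reduces multiplication to the action on the first factor of the right operand, so that
  the formula for the action computes products.\<close>

lemma operator_mult_pure_right:
  "operator_mult (T_op \<mu>) x (c \<otimes>\<^sub>\<int> \<gamma> \<otimes>\<^sub>\<int> d \<otimes>\<^sub>\<int> \<delta>) =
    operator_action (T_op \<mu>) x c \<otimes>\<^sub>\<int> \<gamma> \<otimes>\<^sub>\<int> d \<otimes>\<^sub>\<int> \<delta>"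
proof (rule additive_eq_on_tensors4I[where g = "\<lambda>x. operator_mult (T_op \<mu>) x (c \<otimes>\<^sub>\<int> \<gamma> \<otimes>\<^sub>\<int> d \<otimes>\<^sub>\<int> \<delta>)"
        and h = "\<lambda>x. operator_action (T_op \<mu>) x c \<otimes>\<^sub>\<int> \<gamma> \<otimes>\<^sub>\<int> d \<otimes>\<^sub>\<int> \<delta>", THEN fun_cong])
  show "additive (\<lambda>x. operator_mult (T_op \<mu>) x (c \<otimes>\<^sub>\<int> \<gamma> \<otimes>\<^sub>\<int> d \<otimes>\<^sub>\<int> \<delta>))"
    using operator_mult(1)[OF T_op_quinqueadditive[OF \<mu>]] by (simp add: additive_def)
  show "additive (\<lambda>x. operator_action (T_op \<mu>) x c \<otimes>\<^sub>\<int> \<gamma> \<otimes>\<^sub>\<int> d \<otimes>\<^sub>\<int> \<delta>)"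
    using operator_action(1)[OF T_op_quinqueadditive[OF \<mu>]]
    by (simp add: additive_def tensor_add_left)
qed (simp add: operator_mult(3) operator_action(2) T_op_quinqueadditive[OF \<mu>])

text \<open>The candidate for the operator ideal. \<open>WW_part\<close> is left free because all of
  \<open>W \<otimes> W\<close> belongs to the ideal.\<close>

definition middle_ideal :: "operators set" where
  "middle_ideal = {x. EE_part x = 0 \<and> mixed_part x \<in> range (middle_map \<mu>)}"

lemma zero_in_range_middle_map: "0 \<in> range (middle_map \<mu>)"
  using subgroup_range_additive[OF middle_map(1)[OF \<mu>]]
  by (simp add: additive_group_subgroup_iff)

lemma subgroup_middle_ideal: "subgroup middle_ideal additive_group"
  using subgroup_range_additive[OF middle_map(1)[OF \<mu>]]
  by (auto simp: additive_group_subgroup_iff middle_ideal_def additive.zero[OF EE_part(1)]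
      additive.zero[OF mixed_part(1)] additive.diff[OF EE_part(1)] additive.diff[OF mixed_part(1)])

lemma operator_mult_eq_zero:
  assumes "EE_part x = 0"
  shows "operator_mult (T_op \<mu>) x y = 0"
  by (rule additive_eq_on_tensors4I[where h = "\<lambda>y. 0", THEN fun_cong,
        OF operator_mult(2)[OF T_op_quinqueadditive[OF \<mu>]]])
    (simp_all add: operator_mult_pure_right operator_action_T_op assms additive_def Theta_def
      additive.zero[OF \<mu>] flip: zero_prod_def)

text \<open>The first factor of a product is a value of the action, hence lies in
  \<open>W\<close>.\<close>

lemma EE_part_operator_mult: "EE_part (operator_mult (T_op \<mu>) x y) = 0"
  by (rule additive_eq_on_tensors4I[where h = "\<lambda>y. 0", THEN fun_cong,
        OF additive_comp[OF EE_part(1) operator_mult(2)[OF T_op_quinqueadditive[OF \<mu>]]]])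
    (simp_all add: operator_mult_pure_right operator_action_T_op additive_def EE_part)

lemma mixed_part_operator_mult:
  assumes "EE_part y = 0"
  shows "mixed_part (operator_mult (T_op \<mu>) x y) = 0"
proof (rule additive_eq_on_tensors4I[where g = "\<lambda>x. mixed_part (operator_mult (T_op \<mu>) x y)"
        and h = "\<lambda>x. 0", THEN fun_cong])
  show "additive (\<lambda>x. mixed_part (operator_mult (T_op \<mu>) x y))"
    using operator_mult(1)[OF T_op_quinqueadditive[OF \<mu>]]
    by (simp add: additive_def additive.add[OF mixed_part(1)])
  show "additive (\<lambda>x. 0)"
    by (rule additive_zero_map)
  fix a b :: "E2 \<times> int" and \<alpha> \<beta> :: int
  \<comment> \<open>The first factor of the product lies in \<open>W\<close>, so its mixed part is
    confined to \<open>W \<otimes> E\<close>. There it is the image under \<open>G\<close> of the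
    \<open>E \<otimes> E\<close> part of \<open>y\<close>, which is zero by assumption.\<close>
  define G where "G = tensor_extend (\<lambda>c d. (\<alpha> * \<beta> * \<mu> (fst a \<otimes>\<^sub>\<int> fst b \<otimes>\<^sub>\<int> c)) \<otimes>\<^sub>\<int> (d::E2))"
  have G: "additive G" "G (c \<otimes>\<^sub>\<int> d) = (\<alpha> * \<beta> * \<mu> (fst a \<otimes>\<^sub>\<int> fst b \<otimes>\<^sub>\<int> c)) \<otimes>\<^sub>\<int> (d::E2)" for c d
    unfolding G_def
    by (rule tensor_extend; simp add: additive_def tensor_add_left tensor_add_right
        additive.add[OF \<mu>] distrib_left)+
  have zs: "\<mu> (s \<otimes>\<^sub>\<int> zscale n c) = n * \<mu> (s \<otimes>\<^sub>\<int> c)" for n s c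
    by (rule additive_zscale[where f = "\<lambda>c. \<mu> (s \<otimes>\<^sub>\<int> c)"])
      (simp add: additive_def tensor_add_right additive.add[OF \<mu>])
  have "mixed_part (operator_mult (T_op \<mu>) (a \<otimes>\<^sub>\<int> \<alpha> \<otimes>\<^sub>\<int> b \<otimes>\<^sub>\<int> \<beta>) y) = (G (EE_part y), 0)"
    by (rule additive_eq_on_tensors4I[THEN fun_cong,
          OF additive_comp[OF mixed_part(1) operator_mult(2)[OF T_op_quinqueadditive[OF \<mu>]]]])
      (simp_all add: operator_mult(3)[OF T_op_quinqueadditive[OF \<mu>]] mixed_part EE_part G T_op_eq
        zs ac_simps additive_def additive.add[OF G(1)] additive.add[OF EE_part(1)])
  then show "mixed_part (operator_mult (T_op \<mu>) (a \<otimes>\<^sub>\<int> \<alpha> \<otimes>\<^sub>\<int> b \<otimes>\<^sub>\<int> \<beta>) y) = 0"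
    by (simp add: assms additive.zero[OF G(1)] zero_prod_def)
qed

text \<open>A member of \<open>middle_ideal\<close> acts as zero, so it annihilates everything to
  its right. As a right factor it gives a product with zero \<open>E \<otimes> E\<close> and mixed
  parts, that is, an element of \<open>W \<otimes> W\<close>.\<close>

lemma rng_ideal_middle_ideal: "rng_ideal (operator_mult (T_op \<mu>)) middle_ideal"
  unfolding rng_ideal_def
  by (auto simp: subgroup_middle_ideal)
    (auto simp: middle_ideal_def operator_mult_eq_zero EE_part_operator_mult
      mixed_part_operator_mult additive.zero[OF EE_part(1)] additive.zero[OF mixed_part(1)]
      zero_in_range_middle_map)

lemma operator_relators_subset: "operator_relators (T_op \<mu>) \<subseteq> middle_ideal"
proof
  fix r assume "r \<in> operator_relators (T_op \<mu>)"
  then obtain a \<alpha> b \<beta> c \<gamma> d \<delta> where r: "r = T_op \<mu> a \<alpha> b \<beta> c \<otimes>\<^sub>\<int> \<gamma> \<otimes>\<^sub>\<int> d \<otimes>\<^sub>\<int> \<delta> -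
      a \<otimes>\<^sub>\<int> \<alpha> \<otimes>\<^sub>\<int> T_op \<mu> b \<beta> c \<gamma> d \<otimes>\<^sub>\<int> \<delta>"
    unfolding operator_relators_def by blast
  \<comment> \<open>All four scalars are gathered on \<open>fst a\<close>, which turns the mixed
    part into one value of \<open>B\<^sub>\<mu>\<close>.\<close>
  have "mixed_part r = middle_map \<mu>
      (zscale (\<alpha> * \<beta> * \<gamma> * \<delta>) (fst a) \<otimes>\<^sub>\<int> fst b \<otimes>\<^sub>\<int> fst c \<otimes>\<^sub>\<int> fst d)"
    by (simp add: r additive.diff[OF mixed_part(1)] mixed_part T_op_eq middle_map[OF \<mu>]
        mu_zscale zscale_tensor_int ac_simps)
  moreover have "EE_part r = 0"
    by (simp add: r additive.diff[OF EE_part(1)] EE_part T_op_eq)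
  ultimately show "r \<in> middle_ideal"
    unfolding middle_ideal_def by blast
qed

text \<open>By \<open>operators_decomp\<close> it suffices that an ideal containing the relators
  contains the image of \<open>B\<^sub>\<mu>\<close> and all of \<open>W \<otimes> W\<close>. The
  unit value of \<open>\<mu>\<close> serves for the latter.\<close>

lemma middle_ideal_least:
  assumes I: "rng_ideal (operator_mult (T_op \<mu>)) I" and rel: "operator_relators (T_op \<mu>) \<subseteq> I"
    and unit: "\<mu> (a \<otimes>\<^sub>\<int> b \<otimes>\<^sub>\<int> c) \<in> {1, -1}"
  shows "middle_ideal \<subseteq> I"
proof
  fix x assume x: "x \<in> middle_ideal"
  have S: "subgroup I additive_group"
    using I by (simp add: rng_ideal_def)
  have relI: "T_op \<mu> a \<alpha> b \<beta> c \<otimes>\<^sub>\<int> \<gamma> \<otimes>\<^sub>\<int> d \<otimes>\<^sub>\<int> \<delta> - a \<otimes>\<^sub>\<int> \<alpha> \<otimes>\<^sub>\<int> T_op \<mu> b \<beta> c \<gamma> d \<otimes>\<^sub>\<int> \<delta> \<in> I"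
    for a \<alpha> b \<beta> c \<gamma> d \<delta>
    using rel unfolding operator_relators_def by blast
  have "mixed_inj (middle_map \<mu> t) \<in> I" for t
  proof (rule additive_mem_subgroup4[where h = "\<lambda>t. mixed_inj (middle_map \<mu> t)", OF _ S])
    \<comment> \<open>The relator with all entries in \<open>E\<close> and all scalars 1 is exactly
      this element.\<close>
    show "mixed_inj (middle_map \<mu> (a \<otimes>\<^sub>\<int> b \<otimes>\<^sub>\<int> c \<otimes>\<^sub>\<int> d)) \<in> I" for a b c d
      using relI[of "(a, 0)" 1 "(b, 0)" 1 "(c, 0)" 1 "(d, 0)" 1]
      by (simp add: middle_map[OF \<mu>] additive.diff[OF mixed_inj])
        (simp add: mixed_inj_def WE_inj EW_inj additive.zero[OF WE_inj(1)]
          additive.zero[OF EW_inj(1)] additive.minus[OF EW_inj(1)] T_op_eq)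
  qed (rule additive_comp[OF mixed_inj middle_map(1)[OF \<mu>]])
  moreover have "WW_inj n \<in> I" for n
  proof -
    have "\<mu> (a \<otimes>\<^sub>\<int> b \<otimes>\<^sub>\<int> c) * \<mu> (a \<otimes>\<^sub>\<int> b \<otimes>\<^sub>\<int> c) = 1"
      using unit by auto
    \<comment> \<open>With the last entry in \<open>W\<close>, the second half of the relator
      vanishes, and the first half is \<open>n\<close> times the square of the unit value in
      \<open>W \<otimes> W\<close>.\<close>
    then show ?thesis
      using relI[of "(zscale (n * \<mu> (a \<otimes>\<^sub>\<int> b \<otimes>\<^sub>\<int> c)) a, 0)" 1 "(b, 0)" 1 "(c, 0)" 1 "(0, 1)" 1]
      by (simp add: T_op_eq mu_zscale WW_inj_def mult.assoc additive.zero[OF \<mu>]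
          flip: zero_prod_def)
  qed
  \<comment> \<open>The double sign is there because subgroup closure is stated for
    differences.\<close>
  ultimately have "mixed_inj (mixed_part x) - WW_inj (- WW_part x) \<in> I"
    using x S by (auto simp: middle_ideal_def additive_group_subgroup_iff)
  then have "mixed_inj (mixed_part x) + WW_inj (WW_part x) \<in> I"
    by (simp add: additive.minus[OF WW_inj])
  then show "x \<in> I"
    using x operators_decomp[of x] by (simp add: middle_ideal_def additive.zero[OF EE_inj(1)])
qed

lemma operator_ideal_eq:
  assumes "\<mu> (a \<otimes>\<^sub>\<int> b \<otimes>\<^sub>\<int> c) \<in> {1, -1}"
  shows "operator_ideal (T_op \<mu>) = middle_ideal"
  unfolding operator_ideal_def
  using rng_ideal_middle_ideal operator_relators_subset middle_ideal_least[OF _ _ assms] by blast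

section \<open>The defect as a direct product\<close>

lemma group_middle_coker: "group (middle_coker \<mu>)"
  unfolding middle_coker_def
  by (rule normal.factorgroup_is_group[OF normal_additive_group[OF subgroup_range_additive
      [OF middle_map(1)[OF \<mu>]]]])

lemma operator_defect_iso:
  assumes unit: "\<mu> (a \<otimes>\<^sub>\<int> b \<otimes>\<^sub>\<int> c) \<in> {1, -1}"
  shows "operator_defect (T_op \<mu>) \<cong>
    additive_group\<lparr>carrier := {t. Theta \<mu> t = 0}\<rparr> \<times>\<times> middle_coker \<mu>"
proof -
  \<comment> \<open>\<open>?K\<close> is the preimage of the defect in the tensor group. The map
    \<open>h\<close> below forgets the \<open>W \<otimes> W\<close> part and takes the class of the
    mixed part in \<open>Q\<^sub>\<mu>\<close>, so its kernel on \<open>?K\<close> is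
    \<open>middle_ideal\<close>.\<close>
  let ?R = "range (middle_map \<mu>)" and ?K = "{x. Theta \<mu> (EE_part x) = 0}"
  let ?ker = "additive_group\<lparr>carrier := {t. Theta \<mu> t = 0}\<rparr>"
  define h where "h x = (EE_part x, ?R #>\<^bsub>additive_group\<^esub> mixed_part x)" for x
  have R: "subgroup ?R additive_group"
    by (rule subgroup_range_additive[OF middle_map(1)[OF \<mu>]])
  have sub: "subgroup {t. Theta \<mu> t = 0} additive_group"
    by (simp add: additive_group_subgroup_iff additive.zero[OF additive_Theta]
        additive.diff[OF additive_Theta])
  have K: "subgroup ?K additive_group"
    by (simp add: additive_group_subgroup_iff additive.zero[OF additive_Theta]
        additive.diff[OF additive_Theta] additive.zero[OF EE_part(1)] additive.diff[OF EE_part(1)])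
  have H: "group (?ker \<times>\<times> middle_coker \<mu>)"
    by (rule DirProd_group[OF subgroup.subgroup_is_group[OF sub group_additive_group]
        group_middle_coker])
  have hom: "h \<in> hom (additive_group\<lparr>carrier := ?K\<rparr>) (?ker \<times>\<times> middle_coker \<mu>)"
    by (auto simp: hom_def h_def middle_coker_def carrier_FactGroup additive.add[OF EE_part(1)]
        additive.add[OF mixed_part(1)] normal.rcos_sum[OF normal_additive_group[OF R]])
  have surj: "h ` ?K = carrier (?ker \<times>\<times> middle_coker \<mu>)"
  proof
    show "h ` ?K \<subseteq> carrier (?ker \<times>\<times> middle_coker \<mu>)"
      using hom_carrier[OF hom] by simp
    show "carrier (?ker \<times>\<times> middle_coker \<mu>) \<subseteq> h ` ?K"
    proof
      fix p assume "p \<in> carrier (?ker \<times>\<times> middle_coker \<mu>)"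
      then obtain t z where "Theta \<mu> t = 0" "p = (t, ?R #>\<^bsub>additive_group\<^esub> z)"
        by (auto simp: middle_coker_def carrier_FactGroup)
      then show "p \<in> h ` ?K"
        by (intro image_eqI[where x = "EE_inj t + mixed_inj z"])
          (simp_all add: h_def additive.add[OF EE_part(1)] additive.add[OF mixed_part(1)]
            EE_part_EE_inj EE_part_mixed_inj mixed_part_EE_inj mixed_part_mixed_inj)
    qed
  qed
  have "?R #>\<^bsub>additive_group\<^esub> z = ?R \<longleftrightarrow> z \<in> ?R" for z
    using r_coset_additive_group_eq_iff[OF R, of z 0] by (simp add: r_coset_additive_group)
  then have ker: "{x \<in> ?K. h x = \<one>\<^bsub>?ker \<times>\<times> middle_coker \<mu>\<^esub>} = middle_ideal"
    by (auto simp: h_def middle_coker_def middle_ideal_def additive.zero[OF additive_Theta])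
  \<comment> \<open>The action sees only \<open>EE_part\<close>, which is zero on
    \<open>middle_ideal\<close>. So it is constant on each coset, and \<open>the_elem\<close>
    returns that constant.\<close>
  have "regular_rep (T_op \<mu>) (middle_ideal #>\<^bsub>additive_group\<^esub> x) = operator_action (T_op \<mu>) x"
    for x
  proof -
    have "operator_action (T_op \<mu>) ` (middle_ideal #>\<^bsub>additive_group\<^esub> x) =
        {operator_action (T_op \<mu>) x}"
      using subgroup.one_closed[OF subgroup_middle_ideal]
      by (auto simp: r_coset_additive_group image_image operator_action_T_op
          additive.add[OF EE_part(1)] middle_ideal_def)
    then show ?thesis
      by (simp add: regular_rep_def)
  qed
  moreover have "operator_action (T_op \<mu>) x = 0 \<longleftrightarrow> Theta \<mu> (EE_part x) = 0" for x
    by (auto simp: operator_action_T_op fun_eq_iff prod_eq_iff)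
  ultimately have "kernel (additive_group Mod middle_ideal) additive_End (regular_rep (T_op \<mu>)) =
      (\<lambda>x. middle_ideal #>\<^bsub>additive_group\<^esub> x) ` ?K"
    by (auto simp: kernel_def carrier_FactGroup additive_End_def)
  then show ?thesis
    using subgroup_Mod_iso[OF K H hom surj ker]
    by (simp add: operator_defect_def operator_rng_def operator_ideal_eq[OF unit])
qed

end

section \<open>The cokernel of the middle map\<close>

text \<open>For a sign \<open>\<rho>\<close> these are the coefficients of \<open>s\<close> times
  the threefold tensor power of the functional \<open>x0 + \<rho> * x1\<close> on
  \<open>E\<close>.\<close>

definition geometric :: "(nat \<Rightarrow> nat \<Rightarrow> nat \<Rightarrow> int) \<Rightarrow> int \<Rightarrow> bool" where
  "geometric M \<rho> \<longleftrightarrow>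
     (\<exists>s\<in>{1, -1}. \<forall>a\<in>{0,1}. \<forall>b\<in>{0,1}. \<forall>c\<in>{0,1}. M a b c = s * \<rho> ^ (a + b + c))"

text \<open>Balance says that the sign of an edge from \<open>a\<close> to \<open>d\<close> does not
  depend on \<open>b\<close> and \<open>c\<close>; the edge with \<open>b = c = 0\<close> is the
  reference. Suitable edges then express each entry through \<open>M 0 0 0\<close> and
  \<open>M 0 0 1\<close> according to the parity of \<open>a + b + c\<close>, and
  \<open>\<rho>\<close> is the product of these two signs.\<close>

lemma geometricI_balanced:
  assumes M: "\<And>a b c. a \<in> {0,1} \<Longrightarrow> b \<in> {0,1} \<Longrightarrow> c \<in> {0,1} \<Longrightarrow> M a b c \<in> {1, -1 :: int}"
    and balanced: "\<And>a b c d. a \<in> {0,1} \<Longrightarrow> b \<in> {0,1} \<Longrightarrow> c \<in> {0,1} \<Longrightarrow> d \<in> {0,1} \<Longrightarrow>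
      M a b c * M b c d = M a 0 0 * M 0 0 (d::nat)"
  shows "geometric M 1 \<or> geometric M (-1)"
proof -
  have signs: "M 0 0 0 \<in> {1, -1}" "M 0 0 1 \<in> {1, -1}"
    by (rule M; simp)+
  have cancel: "M a b c = x * y" if "x * M a b c = y" "x \<in> {1, -1}" for a b c x y
    using that by auto
  have m010: "M 0 1 0 = M 0 0 1"
    using cancel[OF balanced[of 0 0 1 0]] signs by auto
  have m011: "M 0 1 1 = M 0 0 0"
    using cancel[OF balanced[of 0 0 1 1]] signs by auto
  have m100: "M 1 0 0 = M 0 0 1"
    using cancel[OF balanced[of 0 1 0 0]] signs m010 by auto
  have m101: "M 1 0 1 = M 0 0 0"
    using cancel[OF balanced[of 0 1 0 1]] signs m010 by auto
  have m110: "M 1 1 0 = M 0 0 0"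
    using cancel[OF balanced[of 0 1 1 0]] signs m011 by auto
  have m111: "M 1 1 1 = M 0 0 1"
    using cancel[OF balanced[of 0 1 1 1]] signs m011 by auto
  show ?thesis
    using signs m010 m011 m100 m101 m110 m111 unfolding geometric_def by auto
qed

text \<open>Sends \<open>f\<^sub>d\<close> to \<open>\<rho> ^ d\<close> and \<open>g\<^sub>a\<close>
  to \<open>\<rho> ^ a\<close>. It becomes the quotient map to \<open>Q\<^sub>\<mu>\<close> in the
  balanced case and, taken modulo 2, in the unbalanced one.\<close>

definition phi :: "int \<Rightarrow> E2 \<times> E2 \<Rightarrow> int" where
  "phi \<rho> v = fst (fst v) + \<rho> * snd (fst v) + fst (snd v) + \<rho> * snd (snd v)"

text \<open>The two pairs of coordinates belong to \<open>f\<^sub>d = w \<otimes> e\<^sub>d\<close> and \<open>g\<^sub>a = e\<^sub>a \<otimes> w\<close>. Up to sign,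
  each basis relation identifies \<open>f\<^sub>d\<close> with \<open>\<mu>\<^sub>a\<^sub>b\<^sub>c \<mu>\<^sub>b\<^sub>c\<^sub>d g\<^sub>a\<close>.\<close>

lemma sign_relations_balanced:
  fixes T :: "(E2 \<times> E2) set"
  assumes T: "subgroup T additive_group" and \<rho>: "\<rho> \<in> {1, -1}"
    and rel: "\<And>n a d. a \<in> {0,1} \<Longrightarrow> d \<in> {0,1} \<Longrightarrow>
      (zscale n (e d), - zscale (n * \<rho> ^ (a + d)) (e a)) \<in> T"
    and v: "phi \<rho> v = 0"
  shows "v \<in> T"
proof -
  obtain x0 x1 y0 y1 where v_eq: "v = ((x0, x1), (y0, y1))" by (metis surj_pair)
  have add: "p + q \<in> T" if "p \<in> T" "q \<in> T" for p q
    using subgroup.m_closed[OF T that] by simp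
  \<comment> \<open>The edges \<open>f\<^sub>0 g\<^sub>0\<close>, \<open>f\<^sub>1 g\<^sub>0\<close>
    and \<open>f\<^sub>0 g\<^sub>1\<close> form a spanning tree. Their multiples are chosen to match
    \<open>x0\<close>, \<open>x1\<close> and \<open>y1\<close>; the coordinate \<open>y0\<close>
    then agrees because \<open>phi\<close> vanishes at \<open>v\<close>.\<close>
  have "((x0 + \<rho> * y1, 0), (- (x0 + \<rho> * y1), 0)) \<in> T"
    using rel[of 0 0 "x0 + \<rho> * y1"] by (simp add: zscale_def e_def)
  moreover have "((0, x1), (- (x1 * \<rho>), 0)) \<in> T"
    using rel[of 0 1 x1] by (simp add: zscale_def e_def)
  moreover have "((- (\<rho> * y1), 0), (0, \<rho> * y1 * \<rho>)) \<in> T"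
    using rel[of 1 0 "- (\<rho> * y1)"] by (simp add: zscale_def e_def)
  ultimately have "((x0 + \<rho> * y1, 0), (- (x0 + \<rho> * y1), 0)) + ((0, x1), (- (x1 * \<rho>), 0)) +
      ((- (\<rho> * y1), 0), (0, \<rho> * y1 * \<rho>)) \<in> T" (is "?w \<in> T")
    by (intro add)
  moreover have "?w = v"
    using v \<rho> by (auto simp: v_eq phi_def)
  ultimately show ?thesis by simp
qed

text \<open>Two edges with the same ends and opposite signs yield \<open>2 g\<^sub>a\<close>, and
  the tree carries this to \<open>2 g\<^sub>0\<close>. Elimination along the tree leaves a multiple
  of \<open>g\<^sub>0\<close>, which is even since signs are odd.\<close>

lemma sign_relations_unbalanced:
  fixes T :: "(E2 \<times> E2) set"
  assumes T: "subgroup T additive_group"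
    and M: "\<And>a b c. a \<in> {0,1} \<Longrightarrow> b \<in> {0,1} \<Longrightarrow> c \<in> {0,1} \<Longrightarrow> M a b c \<in> {1, -1 :: int}"
    and rel: "\<And>n a b c d. a \<in> {0,1} \<Longrightarrow> b \<in> {0,1} \<Longrightarrow> c \<in> {0,1} \<Longrightarrow> d \<in> {0,1} \<Longrightarrow>
      (zscale n (e d), - zscale (n * (M a b c * M b c d)) (e a)) \<in> T"
    and nonexceptional: "\<not> geometric M 1" "\<not> geometric M (-1)"
    and v: "even (phi 1 v)"
  shows "v \<in> T"
proof -
  have diff: "p - q \<in> T" if "p \<in> T" "q \<in> T" for p q
    using T that by (simp add: additive_group_subgroup_iff)
  have add: "p + q \<in> T" if "p \<in> T" "q \<in> T" for p q
    using subgroup.m_closed[OF T that] by simp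
  \<comment> \<open>The sign of the reference edge from \<open>g\<^sub>a\<close> to
    \<open>f\<^sub>d\<close>, with \<open>b = c = 0\<close>.\<close>
  define s where "s a d = M a 0 0 * M 0 0 d" for a d
  have s: "s a d \<in> {1, -1}" if "a \<in> {0,1}" "d \<in> {0,1}" for a d
    using M[of a 0 0] M[of 0 0 d] that by (auto simp: s_def)
  have rel0: "(zscale n (e d), - zscale (n * s a d) (e a)) \<in> T" if "a \<in> {0,1}" "d \<in> {0,1}" for n a d
    using rel[of a 0 0 d] that by (simp add: s_def)
  obtain a b c d where abcd: "a \<in> {0,1}" "b \<in> {0,1}" "c \<in> {0,1}" "d \<in> {0,1}"
    and neq: "M a b c * M b c d \<noteq> s a d"
    using geometricI_balanced[of M] M nonexceptional unfolding s_def by metis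
  have two_a: "(0, zscale (2 * n) (e a)) \<in> T" for n
  proof -
    have "M a b c * M b c d \<in> {1, -1}"
      using M[of a b c] M[of b c d] abcd by auto
    then have "M a b c * M b c d = - s a d"
      using neq s[of a d] abcd by auto
    then have "(zscale (n * s a d) (e d), - zscale (n * s a d * s a d) (e a)) -
        (zscale (n * s a d) (e d), - zscale (n * s a d * (M a b c * M b c d)) (e a)) =
        - (0, zscale (2 * (n * (s a d * s a d))) (e a))"
      by (simp add: zscale_def prod_eq_iff algebra_simps)
    also have "s a d * s a d = 1"
      using s[of a d] abcd by auto
    finally have "- (0, zscale (2 * n) (e a)) \<in> T"
      using diff[OF rel0 rel] abcd by (metis mult.right_neutral)
    then show ?thesis
      using subgroup.m_inv_closed[OF T] by fastforce
  qed
  have two: "((0, 0), (2 * n, 0)) \<in> T" for n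
  proof (cases "a = 0")
    case True
    then show ?thesis using two_a[of n] by (simp add: zscale_def e_def zero_prod_def)
  next
    case False
    then have a: "a = 1" using abcd by simp
    \<comment> \<open>Here \<open>a = 1\<close>: two reference edges at \<open>f\<^sub>0\<close>
      exchange \<open>2 g\<^sub>1\<close> for \<open>2 g\<^sub>0\<close>, up to sign.\<close>
    have "(zscale (2 * n * s 0 0) (e 0), - zscale (2 * n * s 0 0 * s 1 0) (e 1)) -
        (zscale (2 * n * s 0 0) (e 0), - zscale (2 * n * s 0 0 * s 0 0) (e 0)) +
        (0, zscale (2 * (n * s 0 0 * s 1 0)) (e 1)) \<in> T" (is "?w \<in> T")
      using two_a rel0[of 1 0 "2 * n * s 0 0"] rel0[of 0 0 "2 * n * s 0 0"] a
      by (intro add diff) simp_all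
    moreover have "?w = ((0, 0), (2 * n, 0))"
      using s[of 0 0] by (auto simp: zscale_def e_def prod_eq_iff)
    ultimately show ?thesis by simp
  qed
  obtain x0 x1 y0 y1 where v_eq: "v = ((x0, x1), (y0, y1))" by (metis surj_pair)
  \<comment> \<open>The multiple of \<open>g\<^sub>0\<close> that remains once \<open>x0\<close>,
    \<open>x1\<close> and \<open>y1\<close> are matched along the spanning tree.\<close>
  define z where "z = (x0 + y1 * s 1 0) * s 0 0 + x1 * s 0 1 + y0"
  have "even z"
    using v s[of 0 0] s[of 0 1] s[of 1 0] by (auto simp: z_def v_eq phi_def)
  then obtain n where n: "z = 2 * n" ..
  have "(zscale (x0 + y1 * s 1 0) (e 0), - zscale ((x0 + y1 * s 1 0) * s 0 0) (e 0)) +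
      (zscale x1 (e 1), - zscale (x1 * s 0 1) (e 0)) +
      (zscale (- (y1 * s 1 0)) (e 0), - zscale (- (y1 * s 1 0) * s 1 0) (e 1)) +
      ((0, 0), (2 * n, 0)) \<in> T" (is "?w \<in> T")
    by (intro add rel0 two) simp_all
  moreover have "?w = v"
    using s[of 1 0] by (auto simp: v_eq zscale_def e_def prod_eq_iff z_def simp flip: n)
  ultimately show ?thesis by simp
qed

section \<open>Coordinates on the mixed summand and coefficients of trilinear maps\<close>

definition mixed_coords :: "(int \<otimes>\<^sub>\<int> E2) \<times> (E2 \<otimes>\<^sub>\<int> int) \<Rightarrow> E2 \<times> E2" where
  "mixed_coords z =
     (tensor_extend zscale (fst z), tensor_extend (\<lambda>x n. zscale n x) (snd z))"

definition mixed_of_coords :: "E2 \<times> E2 \<Rightarrow> (int \<otimes>\<^sub>\<int> E2) \<times> (E2 \<otimes>\<^sub>\<int> int)" where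
  "mixed_of_coords v = (1 \<otimes>\<^sub>\<int> fst v, snd v \<otimes>\<^sub>\<int> 1)"

lemma tensor_extend_zscale:
  "additive (tensor_extend zscale)" "tensor_extend zscale (n \<otimes>\<^sub>\<int> x) = zscale n x"
  "additive (tensor_extend (\<lambda>x n. zscale n x))"
  "tensor_extend (\<lambda>x n. zscale n x) (x \<otimes>\<^sub>\<int> n) = zscale n x"
  by (rule tensor_extend; simp add: additive_def)+

lemma additive_mixed_coords: "additive mixed_coords"
  by (simp add: additive_def mixed_coords_def additive.add[OF tensor_extend_zscale(1)]
      additive.add[OF tensor_extend_zscale(3)])

lemma mixed_coords_tensors [simp]:
  "mixed_coords (n \<otimes>\<^sub>\<int> x, y \<otimes>\<^sub>\<int> m) = (zscale n x, zscale m y)"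
  by (simp add: mixed_coords_def tensor_extend_zscale)

lemma additive_mixed_of_coords: "additive mixed_of_coords"
  by (simp add: additive_def mixed_of_coords_def tensor_add_left tensor_add_right)

lemma mixed_coords_of_coords [simp]: "mixed_coords (mixed_of_coords v) = v"
  by (simp add: mixed_of_coords_def)

lemma int_tensor_zscale: "(n::int) \<otimes>\<^sub>\<int> x = 1 \<otimes>\<^sub>\<int> zscale n x"
  by (rule additive_int_eqI[where f = "\<lambda>n. n \<otimes>\<^sub>\<int> x"])
    (simp_all add: additive_def tensor_add_left tensor_add_right)

lemma mixed_of_coords_coords [simp]: "mixed_of_coords (mixed_coords z) = z"
proof -
  have "1 \<otimes>\<^sub>\<int> tensor_extend zscale s = s" for s :: "int \<otimes>\<^sub>\<int> E2"
    by (rule additive_eq_on_tensorsI[where h = "\<lambda>s. s", THEN fun_cong,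
          OF additive_comp[OF additive_tensor_elem_right tensor_extend_zscale(1)]])
      (simp_all add: additive_def tensor_extend_zscale flip: int_tensor_zscale)
  moreover have "tensor_extend (\<lambda>x n. zscale n x) t \<otimes>\<^sub>\<int> 1 = t" for t :: "E2 \<otimes>\<^sub>\<int> int"
    by (rule additive_eq_on_tensorsI[where h = "\<lambda>t. t", THEN fun_cong,
          OF additive_comp[OF additive_tensor_elem_left tensor_extend_zscale(3)]])
      (simp_all add: additive_def tensor_extend_zscale zscale_tensor_int)
  ultimately show ?thesis
    by (simp add: mixed_coords_def mixed_of_coords_def)
qed

definition coef :: "(E2 \<otimes>\<^sub>\<int> E2 \<otimes>\<^sub>\<int> E2 \<Rightarrow> int) \<Rightarrow> nat \<Rightarrow> nat \<Rightarrow> nat \<Rightarrow> int" where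
  "coef \<mu> a b c = \<mu> (e a \<otimes>\<^sub>\<int> e b \<otimes>\<^sub>\<int> e c)"

lemma E2_decomp: "(x::E2) = zscale (fst x) (e 0) + zscale (snd x) (e 1)"
  by (simp add: zscale_def e_def)

lemma additive_expand:
  "additive f \<Longrightarrow> f x = fst x * f (e 0) + snd x * (f (e 1) :: int)"
  by (subst E2_decomp) (simp add: additive.add additive_zscale)

lemma mu_expand_third:
  assumes "additive \<mu>"
  shows "\<mu> (t \<otimes>\<^sub>\<int> z) = fst z * \<mu> (t \<otimes>\<^sub>\<int> e 0) + snd z * (\<mu> (t \<otimes>\<^sub>\<int> e 1) :: int)"
  by (rule additive_expand) (rule additive_comp[OF assms additive_tensor_elem_right])

lemma mu_expand_second:
  assumes "additive \<mu>"
  shows "\<mu> (x \<otimes>\<^sub>\<int> y \<otimes>\<^sub>\<int> z) = fst y * \<mu> (x \<otimes>\<^sub>\<int> e 0 \<otimes>\<^sub>\<int> z) + snd y * (\<mu> (x \<otimes>\<^sub>\<int> e 1 \<otimes>\<^sub>\<int> z) :: int)"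
  by (rule additive_expand[where f = "\<lambda>y. \<mu> (x \<otimes>\<^sub>\<int> y \<otimes>\<^sub>\<int> z)"])
    (simp add: additive_def tensor_add_left tensor_add_right additive.add[OF assms])

lemma mu_expand_first:
  assumes "additive \<mu>"
  shows "\<mu> (x \<otimes>\<^sub>\<int> y \<otimes>\<^sub>\<int> z) = fst x * \<mu> (e 0 \<otimes>\<^sub>\<int> y \<otimes>\<^sub>\<int> z) + snd x * (\<mu> (e 1 \<otimes>\<^sub>\<int> y \<otimes>\<^sub>\<int> z) :: int)"
  by (rule additive_expand[where f = "\<lambda>x. \<mu> (x \<otimes>\<^sub>\<int> y \<otimes>\<^sub>\<int> z)"])
    (simp add: additive_def tensor_add_left tensor_add_right additive.add[OF assms])

lemma mu_expand:
  assumes "additive \<mu>"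
  shows "\<mu> (x \<otimes>\<^sub>\<int> y \<otimes>\<^sub>\<int> z) =
    fst z * (fst y * (fst x * coef \<mu> 0 0 0 + snd x * coef \<mu> 1 0 0) +
             snd y * (fst x * coef \<mu> 0 1 0 + snd x * coef \<mu> 1 1 0)) +
    snd z * (fst y * (fst x * coef \<mu> 0 0 1 + snd x * coef \<mu> 1 0 1) +
             snd y * (fst x * coef \<mu> 0 1 1 + snd x * coef \<mu> 1 1 1))"
  unfolding coef_def
  by (simp only: mu_expand_third[OF assms, of _ z] mu_expand_second[OF assms, of _ y]
      mu_expand_first[OF assms, of x])

lemma sign_tensors_iff:
  "\<mu> \<in> sign_tensors \<longleftrightarrow>
    additive \<mu> \<and> (\<forall>a\<in>{0,1}. \<forall>b\<in>{0,1}. \<forall>c\<in>{0,1}. coef \<mu> a b c \<in> {1, -1})"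
  by (simp add: sign_tensors_def coef_def)

lemma coef_sign:
  "\<mu> \<in> sign_tensors \<Longrightarrow> a \<in> {0,1} \<Longrightarrow> b \<in> {0,1} \<Longrightarrow> c \<in> {0,1} \<Longrightarrow> coef \<mu> a b c \<in> {1, -1}"
  unfolding sign_tensors_iff by blast

lemma middle_map_coords:
  assumes "additive \<mu>"
  shows "mixed_coords (middle_map \<mu> (a \<otimes>\<^sub>\<int> b \<otimes>\<^sub>\<int> c \<otimes>\<^sub>\<int> d)) =
    (zscale (\<mu> (a \<otimes>\<^sub>\<int> b \<otimes>\<^sub>\<int> c)) d, - zscale (\<mu> (b \<otimes>\<^sub>\<int> c \<otimes>\<^sub>\<int> d)) a)"
proof -
  \<comment> \<open>The zeros are written as pure tensors so that
    \<open>mixed_coords_tensors\<close> applies to both pairs.\<close>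
  have "middle_map \<mu> (a \<otimes>\<^sub>\<int> b \<otimes>\<^sub>\<int> c \<otimes>\<^sub>\<int> d) =
      (\<mu> (a \<otimes>\<^sub>\<int> b \<otimes>\<^sub>\<int> c) \<otimes>\<^sub>\<int> d, a \<otimes>\<^sub>\<int> 0) - (0 \<otimes>\<^sub>\<int> d, a \<otimes>\<^sub>\<int> \<mu> (b \<otimes>\<^sub>\<int> c \<otimes>\<^sub>\<int> d))"
    by (simp only: middle_map[OF assms] tensor_zero_left tensor_zero_right)
  then show ?thesis
    by (simp only: additive.diff[OF additive_mixed_coords] mixed_coords_tensors)
      (simp add: prod_eq_iff)
qed

text \<open>Treats the infinite cyclic case \<open>k = 0\<close> and the case \<open>k = 2\<close>
  at once: \<open>phi\<close> modulo \<open>k\<close> is shown to have the image of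
  \<open>B\<^sub>\<mu>\<close> as kernel. By \<open>cong\<close>, \<open>\<mu>\<close> is a
  geometric tensor modulo \<open>k\<close>, so \<open>phi\<close> kills the image modulo
  \<open>k\<close>; \<open>least\<close> gives the converse inclusion.\<close>

lemma middle_coker_iso_aux:
  assumes \<mu>: "\<mu> \<in> sign_tensors" and \<rho>: "\<rho> \<in> {1, -1}"
    and cong: "\<And>a b c. a \<in> {0,1} \<Longrightarrow> b \<in> {0,1} \<Longrightarrow> c \<in> {0,1} \<Longrightarrow>
      int k dvd coef \<mu> a b c - s * \<rho> ^ (a + b + c)"
    and least: "\<And>T v. subgroup T additive_group \<Longrightarrow>
      (\<And>n a b c d. a \<in> {0,1} \<Longrightarrow> b \<in> {0,1} \<Longrightarrow> c \<in> {0,1} \<Longrightarrow> d \<in> {0,1} \<Longrightarrow>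
        (zscale n (e d), - zscale (n * (coef \<mu> a b c * coef \<mu> b c d)) (e a)) \<in> T) \<Longrightarrow>
      int k dvd phi \<rho> v \<Longrightarrow> v \<in> T"
  shows "middle_coker \<mu> \<cong> integer_mod_group k"
proof -
  let ?R = "range (middle_map \<mu>)"
  have add: "additive \<mu>"
    using \<mu> by (simp add: sign_tensors_iff)
  have R: "subgroup ?R additive_group"
    by (rule subgroup_range_additive[OF middle_map(1)[OF add]])
  define \<phi> where "\<phi> z = phi \<rho> (mixed_coords z)" for z
  have \<phi>: "additive \<phi>"
    by (simp add: additive_def \<phi>_def phi_def additive.add[OF additive_mixed_coords] algebra_simps)
  have R_iff: "z \<in> ?R \<longleftrightarrow> int k dvd \<phi> z" for z
  proof
    assume "int k dvd \<phi> z"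
    then have dvd: "int k dvd phi \<rho> (mixed_coords z)"
      by (simp add: \<phi>_def)
    have sub: "subgroup {v. mixed_of_coords v \<in> ?R} additive_group"
      using R unfolding additive_group_subgroup_iff mem_Collect_eq
        additive.zero[OF additive_mixed_of_coords]
      by (metis additive.diff[OF additive_mixed_of_coords] mem_Collect_eq)
    have "(zscale n (e d), - zscale (n * (coef \<mu> a b c * coef \<mu> b c d)) (e a))
        \<in> {v. mixed_of_coords v \<in> ?R}"
      if "a \<in> {0,1}" "b \<in> {0,1}" "c \<in> {0,1}" "d \<in> {0,1}" for n a b c d
    proof -
      have "coef \<mu> a b c \<in> {1, -1}"
        using coef_sign[OF \<mu>] that by blast
      then have "coef \<mu> a b c * coef \<mu> a b c = 1"
        by auto
      then have "coef \<mu> a b c * coef \<mu> a b c = 1" "coef \<mu> a b c * (coef \<mu> a b c * m) = m" for m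
        by (simp_all flip: mult.assoc)
      \<comment> \<open>The extra factor \<open>coef \<mu> a b c\<close> on \<open>e a\<close>
        squares to 1 in front of \<open>e d\<close>, which leaves exactly \<open>n\<close>
        there.\<close>
      then have eq: "mixed_coords (middle_map \<mu>
          (zscale (n * coef \<mu> a b c) (e a) \<otimes>\<^sub>\<int> e b \<otimes>\<^sub>\<int> e c \<otimes>\<^sub>\<int> e d)) =
          (zscale n (e d), - zscale (n * (coef \<mu> a b c * coef \<mu> b c d)) (e a))"
        by (simp add: middle_map_coords[OF add] mu_zscale[OF add] coef_def ac_simps)
      show ?thesis
        unfolding mem_Collect_eq eq[symmetric] mixed_of_coords_coords by (rule rangeI)
    qed
    from least[OF sub this dvd] show "z \<in> ?R"
      by simp
  next
    assume "z \<in> ?R"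
    then obtain t where z: "z = middle_map \<mu> t" by blast
    have sub: "subgroup {n. int k dvd n} additive_group"
      by (simp add: additive_group_subgroup_iff)
    \<comment> \<open>The functional whose threefold power, times \<open>s\<close>, has coefficients
      congruent to those of \<open>\<mu>\<close>.\<close>
    define L where "L x = fst x + \<rho> * snd x" for x :: E2
    have dvd_L: "int k dvd \<mu> (x \<otimes>\<^sub>\<int> y \<otimes>\<^sub>\<int> z) - s * (L x * L y * L z)" for x y z
    proof -
      have "\<exists>t. \<forall>a\<in>{0,1}. \<forall>b\<in>{0,1}. \<forall>c\<in>{0,1}. coef \<mu> a b c = s * \<rho> ^ (a + b + c) + int k * t a b c"
      proof (intro exI ballI)
        show "coef \<mu> a b c = s * \<rho> ^ (a + b + c) +
            int k * ((coef \<mu> a b c - s * \<rho> ^ (a + b + c)) div int k)"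
          if "a \<in> {0,1}" "b \<in> {0,1}" "c \<in> {0,1}" for a b c
          using cong[OF that] by simp
      qed
      then obtain t where t: "coef \<mu> a b c = s * \<rho> ^ (a + b + c) + int k * t a b c"
        if "a \<in> {0,1}" "b \<in> {0,1}" "c \<in> {0,1}" for a b c
        by blast
      have "\<mu> (x \<otimes>\<^sub>\<int> y \<otimes>\<^sub>\<int> z) - s * (L x * L y * L z) = int k *
        (fst z * (fst y * (fst x * t 0 0 0 + snd x * t 1 0 0) +
                  snd y * (fst x * t 0 1 0 + snd x * t 1 1 0)) +
         snd z * (fst y * (fst x * t 0 0 1 + snd x * t 1 0 1) +
                  snd y * (fst x * t 0 1 1 + snd x * t 1 1 1)))"
        by (simp add: mu_expand[OF add] t L_def)
          (simp add: algebra_simps power2_eq_square power3_eq_cube)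
      then show ?thesis by simp
    qed
    have "\<phi> (middle_map \<mu> t) \<in> {n. int k dvd n}"
    proof (rule additive_mem_subgroup4[OF additive_comp[OF \<phi> middle_map(1)[OF add]] sub])
      fix a b c d :: E2
      have "\<phi> (middle_map \<mu> (a \<otimes>\<^sub>\<int> b \<otimes>\<^sub>\<int> c \<otimes>\<^sub>\<int> d)) =
          \<mu> (a \<otimes>\<^sub>\<int> b \<otimes>\<^sub>\<int> c) * L d - \<mu> (b \<otimes>\<^sub>\<int> c \<otimes>\<^sub>\<int> d) * L a"
        by (simp add: \<phi>_def middle_map_coords[OF add] phi_def L_def zscale_def algebra_simps)
      \<comment> \<open>Both subtracted corrections equal \<open>s * L a * L b * L c * L d\<close>
        and cancel; what is left in each bracket is divisible by \<open>k\<close>.\<close>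
      also have "\<dots> = (\<mu> (a \<otimes>\<^sub>\<int> b \<otimes>\<^sub>\<int> c) - s * (L a * L b * L c)) * L d -
          (\<mu> (b \<otimes>\<^sub>\<int> c \<otimes>\<^sub>\<int> d) - s * (L b * L c * L d)) * L a"
        by (simp add: algebra_simps)
      finally show "\<phi> (middle_map \<mu> (a \<otimes>\<^sub>\<int> b \<otimes>\<^sub>\<int> c \<otimes>\<^sub>\<int> d)) \<in> {n. int k dvd n}"
        using dvd_L by (simp add: dvd_diff)
    qed
    then show "int k dvd \<phi> z"
      by (simp add: z)
  qed
  let ?f = "\<lambda>z. \<phi> z mod int k"
  have hom: "?f \<in> hom (additive_group\<lparr>carrier := UNIV\<rparr>) (integer_mod_group k)"
    by (simp add: hom_def carrier_integer_mod_group additive.add[OF \<phi>] mod_add_eq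
        del: split_paired_All)
  have surj: "?f ` UNIV = carrier (integer_mod_group k)"
  proof
    show "?f ` UNIV \<subseteq> carrier (integer_mod_group k)"
      using hom_carrier[OF hom] by simp
    show "carrier (integer_mod_group k) \<subseteq> ?f ` UNIV"
    proof
      fix n assume "n \<in> carrier (integer_mod_group k)"
      then have "n mod int k = n"
        by (simp add: carrier_integer_mod_group split: if_splits)
      then show "n \<in> ?f ` UNIV"
        by (intro image_eqI[where x = "mixed_of_coords ((n, 0), (0, 0))"])
          (simp_all add: \<phi>_def phi_def)
    qed
  qed
  have ker: "{z \<in> UNIV. ?f z = \<one>\<^bsub>integer_mod_group k\<^esub>} = ?R"
    unfolding set_eq_iff mem_Collect_eq R_iff by (simp add: dvd_eq_mod_eq_0)
  have univ: "subgroup UNIV additive_group"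
    by (simp add: additive_group_subgroup_iff)
  have "additive_group Mod ?R =
      (additive_group Mod ?R)\<lparr>carrier := (\<lambda>z. ?R #>\<^bsub>additive_group\<^esub> z) ` UNIV\<rparr>"
    by (auto simp: FactGroup_def RCOSETS_def)
  then show ?thesis
    using subgroup_Mod_iso[OF univ group_integer_mod_group hom surj ker]
    by (simp add: middle_coker_def)
qed

text \<open>The case \<open>k = 0\<close>, where divisibility means vanishing. The edges with
  \<open>b = c = 0\<close> have sign \<open>\<rho> ^ (a + d)\<close> and suffice for the spanning
  tree argument.\<close>

lemma middle_coker_geometric:
  assumes \<mu>: "\<mu> \<in> sign_tensors" and exceptional: "geometric (coef \<mu>) \<rho>" and \<rho>: "\<rho> \<in> {1, -1}"
  shows "middle_coker \<mu> \<cong> integer_group"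
proof -
  obtain s where s: "s \<in> {1, -1}"
    and M: "\<And>a b c. a \<in> {0,1} \<Longrightarrow> b \<in> {0,1} \<Longrightarrow> c \<in> {0,1} \<Longrightarrow> coef \<mu> a b c = s * \<rho> ^ (a + b + c)"
    using exceptional unfolding geometric_def by blast
  have "middle_coker \<mu> \<cong> integer_mod_group 0"
  proof (rule middle_coker_iso_aux[OF \<mu> \<rho>, where s = s])
    fix T v
    assume T: "subgroup T additive_group" and v: "int 0 dvd phi \<rho> v"
      and rel: "\<And>n a b c d. a \<in> {0,1} \<Longrightarrow> b \<in> {0,1} \<Longrightarrow> c \<in> {0,1} \<Longrightarrow> d \<in> {0,1} \<Longrightarrow>
        (zscale n (e d), - zscale (n * (coef \<mu> a b c * coef \<mu> b c d)) (e a)) \<in> T"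
    show "v \<in> T"
    proof (rule sign_relations_balanced[OF T \<rho>])
      fix n and a d :: nat
      assume ad: "a \<in> {0,1}" "d \<in> {0,1}"
      have "coef \<mu> a 0 0 * coef \<mu> 0 0 d = s * \<rho> ^ a * (s * \<rho> ^ d)"
        using ad by (simp add: M)
      also have "\<dots> = \<rho> ^ (a + d)"
        using s by (auto simp: power_add)
      finally show "(zscale n (e d), - zscale (n * \<rho> ^ (a + d)) (e a)) \<in> T"
        using rel[of a 0 0 d n] ad by simp
    qed (use v in simp)
  qed (simp add: M)
  then show ?thesis
    by (simp add: integer_mod_group_def)
qed

text \<open>The case \<open>k = 2\<close>: every sign is 1 modulo 2, so each sign tensor is
  congruent to the constant one, given by \<open>s = 1\<close> and
  \<open>\<rho> = 1\<close>.\<close>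

lemma middle_coker_nongeometric:
  assumes \<mu>: "\<mu> \<in> sign_tensors"
    and nonexceptional: "\<not> geometric (coef \<mu>) 1" "\<not> geometric (coef \<mu>) (-1)"
  shows "middle_coker \<mu> \<cong> integer_mod_group 2"
proof (rule middle_coker_iso_aux[OF \<mu>, where s = 1 and \<rho> = 1])
  fix a b c :: nat assume "a \<in> {0,1}" "b \<in> {0,1}" "c \<in> {0,1}"
  then have "coef \<mu> a b c \<in> {1, -1}"
    by (rule coef_sign[OF \<mu>])
  then show "int 2 dvd coef \<mu> a b c - 1 * 1 ^ (a + b + c)"
    by auto
next
  fix T v
  assume T: "subgroup T additive_group" and v: "int 2 dvd phi 1 v"
    and rel: "\<And>n a b c d. a \<in> {0,1} \<Longrightarrow> b \<in> {0,1} \<Longrightarrow> c \<in> {0,1} \<Longrightarrow> d \<in> {0,1} \<Longrightarrow>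
      (zscale n (e d), - zscale (n * (coef \<mu> a b c * coef \<mu> b c d)) (e a)) \<in> T"
  show "v \<in> T"
    using v by (intro sign_relations_unbalanced[OF T coef_sign[OF \<mu>] rel nonexceptional]) simp_all
qed simp

section \<open>The kernel of \<open>\<Theta>\<^sub>\<mu>\<close>\<close>

text \<open>The tensor \<open>p \<otimes> e\<^sub>0 + q \<otimes> e\<^sub>1\<close> is recorded as
  \<open>(p, q)\<close>. Thus \<open>p1\<close> belongs to
  \<open>e\<^sub>1 \<otimes> e\<^sub>0\<close> and \<open>q0\<close> to
  \<open>e\<^sub>0 \<otimes> e\<^sub>1\<close>.\<close>

definition EE_coords :: "E2 \<otimes>\<^sub>\<int> E2 \<Rightarrow> E2 \<times> E2" where
  "EE_coords = tensor_extend (\<lambda>x y. (zscale (fst y) x, zscale (snd y) x))"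

definition EE_of_coords :: "E2 \<times> E2 \<Rightarrow> E2 \<otimes>\<^sub>\<int> E2" where
  "EE_of_coords v = fst v \<otimes>\<^sub>\<int> e 0 + snd v \<otimes>\<^sub>\<int> e 1"

lemma EE_coords: "additive EE_coords" "EE_coords (x \<otimes>\<^sub>\<int> y) = (zscale (fst y) x, zscale (snd y) x)"
  unfolding EE_coords_def by (rule tensor_extend; simp add: additive_def)+

lemma EE_coords_of_coords [simp]: "EE_coords (EE_of_coords v) = v"
  by (simp add: EE_of_coords_def additive.add[OF EE_coords(1)] EE_coords e_def zscale_def
      prod_eq_iff)

lemma zscale_tensor: "zscale n x \<otimes>\<^sub>\<int> y = x \<otimes>\<^sub>\<int> zscale n y"
  by (rule additive_int_eqI[where f = "\<lambda>n. zscale n x \<otimes>\<^sub>\<int> y"])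
    (simp_all add: additive_def tensor_add_left tensor_add_right)

lemma EE_of_coords_coords [simp]: "EE_of_coords (EE_coords t) = t"
proof (rule additive_eq_on_tensorsI[where g = "\<lambda>t. EE_of_coords (EE_coords t)"
      and h = "\<lambda>t. t", THEN fun_cong])
  show "additive (\<lambda>t. EE_of_coords (EE_coords t))"
    by (simp add: additive_def additive.add[OF EE_coords(1)] EE_of_coords_def tensor_add_left)
  show "EE_of_coords (EE_coords (x \<otimes>\<^sub>\<int> y)) = x \<otimes>\<^sub>\<int> y" for x y
    by (simp only: EE_coords EE_of_coords_def fst_conv snd_conv zscale_tensor
        flip: tensor_add_right E2_decomp)
qed (simp add: additive_def)

lemma Theta_of_coords:
  assumes "additive \<mu>"
  shows "Theta \<mu> (EE_of_coords ((p0, p1), (q0, q1))) x =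
    fst x * (p0 * coef \<mu> 0 0 0 + p1 * coef \<mu> 1 0 0 + q0 * coef \<mu> 0 1 0 + q1 * coef \<mu> 1 1 0) +
    snd x * (p0 * coef \<mu> 0 0 1 + p1 * coef \<mu> 1 0 1 + q0 * coef \<mu> 0 1 1 + q1 * coef \<mu> 1 1 1)"
  by (simp add: Theta_def EE_of_coords_def tensor_add_left additive.add[OF assms]
      mu_expand[OF assms, of "(p0, p1)"] mu_expand[OF assms, of "(q0, q1)"] e_def algebra_simps)

lemma Theta_of_coords_eq_zero_iff:
  assumes "additive \<mu>"
  shows "Theta \<mu> (EE_of_coords ((p0, p1), (q0, q1))) = 0 \<longleftrightarrow>
    p0 * coef \<mu> 0 0 0 + p1 * coef \<mu> 1 0 0 + q0 * coef \<mu> 0 1 0 + q1 * coef \<mu> 1 1 0 = 0 \<and>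
    p0 * coef \<mu> 0 0 1 + p1 * coef \<mu> 1 0 1 + q0 * coef \<mu> 0 1 1 + q1 * coef \<mu> 1 1 1 = 0"
    (is "_ = 0 \<longleftrightarrow> ?A = 0 \<and> ?B = 0")
proof
  assume zero: "Theta \<mu> (EE_of_coords ((p0, p1), (q0, q1))) = 0"
  show "?A = 0 \<and> ?B = 0"
    using fun_cong[OF zero, of "(1, 0)"] fun_cong[OF zero, of "(0, 1)"]
    by (simp add: Theta_of_coords[OF assms])
next
  assume "?A = 0 \<and> ?B = 0"
  then show "Theta \<mu> (EE_of_coords ((p0, p1), (q0, q1))) = 0"
    by (simp add: fun_eq_iff Theta_of_coords[OF assms])
qed

text \<open>Meant for a projection \<open>f\<close> onto free coordinates: \<open>inj\<close> and
  \<open>surj\<close> say that the kernel equations determine the remaining coordinates uniquely and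
  over \<int>.\<close>

lemma kernel_iso:
  fixes f :: "E2 \<times> E2 \<Rightarrow> 'h::ab_group_add" and \<mu> :: "E2 \<otimes>\<^sub>\<int> E2 \<otimes>\<^sub>\<int> E2 \<Rightarrow> int"
  assumes f: "additive f"
    and inj: "\<And>v. Theta \<mu> (EE_of_coords v) = 0 \<Longrightarrow> f v = 0 \<Longrightarrow> v = 0"
    and surj: "\<And>w. \<exists>v. Theta \<mu> (EE_of_coords v) = 0 \<and> f v = w"
    and \<mu>: "additive \<mu>"
  shows "additive_group\<lparr>carrier := {t. Theta \<mu> t = 0}\<rparr> \<cong> (additive_group :: 'h monoid)"
proof (rule is_isoI, unfold iso_def, intro CollectI conjI bij_betwI')
  let ?g = "\<lambda>t. f (EE_coords t)"
  have g: "additive ?g"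
    by (rule additive_comp[OF f EE_coords(1)])
  show "?g \<in> hom (additive_group\<lparr>carrier := {t. Theta \<mu> t = 0}\<rparr>) additive_group"
    by (simp add: hom_def additive.add[OF g])
  show "?g s = ?g t \<longleftrightarrow> s = t"
    if "s \<in> carrier (additive_group\<lparr>carrier := {t. Theta \<mu> t = 0}\<rparr>)"
      "t \<in> carrier (additive_group\<lparr>carrier := {t. Theta \<mu> t = 0}\<rparr>)" for s t
  proof
    assume "?g s = ?g t"
    then have "f (EE_coords (s - t)) = 0"
      using additive.diff[OF g, of s t] by simp
    moreover have "Theta \<mu> (EE_of_coords (EE_coords (s - t))) = 0"
      using that by (simp add: additive.diff[OF additive_Theta[OF \<mu>]])
    ultimately have "EE_coords (s - t) = 0"
      using inj by blast
    moreover have "EE_of_coords 0 = 0"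
      by (simp add: EE_of_coords_def)
    ultimately show "s = t"
      using EE_of_coords_coords[of "s - t"] by simp
  qed simp
  show "\<exists>t \<in> carrier (additive_group\<lparr>carrier := {t. Theta \<mu> t = 0}\<rparr>). w = ?g t" for w
  proof -
    obtain v where "Theta \<mu> (EE_of_coords v) = 0" "f v = w"
      using surj by blast
    then show ?thesis
      by (intro bexI[of _ "EE_of_coords v"]) simp_all
  qed
qed simp

lemma integer_group_eq: "integer_group = additive_group"
  by (simp add: integer_group_def additive_group_def)

lemma DirProd_additive_group:
  "(additive_group :: 'a::ab_group_add monoid) \<times>\<times> (additive_group :: 'b::ab_group_add monoid) =
    additive_group"
  by (simp add: DirProd_def additive_group_def fun_eq_iff zero_prod_def)

section \<open>Solving the kernel equations over the integers\<close>

lemma sign_system_unique: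
  fixes v w :: int
  assumes "a \<in> {1, -1}" "b \<in> {1, -1}" "c \<in> {1, -1}" "d \<in> {1, -1}" "a * d \<noteq> b * c"
    and "v * a + w * b = 0" "v * c + w * d = 0"
  shows "v = 0 \<and> w = 0"
  using assms by auto

text \<open>The determinant \<open>a * d - b * c\<close> is 2 or -2. By Cramer's rule an integral
  solution requires even sign combinations of \<open>x\<close> and \<open>y\<close>, which is the
  parity of \<open>x - y\<close>.\<close>

lemma sign_system_solvable:
  fixes x y :: int
  assumes "a \<in> {1, -1}" "b \<in> {1, -1}" "c \<in> {1, -1}" "d \<in> {1, -1}" "a * d \<noteq> b * c"
    and "even (x - y)"
  shows "\<exists>v w. v * a + w * b + x = 0 \<and> v * c + w * d + y = 0"
proof -
  obtain k where k: "x - y = 2 * k" using assms(6) ..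
  then have x: "x = y + 2 * k" by simp
  show ?thesis
    unfolding x using assms(1-5) by (elim insertE emptyE; simp; presburger)
qed

text \<open>The coordinates at \<open>(0, 0)\<close> and \<open>(a, b)\<close> have a nonzero minor
  and are solved for; the other two are free.\<close>

lemma kernel_iso_rank2:
  assumes \<mu>: "\<mu> \<in> sign_tensors"
    and indep: "(a, b) \<in> {(1, 0), (0, 1), (1, 1)}"
      "coef \<mu> 0 0 0 * coef \<mu> a b 1 \<noteq> coef \<mu> a b 0 * coef \<mu> 0 0 1"
  shows "additive_group\<lparr>carrier := {t. Theta \<mu> t = 0}\<rparr> \<cong> integer_group \<times>\<times> integer_group"
proof -
  have add: "additive \<mu>"
    using \<mu> by (simp add: sign_tensors_iff)
  note signs = coef_sign[OF \<mu>]
  have odd: "odd (coef \<mu> a b c)" if "a \<in> {0,1}" "b \<in> {0,1}" "c \<in> {0,1}" for a b c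
    using signs[OF that] by auto
  \<comment> \<open>All coefficients are odd, so both right-hand sides have the parity of
    \<open>u + v\<close>, and the solvability condition holds for any free coordinates.\<close>
  have even: "even (u * coef \<mu> a b 0 + v * coef \<mu> c d 0 - (u * coef \<mu> a b 1 + v * coef \<mu> c d 1))"
    if "a \<in> {0,1}" "b \<in> {0,1}" "c \<in> {0,1}" "d \<in> {0,1}" for u v a b c d
    using odd[OF that(1,2), of 0] odd[OF that(1,2), of 1] odd[OF that(3,4), of 0]
      odd[OF that(3,4), of 1] by simp
  consider "(a, b) = (1, 0)" | "(a, b) = (0, 1)" | "(a, b) = (1, 1)"
    using indep(1) by blast
  then have "additive_group\<lparr>carrier := {t. Theta \<mu> t = 0}\<rparr> \<cong> (additive_group :: E2 monoid)"
  proof cases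
    case 1
    then have neq: "coef \<mu> 0 0 0 * coef \<mu> 1 0 1 \<noteq> coef \<mu> 1 0 0 * coef \<mu> 0 0 1"
      using indep(2) by simp
    note sys = signs[of 0 0 0] signs[of 1 0 0] signs[of 0 0 1] signs[of 1 0 1]
    show ?thesis
    proof (rule kernel_iso[where f = snd, OF _ _ _ add])
      fix v assume "Theta \<mu> (EE_of_coords v) = 0" "snd v = 0"
      moreover obtain p0 p1 q0 q1 where v: "v = ((p0, p1), (q0, q1))" by (metis surj_pair)
      ultimately show "v = 0"
        using sign_system_unique[OF sys neq, of p0 p1]
        by (simp add: Theta_of_coords_eq_zero_iff[OF add] zero_prod_def)
    next
      fix w :: E2
      obtain q0 q1 where w: "w = (q0, q1)" by (metis surj_pair)
      show "\<exists>v. Theta \<mu> (EE_of_coords v) = 0 \<and> snd v = w"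
        using sign_system_solvable[OF sys neq even[of 0 1 1 1 q0 q1]]
        by (auto simp: w Theta_of_coords_eq_zero_iff[OF add] add.assoc)
    qed (simp add: additive_def)
  next
    case 2
    then have neq: "coef \<mu> 0 0 0 * coef \<mu> 0 1 1 \<noteq> coef \<mu> 0 1 0 * coef \<mu> 0 0 1"
      using indep(2) by simp
    note sys = signs[of 0 0 0] signs[of 0 1 0] signs[of 0 0 1] signs[of 0 1 1]
    show ?thesis
    proof (rule kernel_iso[where f = "\<lambda>v. (snd (fst v), snd (snd v))", OF _ _ _ add])
      fix v assume "Theta \<mu> (EE_of_coords v) = 0" "(snd (fst v), snd (snd v)) = 0"
      moreover obtain p0 p1 q0 q1 where v: "v = ((p0, p1), (q0, q1))" by (metis surj_pair)
      ultimately show "v = 0"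
        using sign_system_unique[OF sys neq, of p0 q0]
        by (simp add: Theta_of_coords_eq_zero_iff[OF add] zero_prod_def)
    next
      fix w :: E2
      obtain p1 q1 where w: "w = (p1, q1)" by (metis surj_pair)
      show "\<exists>v. Theta \<mu> (EE_of_coords v) = 0 \<and> (snd (fst v), snd (snd v)) = w"
        using sign_system_solvable[OF sys neq even[of 1 0 1 1 p1 q1]]
        by (auto simp: w Theta_of_coords_eq_zero_iff[OF add] ac_simps)
    qed (simp add: additive_def)
  next
    case 3
    then have neq: "coef \<mu> 0 0 0 * coef \<mu> 1 1 1 \<noteq> coef \<mu> 1 1 0 * coef \<mu> 0 0 1"
      using indep(2) by simp
    note sys = signs[of 0 0 0] signs[of 1 1 0] signs[of 0 0 1] signs[of 1 1 1]
    show ?thesis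
    proof (rule kernel_iso[where f = "\<lambda>v. (snd (fst v), fst (snd v))", OF _ _ _ add])
      fix v assume "Theta \<mu> (EE_of_coords v) = 0" "(snd (fst v), fst (snd v)) = 0"
      moreover obtain p0 p1 q0 q1 where v: "v = ((p0, p1), (q0, q1))" by (metis surj_pair)
      ultimately show "v = 0"
        using sign_system_unique[OF sys neq, of p0 q1]
        by (simp add: Theta_of_coords_eq_zero_iff[OF add] zero_prod_def)
    next
      fix w :: E2
      obtain p1 q0 where w: "w = (p1, q0)" by (metis surj_pair)
      show "\<exists>v. Theta \<mu> (EE_of_coords v) = 0 \<and> (snd (fst v), fst (snd v)) = w"
        using sign_system_solvable[OF sys neq even[of 1 0 0 1 p1 q0]]
        by (auto simp: w Theta_of_coords_eq_zero_iff[OF add] ac_simps)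
    qed (simp add: additive_def)
  qed
  then show ?thesis
    by (simp add: integer_group_eq DirProd_additive_group)
qed

text \<open>The slices \<open>c = 0\<close> and \<open>c = 1\<close> are the two equations of
  \<open>ker \<Theta>\<^sub>\<mu>\<close>; the second is then a multiple of the first.\<close>

definition proportional :: "(nat \<Rightarrow> nat \<Rightarrow> nat \<Rightarrow> int) \<Rightarrow> int \<Rightarrow> bool" where
  "proportional M \<rho> \<longleftrightarrow> (\<forall>a\<in>{0,1}. \<forall>b\<in>{0,1}. M a b 1 = \<rho> * M a b 0)"

text \<open>One equation remains, and its coefficient at \<open>p0\<close> is a unit, so
  \<open>p0\<close> is determined by three free coordinates.\<close>

lemma kernel_iso_rank1:
  assumes \<mu>: "\<mu> \<in> sign_tensors" and ratio: "proportional (coef \<mu>) \<rho>"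
  shows "additive_group\<lparr>carrier := {t. Theta \<mu> t = 0}\<rparr> \<cong>
    integer_group \<times>\<times> integer_group \<times>\<times> integer_group"
proof -
  have add: "additive \<mu>"
    using \<mu> by (simp add: sign_tensors_iff)
  have sq: "coef \<mu> 0 0 0 * coef \<mu> 0 0 0 = 1"
    using coef_sign[OF \<mu>, of 0 0 0] by auto
  have Theta_iff: "Theta \<mu> (EE_of_coords ((p0, p1), (q0, q1))) = 0 \<longleftrightarrow>
      p0 * coef \<mu> 0 0 0 + (p1 * coef \<mu> 1 0 0 + q0 * coef \<mu> 0 1 0 + q1 * coef \<mu> 1 1 0) = 0"
    for p0 p1 q0 q1
  proof -
    have "p0 * coef \<mu> 0 0 1 + p1 * coef \<mu> 1 0 1 + q0 * coef \<mu> 0 1 1 + q1 * coef \<mu> 1 1 1 =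
      \<rho> * (p0 * coef \<mu> 0 0 0 + p1 * coef \<mu> 1 0 0 + q0 * coef \<mu> 0 1 0 + q1 * coef \<mu> 1 1 0)"
      using ratio by (simp add: proportional_def algebra_simps)
    then show ?thesis
      by (auto simp: Theta_of_coords_eq_zero_iff[OF add] add.assoc)
  qed
  have "additive_group\<lparr>carrier := {t. Theta \<mu> t = 0}\<rparr> \<cong>
      (additive_group :: (int \<times> int \<times> int) monoid)"
  proof (rule kernel_iso[where f = "\<lambda>v. (snd (fst v), snd v)", OF _ _ _ add])
    fix v assume "Theta \<mu> (EE_of_coords v) = 0" "(snd (fst v), snd v) = 0"
    moreover obtain p0 p1 q0 q1 where v: "v = ((p0, p1), (q0, q1))" by (metis surj_pair)
    ultimately show "v = 0"
      using sq by (auto simp: Theta_iff zero_prod_def)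
  next
    fix w :: "int \<times> int \<times> int"
    obtain p1 q0 q1 where w: "w = (p1, (q0, q1))" by (metis surj_pair)
    define z where "z = p1 * coef \<mu> 1 0 0 + q0 * coef \<mu> 0 1 0 + q1 * coef \<mu> 1 1 0"
    have "- z * coef \<mu> 0 0 0 * coef \<mu> 0 0 0 + z = 0"
      using sq by (simp add: mult.assoc)
    then have "Theta \<mu> (EE_of_coords ((- z * coef \<mu> 0 0 0, p1), (q0, q1))) = 0"
      unfolding Theta_iff z_def .
    then show "\<exists>v. Theta \<mu> (EE_of_coords v) = 0 \<and> (snd (fst v), snd v) = w"
      unfolding w by (metis fst_conv snd_conv)
  qed (simp add: additive_def)
  then show ?thesis
    by (simp add: integer_group_eq DirProd_additive_group)
qed

section \<open>Ranks\<close>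

interpretation rat_fun: vector_space "\<lambda>(q::rat) (f :: 'e \<Rightarrow> rat) x. q * f x"
  by unfold_locales (simp_all add: fun_eq_iff algebra_simps)

lemma Theta_apply:
  assumes "additive \<mu>"
  shows "Theta \<mu> t x = fst x * Theta \<mu> t (e 0) + snd x * Theta \<mu> t (e 1)"
  unfolding Theta_def by (rule mu_expand_third[OF assms])

lemma Theta_e: "Theta \<mu> (e a \<otimes>\<^sub>\<int> e b) (e c) = coef \<mu> a b c"
  by (simp add: Theta_def coef_def)

lemma Theta_basis_proportional:
  assumes \<mu>: "\<mu> \<in> sign_tensors" and ratio: "proportional (coef \<mu>) \<rho>"
  shows "Theta \<mu> t (e 1) = \<rho> * Theta \<mu> t (e 0)"
proof -
  have add: "additive \<mu>"
    using \<mu> by (simp add: sign_tensors_iff)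
  have "additive (\<lambda>t. Theta \<mu> t (e 1))" "additive (\<lambda>t. \<rho> * Theta \<mu> t (e 0))"
    by (simp_all add: additive_def Theta_def tensor_add_left additive.add[OF add] distrib_left)
  then show ?thesis
  proof (rule additive_eq_on_tensorsI[THEN fun_cong])
    fix x y :: E2
    show "Theta \<mu> (x \<otimes>\<^sub>\<int> y) (e 1) = \<rho> * Theta \<mu> (x \<otimes>\<^sub>\<int> y) (e 0)"
      using ratio by (simp add: Theta_def mu_expand[OF add] proportional_def e_def algebra_simps)
  qed
qed

lemma rational_rank_proportional:
  assumes \<mu>: "\<mu> \<in> sign_tensors" and ratio: "proportional (coef \<mu>) \<rho>"
  shows "rational_rank (Theta \<mu>) = 1"
proof -
  let ?h = "\<lambda>t x. of_int (Theta \<mu> t x) :: rat"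
  define g where "g = ?h (e 0 \<otimes>\<^sub>\<int> e 0)"
  have add: "additive \<mu>"
    using \<mu> by (simp add: sign_tensors_iff)
  have unit: "coef \<mu> 0 0 0 * coef \<mu> 0 0 0 = 1"
    using coef_sign[OF \<mu>, of 0 0 0] by auto
  \<comment> \<open>The value \<open>coef \<mu> 0 0 0\<close> of \<open>g\<close> at
    \<open>e 0\<close> is its own inverse, which makes the proportionality factor an
    integer.\<close>
  have "?h t = (\<lambda>x. of_int (Theta \<mu> t (e 0) * coef \<mu> 0 0 0) * g x)" for t
  proof
    fix x
    have "Theta \<mu> t x = (fst x + \<rho> * snd x) * Theta \<mu> t (e 0)" for t
      by (subst Theta_apply[OF add], simp only: Theta_basis_proportional[OF \<mu> ratio])
        (simp add: algebra_simps)
    then have "g x = of_int ((fst x + \<rho> * snd x) * coef \<mu> 0 0 0)"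
      and "?h t x = of_int ((fst x + \<rho> * snd x) * Theta \<mu> t (e 0) * (coef \<mu> 0 0 0 * coef \<mu> 0 0 0))"
      by (simp_all only: g_def Theta_e unit mult_1_right)
    then show "?h t x = of_int (Theta \<mu> t (e 0) * coef \<mu> 0 0 0) * g x"
      by (simp add: ac_simps)
  qed
  then have "range ?h \<subseteq> rat_fun.span {g}"
    using rat_fun.span_scale[OF rat_fun.span_base, of g "{g}"] by (auto simp del: of_int_mult)
  moreover have "g (e 0) \<noteq> 0"
    using unit by (auto simp: g_def Theta_e)
  then have "g \<noteq> 0"
    by auto
  then have "rat_fun.independent {g}"
    by simp
  moreover have "{g} \<subseteq> range ?h"
    by (auto simp: g_def)
  ultimately show ?thesis
    unfolding rational_rank_def by (intro rat_fun.dim_unique) auto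
qed

lemma rational_rank_2:
  assumes \<mu>: "\<mu> \<in> sign_tensors"
    and indep: "coef \<mu> 0 0 0 * coef \<mu> a b 1 \<noteq> coef \<mu> a b 0 * coef \<mu> 0 0 1"
  shows "rational_rank (Theta \<mu>) = 2"
proof -
  let ?h = "\<lambda>t x. of_int (Theta \<mu> t x) :: rat"
  have add: "additive \<mu>"
    using \<mu> by (simp add: sign_tensors_iff)
  define f g where "f = ?h (e 0 \<otimes>\<^sub>\<int> e 0)" and "g = ?h (e a \<otimes>\<^sub>\<int> e b)"
  \<comment> \<open>The determinant of \<open>f\<close> and \<open>g\<close> in the coordinates
    given by evaluation at \<open>e 0\<close> and \<open>e 1\<close>; up to the embedding into the
    rationals it is the minor in \<open>indep\<close>.\<close>
  define D where "D = f (e 0) * g (e 1) - g (e 0) * f (e 1)"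
  have D: "D \<noteq> 0"
    using indep by (simp add: D_def f_def g_def Theta_e flip: of_int_mult)
  have lin: "?h t x = of_int (fst x) * ?h t (e 0) + of_int (snd x) * ?h t (e 1)" for t x
    by (subst Theta_apply[OF add]) simp
  have "?h t \<in> rat_fun.span {f, g}" for t
  proof -
    \<comment> \<open>Cramer's rule for writing \<open>?h t\<close> in terms of \<open>f\<close> and
      \<open>g\<close>.\<close>
    define p q where "p = (?h t (e 0) * g (e 1) - g (e 0) * ?h t (e 1)) / D"
      and "q = (f (e 0) * ?h t (e 1) - ?h t (e 0) * f (e 1)) / D"
    have *: "p * f (e 0) + q * g (e 0) = ?h t (e 0)" "p * f (e 1) + q * g (e 1) = ?h t (e 1)"
      using D by (simp_all add: p_def q_def field_simps) (simp_all add: D_def algebra_simps)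
    have "?h t x = p * f x + q * g x" for x
    proof -
      have "f x = of_int (fst x) * f (e 0) + of_int (snd x) * f (e 1)"
        "g x = of_int (fst x) * g (e 0) + of_int (snd x) * g (e 1)"
        unfolding f_def g_def by (rule lin)+
      then show ?thesis
        by (subst lin, simp only: flip: *) (simp add: algebra_simps)
    qed
    then have "?h t = (\<lambda>x. p * f x) + (\<lambda>x. q * g x)"
      by (simp add: fun_eq_iff)
    then show ?thesis
      by (simp add: rat_fun.span_add rat_fun.span_scale rat_fun.span_base)
  qed
  then have "range ?h \<subseteq> rat_fun.span {f, g}"
    by blast
  moreover have "rat_fun.independent {f, g}" "f \<noteq> g"
  proof -
    have "g \<noteq> 0"
      using D by (auto simp: D_def)
    then have "rat_fun.independent {g}"
      by simp
    moreover have "f \<notin> rat_fun.span {g}"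
    proof
      assume "f \<in> rat_fun.span {g}"
      then obtain k where "f = (\<lambda>x. k * g x)"
        by (auto simp: rat_fun.span_singleton)
      then show False
        using D by (simp add: D_def)
    qed
    ultimately show "rat_fun.independent {f, g}"
      by (rule rat_fun.independent_insertI[rotated])
    show "f \<noteq> g"
      using D by (auto simp: D_def)
  qed
  moreover have "{f, g} \<subseteq> range ?h"
    by (auto simp: f_def g_def)
  ultimately show ?thesis
    unfolding rational_rank_def by (intro rat_fun.dim_unique) auto
qed

text \<open>Raising to the group order is a nontrivial relation on any nonempty set, so only the
  empty set is independent.\<close>

lemma int_rank_eq_0:
  fixes G (structure)
  assumes "comm_group G" and order: "order G = n" "n > 0"
  shows "int_rank G = 0"
proof -
  interpret comm_group G by fact
  have "S = {}" if "int_independent G S" for S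
  proof (rule ccontr)
    assume "S \<noteq> {}"
    have S: "finite S" "S \<subseteq> carrier G"
      and ind: "\<And>m :: _ \<Rightarrow> int. (\<Otimes>x\<in>S. x [^] m x) = \<one> \<Longrightarrow> \<forall>x\<in>S. m x = 0"
      using that by (auto simp: int_independent_def)
    have "(\<Otimes>x\<in>S. x [^] int n) = (\<Otimes>x\<in>S. \<one>)"
      using S(2) pow_order_eq_1 order by (intro finprod_cong') (auto simp: int_pow_int)
    then have "\<forall>x\<in>S. int n = 0"
      using ind[of "\<lambda>_. int n"] by simp
    then show False
      using \<open>S \<noteq> {}\<close> order by auto
  qed
  moreover have "int_independent G {}"
    by (simp add: int_independent_def)
  ultimately have "{S. int_independent G S} = {{}}"
    by auto
  then show ?thesis
    by (simp add: int_rank_def zero_enat_def)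
qed

lemma int_rank_eq_1:
  fixes G (structure)
  assumes "comm_group G" and iso: "G \<cong> integer_group"
  shows "int_rank G = 1"
proof -
  interpret comm_group G by fact
  obtain h where h: "h \<in> iso G integer_group"
    using iso by (auto simp: is_iso_def)
  interpret h: group_hom G integer_group h
    using h by (simp add: group_hom_def group_hom_axioms_def iso_def)
  have bij: "bij_betw h (carrier G) UNIV"
    using h by (simp add: iso_def)
  have inj: "x = \<one>" if "x \<in> carrier G" "h x = 0" for x
    using inj_onD[OF bij_betw_imp_inj_on[OF bij], of x \<one>] that h.hom_one by simp
  have h_pow: "h (x [^] m) = m * h x" if "x \<in> carrier G" for x and m :: int
    using h.hom_int_pow[OF that] by (simp add: int_pow_def2)
  have "card S \<le> 1" if S: "int_independent G S" for S
  proof (rule ccontr)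
    assume "\<not> card S \<le> 1"
    have fin: "finite S" and carr: "S \<subseteq> carrier G"
      and ind: "\<And>m :: _ \<Rightarrow> int. (\<Otimes>x\<in>S. x [^] m x) = \<one> \<Longrightarrow> \<forall>x\<in>S. m x = 0"
      using S by (auto simp: int_independent_def)
    obtain x y where xy: "x \<in> S" "y \<in> S" "x \<noteq> y"
      using \<open>\<not> card S \<le> 1\<close> card_le_Suc0_iff_eq[OF fin] by auto
    have zero: "h x = 0 \<and> h y = 0"
    proof -
      \<comment> \<open>The relation \<open>h y * h x - h x * h y = 0\<close> in \<int>.
        Independence makes both values zero, so \<open>x\<close> is neutral, and then
        \<open>x\<close> alone satisfies a nontrivial relation.\<close>
      define m where "m z = (if z = x then h y else if z = y then - h x else 0)" for z
      have "(\<Otimes>z\<in>S. z [^] m z) = (\<Otimes>z\<in>{x, y}. z [^] m z)"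
        using xy carr by (intro finprod_mono_neutral_cong_right fin) (auto simp: m_def)
      also have "\<dots> = x [^] h y \<otimes> y [^] (- h x)"
        using xy carr by (subst finprod_insert) (auto simp: m_def)
      also have "\<dots> = \<one>"
        using subsetD[OF carr xy(1)] subsetD[OF carr xy(2)] by (intro inj) (simp_all add: h_pow)
      finally show ?thesis
        using ind[of m] xy by (auto simp: m_def)
    qed
    then have "x = \<one>"
      using xy carr inj by blast
    have "(\<Otimes>z\<in>S. z [^] (if z = x then 1 else 0 :: int)) = (\<Otimes>z\<in>S. \<one>)"
      using carr \<open>x = \<one>\<close> by (intro finprod_cong') auto
    then show False
      using ind[of "\<lambda>z. if z = x then 1 else 0"] xy by auto
  qed
  moreover obtain x where x: "x \<in> carrier G" "h x = 1"
    using bij_betw_imp_surj_on[OF bij] by (metis UNIV_I imageE)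
  have "int_independent G {x}"
    unfolding int_independent_def
  proof (intro conjI allI impI)
    fix m :: "_ \<Rightarrow> int"
    assume "(\<Otimes>z\<in>{x}. z [^] m z) = \<one>"
    then have "h (x [^] m x) = 0"
      using x h.hom_one by simp
    then show "\<forall>z\<in>{x}. m z = 0"
      using x by (simp add: h_pow)
  qed (use x in auto)
  ultimately show ?thesis
    unfolding int_rank_def one_enat_def
    by (intro antisym SUP_least SUP_upper2[of "{x}"]) auto
qed

section \<open>Torsion\<close>

lemma tors_finite:
  fixes G :: "'a monoid"
  assumes "group G" "finite (carrier G)"
  shows "tors G = G"
proof -
  interpret group G by fact
  have "order G > 0"
    using assms(2) by (simp add: order_gt_0_iff_finite)
  then have "{x \<in> carrier G. \<exists>n::nat. n > 0 \<and> x [^]\<^bsub>G\<^esub> n = \<one>\<^bsub>G\<^esub>} = carrier G"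
    using pow_order_eq_1 by auto
  then show ?thesis
    by (simp add: tors_def)
qed

lemma primary_part_order:
  assumes "group G" "order G = p"
  shows "primary_part p G = carrier G"
proof -
  have "x [^]\<^bsub>G\<^esub> (p ^ 1) = \<one>\<^bsub>G\<^esub>" if "x \<in> carrier G" for x
    using group.pow_order_eq_1[OF assms(1) that] assms(2) by simp
  then show ?thesis
    unfolding primary_part_def by blast
qed

text \<open>\<open>integer_mod_group 1\<close> stands for the trivial group.\<close>

lemma tors_infinite_cyclic:
  fixes G :: "'a monoid"
  assumes "group G" and iso: "G \<cong> integer_group"
  shows "tors G \<cong> integer_mod_group 1"
proof -
  interpret group G by fact
  obtain h where h: "h \<in> iso G integer_group"
    using iso by (auto simp: is_iso_def)
  interpret h: group_hom G integer_group h
    using h by (simp add: group_hom_def group_hom_axioms_def iso_def)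
  have inj: "inj_on h (carrier G)"
    using h by (simp add: iso_def bij_betw_def)
  have "x = \<one>\<^bsub>G\<^esub>" if "x \<in> carrier G" "n > 0" "x [^]\<^bsub>G\<^esub> n = \<one>\<^bsub>G\<^esub>" for x and n :: nat
  proof -
    have "int n * h x = 0"
      using h.hom_nat_pow[OF that(1), of n] that(3) h.hom_one by simp
    then show ?thesis
      using that inj_onD[OF inj, of x "\<one>\<^bsub>G\<^esub>"] h.hom_one by simp
  qed
  then have carr: "carrier (tors G) = {\<one>\<^bsub>G\<^esub>}"
    by (auto simp: tors_def intro: exI[of _ 1])
  have "(\<lambda>_. 0) \<in> iso (tors G) (integer_mod_group 1)"
    using carr by (auto simp: iso_def hom_def bij_betw_def carrier_integer_mod_group)
  then show ?thesis
    by (rule is_isoI)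
qed

section \<open>The classification\<close>

lemma comm_group_middle_coker: "additive \<mu> \<Longrightarrow> comm_group (middle_coker \<mu>)"
  for \<mu> :: "E2 \<otimes>\<^sub>\<int> E2 \<otimes>\<^sub>\<int> E2 \<Rightarrow> int"
  unfolding middle_coker_def
  by (rule comm_group.abelian_FactGroup
      [OF comm_group_additive_group subgroup_range_additive[OF middle_map(1)]])

lemma DirProd_assoc_iso: "(G \<times>\<times> H) \<times>\<times> K \<cong> G \<times>\<times> H \<times>\<times> K"
  by (rule is_isoI[where h = "\<lambda>((x, y), z). (x, y, z)"])
    (auto simp: iso_def hom_def inj_on_def bij_betw_def image_iff)

lemma operator_defect_sign_tensor:
  assumes \<mu>: "\<mu> \<in> sign_tensors"
    and ker: "additive_group\<lparr>carrier := {t. Theta \<mu> t = 0}\<rparr> \<cong> K"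
    and coker: "middle_coker \<mu> \<cong> Q"
  shows "operator_defect (T_op \<mu>) \<cong> K \<times>\<times> Q"
proof -
  have add: "additive \<mu>"
    using \<mu> by (simp add: sign_tensors_iff)
  have "subgroup {t. Theta \<mu> t = 0} additive_group"
    by (simp add: additive_group_subgroup_iff additive.zero[OF additive_Theta[OF add]]
        additive.diff[OF additive_Theta[OF add]])
  then have "group (additive_group\<lparr>carrier := {t. Theta \<mu> t = 0}\<rparr>)"
    by (rule subgroup.subgroup_is_group) simp
  moreover have "\<mu> (e 0 \<otimes>\<^sub>\<int> e 0 \<otimes>\<^sub>\<int> e 0) \<in> {1, -1}"
    using coef_sign[OF \<mu>, of 0 0 0] by (simp add: coef_def)
  ultimately show ?thesis
    using iso_trans[OF operator_defect_iso[OF add] group.DirProd_iso_trans[OF _ ker coker]] by blast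
qed

section \<open>Balanced and rank one sign tensors\<close>

definition exceptional :: "(E2 \<otimes>\<^sub>\<int> E2 \<otimes>\<^sub>\<int> E2 \<Rightarrow> int) \<Rightarrow> bool" where
  "exceptional \<mu> \<longleftrightarrow> geometric (coef \<mu>) 1 \<or> geometric (coef \<mu>) (-1)"

definition degenerate :: "(E2 \<otimes>\<^sub>\<int> E2 \<otimes>\<^sub>\<int> E2 \<Rightarrow> int) \<Rightarrow> bool" where
  "degenerate \<mu> \<longleftrightarrow> proportional (coef \<mu>) 1 \<or> proportional (coef \<mu>) (-1)"

text \<open>Raising \<open>c\<close> from 0 to 1 multiplies \<open>s * \<rho> ^ (a + b + c)\<close>
  by \<open>\<rho>\<close>.\<close>

lemma exceptional_imp_degenerate: "exceptional \<mu> \<Longrightarrow> degenerate \<mu>"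
  by (auto simp: exceptional_def degenerate_def geometric_def proportional_def)

lemma exceptional_middle_coker:
  assumes "\<mu> \<in> sign_tensors" "exceptional \<mu>"
  shows "middle_coker \<mu> \<cong> integer_group"
  using assms middle_coker_geometric[OF assms(1)] unfolding exceptional_def by blast

lemma exceptional_invariants:
  assumes \<mu>: "\<mu> \<in> sign_tensors" and exceptional: "exceptional \<mu>"
  shows "int_rank (middle_coker \<mu>) = 1" "tors (middle_coker \<mu>) \<cong> integer_mod_group 1"
proof -
  have "comm_group (middle_coker \<mu>)"
    using \<mu> by (intro comm_group_middle_coker) (simp add: sign_tensors_iff)
  then show "int_rank (middle_coker \<mu>) = 1" "tors (middle_coker \<mu>) \<cong> integer_mod_group 1"
    using exceptional_middle_coker[OF assms] int_rank_eq_1 tors_infinite_cyclic comm_group.axioms(2) by auto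
qed

text \<open>Everything follows from the order 2: such a group has rank 0 and equals both its torsion
  subgroup and its 2-primary part.\<close>

lemma nonexceptional_invariants:
  assumes \<mu>: "\<mu> \<in> sign_tensors" and nonexceptional: "\<not> exceptional \<mu>"
  shows "middle_coker \<mu> \<cong> integer_mod_group 2" "int_rank (middle_coker \<mu>) = 0"
    "tors (middle_coker \<mu>) \<cong> integer_mod_group 2"
    "primary_part 2 (tors (middle_coker \<mu>)) \<noteq> {\<one>\<^bsub>tors (middle_coker \<mu>)\<^esub>}"
proof -
  show iso: "middle_coker \<mu> \<cong> integer_mod_group 2"
    using middle_coker_nongeometric[OF \<mu>] nonexceptional by (simp add: exceptional_def)
  have comm: "comm_group (middle_coker \<mu>)"
    using \<mu> by (intro comm_group_middle_coker) (simp add: sign_tensors_iff)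
  then have grp: "group (middle_coker \<mu>)"
    by (rule comm_group.axioms(2))
  have order: "order (middle_coker \<mu>) = 2"
    using iso_same_card[OF iso] by (simp add: order_def carrier_integer_mod_group)
  then show "int_rank (middle_coker \<mu>) = 0"
    by (intro int_rank_eq_0[OF comm]) auto
  have fin: "finite (carrier (middle_coker \<mu>))"
    using order by (simp add: order_def card_ge_0_finite)
  show "tors (middle_coker \<mu>) \<cong> integer_mod_group 2"
    using iso by (simp add: tors_finite[OF grp fin])
  show "primary_part 2 (tors (middle_coker \<mu>)) \<noteq> {\<one>\<^bsub>tors (middle_coker \<mu>)\<^esub>}"
    using order by (auto simp: tors_finite[OF grp fin] primary_part_order[OF grp order] order_def)
qed

text \<open>If all minors involving the index \<open>(0, 0)\<close> vanished, the slices would be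
  proportional with ratio \<open>coef \<mu> 0 0 0 * coef \<mu> 0 0 1\<close>, which is a
  sign.\<close>

lemma nondegenerateE:
  assumes \<mu>: "\<mu> \<in> sign_tensors" and "\<not> degenerate \<mu>"
  obtains a b where "(a, b) \<in> {(1, 0), (0, 1), (1, 1)}"
    "coef \<mu> 0 0 0 * coef \<mu> a b 1 \<noteq> coef \<mu> a b 0 * coef \<mu> 0 0 1"
proof (rule ccontr)
  note witness = that
  assume "\<not> thesis"
  have eq: "coef \<mu> 0 0 0 * coef \<mu> a b 1 = coef \<mu> a b 0 * coef \<mu> 0 0 1"
    if "a \<in> {0,1}" "b \<in> {0,1}" for a b
  proof (rule ccontr)
    assume neq: "\<not> ?thesis"
    then have "(a, b) \<noteq> (0, 0)"
      by auto
    then have "(a, b) \<in> {(1, 0), (0, 1), (1, 1)}"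
      using that by blast
    from witness[OF this neq] show False
      using \<open>\<not> thesis\<close> by blast
  qed
  have unit: "coef \<mu> 0 0 0 \<in> {1, -1}" "coef \<mu> 0 0 1 \<in> {1, -1}"
    by (rule coef_sign[OF \<mu>]; simp)+
  have "coef \<mu> a b 1 = coef \<mu> 0 0 0 * coef \<mu> 0 0 1 * coef \<mu> a b 0"
    if "a \<in> {0,1}" "b \<in> {0,1}" for a b
  proof -
    have "coef \<mu> a b 1 = coef \<mu> 0 0 0 * (coef \<mu> 0 0 0 * coef \<mu> a b 1)"
      using unit(1) by auto
    then show ?thesis
      by (simp only: eq[OF that] ac_simps)
  qed
  then have "proportional (coef \<mu>) (coef \<mu> 0 0 0 * coef \<mu> 0 0 1)"
    unfolding proportional_def by blast
  then show False
    using unit \<open>\<not> degenerate \<mu>\<close> by (auto simp: degenerate_def)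
qed

lemma rational_rank_sign_tensor:
  assumes "\<mu> \<in> sign_tensors"
  shows "rational_rank (Theta \<mu>) = (if degenerate \<mu> then 1 else 2)"
proof (cases "degenerate \<mu>")
  case True
  then show ?thesis
    using rational_rank_proportional[OF assms] by (auto simp: degenerate_def)
next
  case False
  from assms False show ?thesis
    by (rule nondegenerateE) (use False rational_rank_2[OF assms] in auto)
qed

lemma sign_tensor_invariants:
  assumes "\<mu> \<in> sign_tensors"
  shows "rational_rank (Theta \<mu>) = (if degenerate \<mu> then 1 else 2)"
    "int_rank (middle_coker \<mu>) = (if exceptional \<mu> then 1 else 0)"
    "tors (middle_coker \<mu>) \<cong> integer_mod_group (if exceptional \<mu> then 1 else 2)"
  using assms rational_rank_sign_tensor exceptional_invariants nonexceptional_invariants by auto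

text \<open>The two ranks already separate the three classes, so the torsion groups never have to be
  told apart.\<close>

lemma sign_tensors_with_2_0:
  "sign_tensors_with 2 0 (integer_mod_group 2) = {\<mu> \<in> sign_tensors. \<not> degenerate \<mu>}"
proof (rule Set.set_eqI)
  fix \<mu>
  show "\<mu> \<in> sign_tensors_with 2 0 (integer_mod_group 2) \<longleftrightarrow> \<mu> \<in> {\<mu> \<in> sign_tensors. \<not> degenerate \<mu>}"
    using sign_tensor_invariants[of \<mu>] exceptional_imp_degenerate[of \<mu>]
    by (cases "degenerate \<mu>"; cases "exceptional \<mu>") (auto simp: sign_tensors_with_def)
qed

lemma sign_tensors_with_1_0:
  "sign_tensors_with 1 0 (integer_mod_group 2) = {\<mu> \<in> sign_tensors. degenerate \<mu> \<and> \<not> exceptional \<mu>}"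
proof (rule Set.set_eqI)
  fix \<mu>
  show "\<mu> \<in> sign_tensors_with 1 0 (integer_mod_group 2) \<longleftrightarrow> \<mu> \<in> {\<mu> \<in> sign_tensors. degenerate \<mu> \<and> \<not> exceptional \<mu>}"
    using sign_tensor_invariants[of \<mu>] exceptional_imp_degenerate[of \<mu>]
    by (cases "degenerate \<mu>"; cases "exceptional \<mu>") (auto simp: sign_tensors_with_def)
qed

lemma sign_tensors_with_1_1:
  "sign_tensors_with 1 1 (integer_mod_group 1) = {\<mu> \<in> sign_tensors. exceptional \<mu>}"
proof (rule Set.set_eqI)
  fix \<mu>
  show "\<mu> \<in> sign_tensors_with 1 1 (integer_mod_group 1) \<longleftrightarrow> \<mu> \<in> {\<mu> \<in> sign_tensors. exceptional \<mu>}"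
    using sign_tensor_invariants[of \<mu>] exceptional_imp_degenerate[of \<mu>]
    by (cases "degenerate \<mu>"; cases "exceptional \<mu>") (auto simp: sign_tensors_with_def)
qed

section \<open>The defect of a sign tensor\<close>

lemma operator_defect_rank2:
  assumes \<mu>: "\<mu> \<in> sign_tensors" and "\<not> degenerate \<mu>" and "middle_coker \<mu> \<cong> Q"
  shows "operator_defect (T_op \<mu>) \<cong> integer_group \<times>\<times> integer_group \<times>\<times> Q"
proof -
  obtain a b where "(a, b) \<in> {(1, 0), (0, 1), (1, 1)}"
    "coef \<mu> 0 0 0 * coef \<mu> a b 1 \<noteq> coef \<mu> a b 0 * coef \<mu> 0 0 1"
    using nondegenerateE[OF assms(1,2)] by blast
  from operator_defect_sign_tensor[OF \<mu> kernel_iso_rank2[OF \<mu> this] assms(3)]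
  show ?thesis
    by (rule iso_trans) (rule DirProd_assoc_iso)
qed

lemma operator_defect_rank1:
  assumes \<mu>: "\<mu> \<in> sign_tensors" and "degenerate \<mu>" and "middle_coker \<mu> \<cong> Q"
  shows "operator_defect (T_op \<mu>) \<cong> integer_group \<times>\<times> integer_group \<times>\<times> integer_group \<times>\<times> Q"
proof -
  obtain \<rho> where "proportional (coef \<mu>) \<rho>"
    using assms(2) by (auto simp: degenerate_def)
  from operator_defect_sign_tensor[OF \<mu> kernel_iso_rank1[OF \<mu> this] assms(3)]
  have "operator_defect (T_op \<mu>) \<cong> (integer_group \<times>\<times> integer_group \<times>\<times> integer_group) \<times>\<times> Q" .
  also have "\<dots> \<cong> integer_group \<times>\<times> (integer_group \<times>\<times> integer_group) \<times>\<times> Q"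
    by (rule DirProd_assoc_iso)
  also have "\<dots> \<cong> integer_group \<times>\<times> integer_group \<times>\<times> integer_group \<times>\<times> Q"
    by (rule group.DirProd_iso_trans[OF group_integer_group iso_refl DirProd_assoc_iso])
  finally show ?thesis .
qed

section \<open>Counting\<close>

lemma sign_tensor_eqI:
  assumes \<mu>: "\<mu> \<in> sign_tensors" and \<nu>: "\<nu> \<in> sign_tensors"
    and eq: "\<And>a b c. a \<in> {0,1} \<Longrightarrow> b \<in> {0,1} \<Longrightarrow> c \<in> {0,1} \<Longrightarrow> coef \<mu> a b c = coef \<nu> a b c"
  shows "\<mu> = \<nu>"
proof -
  have add: "additive \<mu>" "additive \<nu>"
    using \<mu> \<nu> by (simp_all add: sign_tensors_iff)
  show ?thesis
  proof (rule additive_eq_on_tensorsI[OF add])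
    fix s z
    have "\<mu> (x \<otimes>\<^sub>\<int> y \<otimes>\<^sub>\<int> z) = \<nu> (x \<otimes>\<^sub>\<int> y \<otimes>\<^sub>\<int> z)" for x y
      by (simp add: mu_expand[OF add(1)] mu_expand[OF add(2)] eq)
    then have "(\<lambda>s. \<mu> (s \<otimes>\<^sub>\<int> z)) = (\<lambda>s. \<nu> (s \<otimes>\<^sub>\<int> z))"
      by (intro additive_eq_on_tensorsI additive_tensor_left add)
    then show "\<mu> (s \<otimes>\<^sub>\<int> z) = \<nu> (s \<otimes>\<^sub>\<int> z)"
      by (rule fun_cong)
  qed
qed

lemma sign_tensor_exists:
  assumes M: "\<And>a b c. a \<in> {0,1} \<Longrightarrow> b \<in> {0,1} \<Longrightarrow> c \<in> {0,1} \<Longrightarrow> M a b c \<in> {1, -1}"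
  shows "\<exists>\<mu>\<in>sign_tensors. \<forall>a\<in>{0,1}. \<forall>b\<in>{0,1}. \<forall>c\<in>{0,1}. coef \<mu> a b c = M a b c"
proof -
  \<comment> \<open>The trilinear form with coefficients \<open>M\<close>, times an additional
    integer variable that brings it into the range of \<open>tensor4_universal\<close>; the variable
    is set to 1 afterwards.\<close>
  define F where "F x y z n = n *
    (fst z * (fst y * (fst x * M 0 0 0 + snd x * M 1 0 0) +
              snd y * (fst x * M 0 1 0 + snd x * M 1 1 0)) +
     snd z * (fst y * (fst x * M 0 0 1 + snd x * M 1 0 1) +
              snd y * (fst x * M 0 1 1 + snd x * M 1 1 1)))" for x y z :: E2 and n :: int
  have "quadriadditive F"
    by (simp add: quadriadditive_def additive_def F_def algebra_simps)
  from tensor4_universal[OF this] obtain h where h: "additive h"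
    and h_pure: "\<And>x y z n. h (x \<otimes>\<^sub>\<int> y \<otimes>\<^sub>\<int> z \<otimes>\<^sub>\<int> n) = F x y z n"
    by blast
  define \<mu> where "\<mu> t = h (t \<otimes>\<^sub>\<int> 1)" for t
  have add: "additive \<mu>"
    unfolding \<mu>_def by (rule additive_tensor_left[OF h])
  have coef: "coef \<mu> a b c = M a b c" if "a \<in> {0,1}" "b \<in> {0,1}" "c \<in> {0,1}" for a b c
    using that by (auto simp: coef_def \<mu>_def h_pure F_def e_def)
  have "\<mu> \<in> sign_tensors"
    unfolding sign_tensors_iff using add coef M by metis
  then show ?thesis
    using coef by blast
qed

text \<open>A sign tensor amounts to a free choice of eight signs. Restriction to the index set
  gives extensional functions, which can be counted.\<close>

lemma card_sign_tensors: "card sign_tensors = 256"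
proof -
  let ?I = "{0,1} \<times> {0,1} \<times> {0,1} :: (nat \<times> nat \<times> nat) set"
  let ?f = "\<lambda>\<mu>. \<lambda>(a, b, c)\<in>?I. coef \<mu> a b c"
  have "bij_betw ?f sign_tensors (?I \<rightarrow>\<^sub>E {1, -1})"
  proof (rule bij_betw_imageI)
    show "inj_on ?f sign_tensors"
    proof (rule inj_onI)
      fix \<mu> \<nu> assume \<mu>\<nu>: "\<mu> \<in> sign_tensors" "\<nu> \<in> sign_tensors" and eq: "?f \<mu> = ?f \<nu>"
      from \<mu>\<nu> show "\<mu> = \<nu>"
      proof (rule sign_tensor_eqI)
        show "coef \<mu> a b c = coef \<nu> a b c" if "a \<in> {0,1}" "b \<in> {0,1}" "c \<in> {0,1}" for a b c
        proof -
          have "(a, b, c) \<in> ?I"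
            using that by blast
          then show ?thesis
            using fun_cong[OF eq, of "(a, b, c)"] by (simp only: restrict_apply' prod.case)
        qed
      qed
    qed
    show "?f ` sign_tensors = ?I \<rightarrow>\<^sub>E {1, -1}"
    proof
      show "?f ` sign_tensors \<subseteq> ?I \<rightarrow>\<^sub>E {1, -1}"
      proof (intro image_subsetI, unfold restrict_PiE_iff, intro ballI)
        fix \<mu> i assume "\<mu> \<in> sign_tensors" and "i \<in> ?I"
        then show "(case i of (a, b, c) \<Rightarrow> coef \<mu> a b c) \<in> {1, -1}"
          by (elim SigmaE) (simp only: prod.case coef_sign)
      qed
      show "?I \<rightarrow>\<^sub>E {1, -1} \<subseteq> ?f ` sign_tensors"
      proof
        fix g assume g: "g \<in> ?I \<rightarrow>\<^sub>E {1, -1 :: int}"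
        have "g (a, b, c) \<in> {1, -1}" if "a \<in> {0,1}" "b \<in> {0,1}" "c \<in> {0,1}" for a b c
          using g that by blast
        from sign_tensor_exists[of "\<lambda>a b c. g (a, b, c)", OF this]
        obtain \<mu> where \<mu>: "\<mu> \<in> sign_tensors"
          and "\<forall>a\<in>{0,1}. \<forall>b\<in>{0,1}. \<forall>c\<in>{0,1}. coef \<mu> a b c = g (a, b, c)" ..
        then have coef: "coef \<mu> a b c = g (a, b, c)"
          if "a \<in> {0,1}" "b \<in> {0,1}" "c \<in> {0,1}" for a b c
          using that by blast
        have "?f \<mu> = restrict g ?I"
          by (rule restrict_ext) (elim SigmaE, simp only: prod.case coef)
        also have "\<dots> = g"
          using g by (simp only: PiE_restrict)
        finally have "g = ?f \<mu>"
          by (rule sym)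
        then show "g \<in> ?f ` sign_tensors"
          using \<mu> by (rule image_eqI[where f = ?f and x = \<mu>])
      qed
    qed
  qed
  then have "card sign_tensors = card (?I \<rightarrow>\<^sub>E {1, -1 :: int})"
    by (rule bij_betw_same_card)
  also have "\<dots> = 256"
    by (simp add: card_PiE)
  finally show ?thesis .
qed

lemma degenerate_ratio:
  assumes \<mu>: "\<mu> \<in> sign_tensors" and "degenerate \<mu>" and "a \<in> {0,1}" "b \<in> {0,1}"
  shows "coef \<mu> a b 1 = coef \<mu> 0 0 0 * coef \<mu> 0 0 1 * coef \<mu> a b 0"
proof -
  obtain \<rho> where "proportional (coef \<mu>) \<rho>"
    using assms(2) by (auto simp: degenerate_def)
  then have \<rho>: "coef \<mu> a b 1 = \<rho> * coef \<mu> a b 0" if "a \<in> {0,1}" "b \<in> {0,1}" for a b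
    using that unfolding proportional_def by blast
  have "coef \<mu> 0 0 0 \<in> {1, -1}"
    by (rule coef_sign[OF \<mu>]; simp)
  then show ?thesis
    using \<rho>[of 0 0] \<rho>[OF assms(3,4)] by auto
qed

text \<open>Such a tensor is determined by its ratio and its slice \<open>c = 0\<close>, both
  arbitrary: \<open>2 * 2 ^ 4\<close> choices.\<close>

lemma card_degenerate: "card {\<mu> \<in> sign_tensors. degenerate \<mu>} = 32"
proof -
  let ?J = "{0,1} \<times> {0,1} :: (nat \<times> nat) set"
  let ?f = "\<lambda>\<mu>. (coef \<mu> 0 0 0 * coef \<mu> 0 0 1, \<lambda>(a, b)\<in>?J. coef \<mu> a b 0)"
  have "bij_betw ?f {\<mu> \<in> sign_tensors. degenerate \<mu>} ({1, -1} \<times> (?J \<rightarrow>\<^sub>E {1, -1}))"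
  proof (rule bij_betw_imageI)
    show "inj_on ?f {\<mu> \<in> sign_tensors. degenerate \<mu>}"
    proof (rule inj_onI, elim CollectE conjE)
      fix \<mu> \<nu> assume \<mu>: "\<mu> \<in> sign_tensors" "degenerate \<mu>" and \<nu>: "\<nu> \<in> sign_tensors" "degenerate \<nu>"
        and eq: "?f \<mu> = ?f \<nu>"
      from \<mu>(1) \<nu>(1) show "\<mu> = \<nu>"
      proof (rule sign_tensor_eqI)
        fix a b c :: nat assume abc: "a \<in> {0,1}" "b \<in> {0,1}" "c \<in> {0,1}"
        have 0: "coef \<mu> a b 0 = coef \<nu> a b 0"
        proof -
          have "(a, b) \<in> ?J"
            using abc by blast
          then show ?thesis
            using fun_cong[OF arg_cong[OF eq, of snd], of "(a, b)"]
            by (simp only: snd_conv restrict_apply' prod.case)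
        qed
        moreover have "coef \<mu> a b 1 = coef \<nu> a b 1"
          using degenerate_ratio[OF \<mu> abc(1,2)] degenerate_ratio[OF \<nu> abc(1,2)] 0
            arg_cong[OF eq, of fst] by (simp only: fst_conv)
        ultimately show "coef \<mu> a b c = coef \<nu> a b c"
          using abc(3) by auto
      qed
    qed
    show "?f ` {\<mu> \<in> sign_tensors. degenerate \<mu>} = {1, -1} \<times> (?J \<rightarrow>\<^sub>E {1, -1})"
    proof
      show "?f ` {\<mu> \<in> sign_tensors. degenerate \<mu>} \<subseteq> {1, -1} \<times> (?J \<rightarrow>\<^sub>E {1, -1})"
      proof (rule image_subsetI, elim CollectE conjE)
        fix \<mu> assume \<mu>: "\<mu> \<in> sign_tensors"
        have "coef \<mu> 0 0 0 \<in> {1, -1}" "coef \<mu> 0 0 1 \<in> {1, -1}"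
          by (rule coef_sign[OF \<mu>]; simp)+
        then have "coef \<mu> 0 0 0 * coef \<mu> 0 0 1 \<in> {1, -1}"
          by auto
        moreover have "(\<lambda>(a, b)\<in>?J. coef \<mu> a b 0) \<in> ?J \<rightarrow>\<^sub>E {1, -1}"
          unfolding restrict_PiE_iff
          by (intro ballI, elim SigmaE) (simp only: prod.case coef_sign[OF \<mu> _ _ insertI1])
        ultimately show "?f \<mu> \<in> {1, -1} \<times> (?J \<rightarrow>\<^sub>E {1, -1})"
          by (rule SigmaI)
      qed
      show "{1, -1} \<times> (?J \<rightarrow>\<^sub>E {1, -1}) \<subseteq> ?f ` {\<mu> \<in> sign_tensors. degenerate \<mu>}"
      proof
        fix p assume "p \<in> {1, -1 :: int} \<times> (?J \<rightarrow>\<^sub>E {1, -1 :: int})"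
        then obtain \<rho> g where p: "p = (\<rho>, g)" and \<rho>: "\<rho> \<in> {1, -1}" and g: "g \<in> ?J \<rightarrow>\<^sub>E {1, -1}"
          by blast
        have g_sign: "g (a, b) \<in> {1, -1}" if "a \<in> {0,1}" "b \<in> {0,1}" for a b
          using g that by blast
        have "\<rho> ^ c * g (a, b) \<in> {1, -1}" if "a \<in> {0,1}" "b \<in> {0,1}" "c \<in> {0,1}"
          for a b c :: nat
          using \<rho> g_sign[OF that(1,2)] that(3) by auto
        from sign_tensor_exists[of "\<lambda>a b c. \<rho> ^ c * g (a, b)", OF this]
        obtain \<mu> where \<mu>: "\<mu> \<in> sign_tensors"
          and "\<forall>a\<in>{0,1}. \<forall>b\<in>{0,1}. \<forall>c\<in>{0,1}. coef \<mu> a b c = \<rho> ^ c * g (a, b)" ..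
        then have coef: "coef \<mu> a b c = \<rho> ^ c * g (a, b)"
          if "a \<in> {0,1}" "b \<in> {0,1}" "c \<in> {0,1}" for a b c
          using that by blast
        have "proportional (coef \<mu>) \<rho>"
          unfolding proportional_def by (simp add: coef)
        then have "degenerate \<mu>"
          using \<rho> by (auto simp: degenerate_def)
        moreover have "coef \<mu> 0 0 0 * coef \<mu> 0 0 1 = \<rho>"
          using g_sign[of 0 0] by (auto simp: coef)
        moreover have "(\<lambda>(a, b)\<in>?J. coef \<mu> a b 0) = restrict g ?J"
          by (rule restrict_ext) (elim SigmaE, simp only: prod.case coef[OF _ _ insertI1]
            power_0 mult_1_left)
        moreover have "\<dots> = g"
          using g by (simp only: PiE_restrict)
        ultimately show "p \<in> ?f ` {\<mu> \<in> sign_tensors. degenerate \<mu>}"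
          unfolding p using \<mu> by (intro image_eqI[where x = \<mu>]) simp_all
      qed
    qed
  qed
  then have "card {\<mu> \<in> sign_tensors. degenerate \<mu>} = card ({1, -1 :: int} \<times> (?J \<rightarrow>\<^sub>E {1, -1 :: int}))"
    by (rule bij_betw_same_card)
  also have "\<dots> = 32"
    by (simp add: card_PiE card_cartesian_product)
  finally show ?thesis .
qed

text \<open>The parameters \<open>s\<close> and \<open>\<rho>\<close> are recovered from the tensor
  as \<open>coef \<mu> 0 0 0\<close> and \<open>coef \<mu> 0 0 0 * coef \<mu> 0 0 1\<close>, and
  every pair of signs occurs.\<close>

lemma card_exceptional: "card {\<mu> \<in> sign_tensors. exceptional \<mu>} = 4"
proof -
  let ?f = "\<lambda>\<mu>. (coef \<mu> 0 0 0, coef \<mu> 0 0 0 * coef \<mu> 0 0 1)"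
  have exceptional_coef: "coef \<mu> a b c = coef \<mu> 0 0 0 * (coef \<mu> 0 0 0 * coef \<mu> 0 0 1) ^ (a + b + c)"
    if exceptional: "exceptional \<mu>" and abc: "a \<in> {0,1}" "b \<in> {0,1}" "c \<in> {0,1}" for \<mu> a b c
  proof -
    obtain \<rho> where "geometric (coef \<mu>) \<rho>"
      using exceptional unfolding exceptional_def by blast
    then obtain s where s: "s \<in> {1, -1}"
      and "\<forall>a\<in>{0,1}. \<forall>b\<in>{0,1}. \<forall>c\<in>{0,1}. coef \<mu> a b c = s * \<rho> ^ (a + b + c)"
      unfolding geometric_def ..
    then have M: "coef \<mu> a b c = s * \<rho> ^ (a + b + c)"
      if "a \<in> {0,1}" "b \<in> {0,1}" "c \<in> {0,1}" for a b c
      using that by blast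
    have "coef \<mu> 0 0 0 = s" "coef \<mu> 0 0 1 = s * \<rho>"
      using M[of 0 0 0] M[of 0 0 1] by simp_all
    moreover have "s * (s * \<rho>) = \<rho>"
      using s by auto
    ultimately show ?thesis
      by (simp only: M[OF abc])
  qed
  have "bij_betw ?f {\<mu> \<in> sign_tensors. exceptional \<mu>} ({1, -1} \<times> {1, -1})"
  proof (rule bij_betw_imageI)
    show "inj_on ?f {\<mu> \<in> sign_tensors. exceptional \<mu>}"
    proof (rule inj_onI, elim CollectE conjE)
      fix \<mu> \<nu> assume \<mu>: "\<mu> \<in> sign_tensors" "exceptional \<mu>" and \<nu>: "\<nu> \<in> sign_tensors" "exceptional \<nu>"
        and eq: "?f \<mu> = ?f \<nu>"
      from \<mu>(1) \<nu>(1) show "\<mu> = \<nu>"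
      proof (rule sign_tensor_eqI)
        fix a b c :: nat assume abc: "a \<in> {0,1}" "b \<in> {0,1}" "c \<in> {0,1}"
        show "coef \<mu> a b c = coef \<nu> a b c"
          using arg_cong[OF eq, of "\<lambda>p. fst p * snd p ^ (a + b + c)"]
          unfolding exceptional_coef[OF \<mu>(2) abc] exceptional_coef[OF \<nu>(2) abc] fst_conv snd_conv .
      qed
    qed
    show "?f ` {\<mu> \<in> sign_tensors. exceptional \<mu>} = {1, -1} \<times> {1, -1}"
    proof
      show "?f ` {\<mu> \<in> sign_tensors. exceptional \<mu>} \<subseteq> {1, -1} \<times> {1, -1}"
      proof (rule image_subsetI, elim CollectE conjE)
        fix \<mu> assume \<mu>: "\<mu> \<in> sign_tensors"
        have "coef \<mu> 0 0 0 \<in> {1, -1}" "coef \<mu> 0 0 1 \<in> {1, -1}"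
          by (rule coef_sign[OF \<mu>]; simp)+
        then show "?f \<mu> \<in> {1, -1} \<times> {1, -1}"
          by auto
      qed
      show "{1, -1} \<times> {1, -1} \<subseteq> ?f ` {\<mu> \<in> sign_tensors. exceptional \<mu>}"
      proof
        fix p assume "p \<in> {1, -1 :: int} \<times> {1, -1 :: int}"
        then obtain s \<rho> where p: "p = (s, \<rho>)" and s: "s \<in> {1, -1}" and \<rho>: "\<rho> \<in> {1, -1}"
          by blast
        have "\<rho> ^ n \<in> {1, -1}" for n
          by (induction n) (use \<rho> in auto)
        then have "s * \<rho> ^ n \<in> {1, -1}" for n
          using s by fastforce
        from sign_tensor_exists[of "\<lambda>a b c. s * \<rho> ^ (a + b + c)", OF this]
        obtain \<mu> where \<mu>: "\<mu> \<in> sign_tensors"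
          and "\<forall>a\<in>{0,1}. \<forall>b\<in>{0,1}. \<forall>c\<in>{0,1}. coef \<mu> a b c = s * \<rho> ^ (a + b + c)" ..
        then have coef: "coef \<mu> a b c = s * \<rho> ^ (a + b + c)"
          if "a \<in> {0,1}" "b \<in> {0,1}" "c \<in> {0,1}" for a b c
          using that by blast
        have "geometric (coef \<mu>) \<rho>"
          unfolding geometric_def using coef s by blast
        then have "exceptional \<mu>"
          using \<rho> by (auto simp: exceptional_def)
        moreover have "?f \<mu> = p"
          using s by (auto simp: coef p)
        ultimately show "p \<in> ?f ` {\<mu> \<in> sign_tensors. exceptional \<mu>}"
          using \<mu> by blast
      qed
    qed
  qed
  then have "card {\<mu> \<in> sign_tensors. exceptional \<mu>} = card ({1, -1 :: int} \<times> {1, -1 :: int})"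
    by (rule bij_betw_same_card)
  then show ?thesis
    by (simp add: card_cartesian_product)
qed

lemma exceptional_iff:
  "exceptional \<mu> \<longleftrightarrow> (\<exists>s \<in> {1, -1}.
     (\<forall>a\<in>{0,1}. \<forall>b\<in>{0,1}. \<forall>c\<in>{0,1}. \<mu> (e a \<otimes>\<^sub>\<int> e b \<otimes>\<^sub>\<int> e c) = s) \<or>
     (\<forall>a\<in>{0,1}. \<forall>b\<in>{0,1}. \<forall>c\<in>{0,1}. \<mu> (e a \<otimes>\<^sub>\<int> e b \<otimes>\<^sub>\<int> e c) = s * (-1) ^ (a + b + c)))"
  unfolding exceptional_def geometric_def coef_def power_one mult_1_right by blast

theorem theorem17p3:
  shows
    "card sign_tensors = 256 \<and>
     sign_tensors =
       sign_tensors_with 2 0 (integer_mod_group 2) \<union>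
       sign_tensors_with 1 0 (integer_mod_group 2) \<union>
       sign_tensors_with 1 1 (integer_mod_group 1) \<and>
     card (sign_tensors_with 2 0 (integer_mod_group 2)) = 224 \<and>
     (\<forall>\<mu> \<in> sign_tensors_with 2 0 (integer_mod_group 2).
        middle_coker \<mu> \<cong> integer_mod_group 2 \<and>
        operator_defect (T_op \<mu>) \<cong>
          integer_group \<times>\<times> integer_group \<times>\<times> integer_mod_group 2) \<and>
     card (sign_tensors_with 1 0 (integer_mod_group 2)) = 28 \<and>
     (\<forall>\<mu> \<in> sign_tensors_with 1 0 (integer_mod_group 2).
        middle_coker \<mu> \<cong> integer_mod_group 2 \<and>
        operator_defect (T_op \<mu>) \<cong>
          integer_group \<times>\<times> integer_group \<times>\<times> integer_group \<times>\<times> integer_mod_group 2) \<and>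
     card (sign_tensors_with 1 1 (integer_mod_group 1)) = 4 \<and>
     (\<forall>\<mu> \<in> sign_tensors_with 1 1 (integer_mod_group 1).
        middle_coker \<mu> \<cong> integer_group \<and>
        operator_defect (T_op \<mu>) \<cong>
          integer_group \<times>\<times> integer_group \<times>\<times> integer_group \<times>\<times> integer_group) \<and>
     sign_tensors_with 1 1 (integer_mod_group 1) =
       {\<mu> \<in> sign_tensors. \<exists>s \<in> {1, -1}.
          (\<forall>a\<in>{0,1}. \<forall>b\<in>{0,1}. \<forall>c\<in>{0,1}. \<mu> (e a \<otimes>\<^sub>\<int> e b \<otimes>\<^sub>\<int> e c) = s) \<or>
          (\<forall>a\<in>{0,1}. \<forall>b\<in>{0,1}. \<forall>c\<in>{0,1}. \<mu> (e a \<otimes>\<^sub>\<int> e b \<otimes>\<^sub>\<int> e c) = s * (-1) ^ (a + b + c))} \<and>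
     (\<forall>\<mu> \<in> sign_tensors - sign_tensors_with 1 1 (integer_mod_group 1).
        primary_part 2 (tors (middle_coker \<mu>)) \<noteq> {\<one>\<^bsub>tors (middle_coker \<mu>)\<^esub>})"
proof -
  have fin: "finite sign_tensors"
    using card_sign_tensors by (simp add: card_ge_0_finite)
  have "{\<mu> \<in> sign_tensors. \<not> degenerate \<mu>} = sign_tensors - {\<mu> \<in> sign_tensors. degenerate \<mu>}"
    by blast
  then have card_2: "card {\<mu> \<in> sign_tensors. \<not> degenerate \<mu>} = 224"
    using fin by (simp add: card_Diff_subset card_sign_tensors card_degenerate)
  have "{\<mu> \<in> sign_tensors. degenerate \<mu> \<and> \<not> exceptional \<mu>} =
      {\<mu> \<in> sign_tensors. degenerate \<mu>} - {\<mu> \<in> sign_tensors. exceptional \<mu>}"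
    by blast
  \<comment> \<open>This inclusion justifies the subtraction \<open>32 - 4\<close>.\<close>
  moreover have "{\<mu> \<in> sign_tensors. exceptional \<mu>} \<subseteq> {\<mu> \<in> sign_tensors. degenerate \<mu>}"
    using exceptional_imp_degenerate by blast
  ultimately have card_1: "card {\<mu> \<in> sign_tensors. degenerate \<mu> \<and> \<not> exceptional \<mu>} = 28"
    using fin by (simp add: card_Diff_subset card_degenerate card_exceptional)
  have coker_2: "middle_coker \<mu> \<cong> integer_mod_group 2"
    and defect_2: "operator_defect (T_op \<mu>) \<cong>
      integer_group \<times>\<times> integer_group \<times>\<times> integer_mod_group 2"
    if "\<mu> \<in> {\<mu> \<in> sign_tensors. \<not> degenerate \<mu>}" for \<mu>
  proof -
    have \<mu>: "\<mu> \<in> sign_tensors" "\<not> degenerate \<mu>" and "\<not> exceptional \<mu>"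
      using that exceptional_imp_degenerate by blast+
    then show coker: "middle_coker \<mu> \<cong> integer_mod_group 2"
      by (intro nonexceptional_invariants)
    show "operator_defect (T_op \<mu>) \<cong>
        integer_group \<times>\<times> integer_group \<times>\<times> integer_mod_group 2"
      by (rule operator_defect_rank2[OF \<mu> coker])
  qed
  have coker_1: "middle_coker \<mu> \<cong> integer_mod_group 2"
    and defect_1: "operator_defect (T_op \<mu>) \<cong>
      integer_group \<times>\<times> integer_group \<times>\<times> integer_group \<times>\<times> integer_mod_group 2"
    if "\<mu> \<in> {\<mu> \<in> sign_tensors. degenerate \<mu> \<and> \<not> exceptional \<mu>}" for \<mu>
  proof -
    have \<mu>: "\<mu> \<in> sign_tensors" "degenerate \<mu>" and "\<not> exceptional \<mu>"
      using that by blast+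
    then show coker: "middle_coker \<mu> \<cong> integer_mod_group 2"
      by (intro nonexceptional_invariants)
    show "operator_defect (T_op \<mu>) \<cong>
        integer_group \<times>\<times> integer_group \<times>\<times> integer_group \<times>\<times> integer_mod_group 2"
      by (rule operator_defect_rank1[OF \<mu> coker])
  qed
  have coker_exceptional: "middle_coker \<mu> \<cong> integer_group"
    and defect_exceptional: "operator_defect (T_op \<mu>) \<cong>
      integer_group \<times>\<times> integer_group \<times>\<times> integer_group \<times>\<times> integer_group"
    if "\<mu> \<in> {\<mu> \<in> sign_tensors. exceptional \<mu>}" for \<mu>
  proof -
    have \<mu>: "\<mu> \<in> sign_tensors" "degenerate \<mu>" and "exceptional \<mu>"
      using that exceptional_imp_degenerate by blast+
    then show coker: "middle_coker \<mu> \<cong> integer_group"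
      by (intro exceptional_middle_coker)
    show "operator_defect (T_op \<mu>) \<cong>
        integer_group \<times>\<times> integer_group \<times>\<times> integer_group \<times>\<times> integer_group"
      by (rule operator_defect_rank1[OF \<mu> coker])
  qed
  have union: "sign_tensors = {\<mu> \<in> sign_tensors. \<not> degenerate \<mu>} \<union>
      {\<mu> \<in> sign_tensors. degenerate \<mu> \<and> \<not> exceptional \<mu>} \<union> {\<mu> \<in> sign_tensors. exceptional \<mu>}"
    using exceptional_imp_degenerate by blast
  have primary: "primary_part 2 (tors (middle_coker \<mu>)) \<noteq> {\<one>\<^bsub>tors (middle_coker \<mu>)\<^esub>}"
    if "\<mu> \<in> sign_tensors - {\<mu> \<in> sign_tensors. exceptional \<mu>}" for \<mu>
    using that by (intro nonexceptional_invariants) blast+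
  show ?thesis
    unfolding sign_tensors_with_2_0 sign_tensors_with_1_0 sign_tensors_with_1_1 exceptional_iff[symmetric]
    by (intro conjI ballI card_sign_tensors union card_2 coker_2 defect_2 card_1 coker_1 defect_1
        card_exceptional coker_exceptional defect_exceptional refl primary)
qed

end
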